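(* Let $(\mathcal{E},D(\mathcal{E}))$ be a transient symmetric regular Dirichlet form on $L^2(E;m)$ with generator $L$ and extended Dirichlet space $D_e(\mathcal{E})$, let $\mu\in\mathcal{M}_{0,b}$ be a diffuse measure and let $f:E\times\mathbb{R}\to\mathbb{R}$ be a Carathéodory function such that $$f(x,0)=0,\qquad f(x,y)y\le0,\qquad x\in E,\ y\in\mathbb{R}.$$ If $u$ is a solution (in the sense of duality) of $-Lu=f(\cdot,u)+\mu$, then for every $k\ge0$, $T_k(u)\in D_e(\mathcal{E})$ and $$\mathcal{E}(T_k(u),T_k(u))\le 2k\|\mu\|_{TV}.$$
   Context: Setting. $E$ is a locally compact separable metric space; $m$ is a Radon measure on $E$ (nonnegative Borel measure, finite on compact sets) with $\mathrm{supp}[m]=E$; $(\cdot,\cdot)$ is the inner product of $L^2(E;m)$. $(\mathcal{E},D(\mathcal{E}))$ is a symmetric regular Dirichlet form on $L^2(E;m)$ which is transient: there is a bounded $g\in L^1(E;m)$, $g>0$ $m$-a.e., with $\int_E|u|g\,dm\le\mathcal{E}(u,u)^{1/2}$ for all $u\in D(\mathcal{E})$. $L$ is the unique nonpositive self-adjoint operator on $L^2(E;m)$ with $D(L)\subset D(\mathcal{E})$ and $\mathcal{E}(u,v)=(-Lu,v)$ for $u\in D(L)$, $v\in D(\mathcal{E})$. The extended Dirichlet space $D_e(\mathcal{E})$ consists of ($m$-classes of) $m$-a.e. finite measurable functions $u$ that are $m$-a.e. limits of $\mathcal{E}$-Cauchy sequences $\{u_n\}\subset D(\mathcal{E})$,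 with $\mathcal{E}(u,u)=\lim_n\mathcal{E}(u_n,u_n)$. Capacity. For $U\subset E$ open, $\mathrm{Cap}_{(0)}(U)=\inf\{\mathcal{E}(u,u):u\in D_e(\mathcal{E}),\,u\ge1\ m\text{-a.e. on }U\}$ ($\inf\emptyset=\infty$); for arbitrary $A\subset E$, $\mathrm{Cap}_{(0)}(A)=\inf\{\mathrm{Cap}_{(0)}(U):U\supset A\text{ open}\}$. A function is quasi-continuous if for every $\varepsilon>0$ there is an open $U$ with $\mathrm{Cap}_{(0)}(U)<\varepsilon$ such that its restriction to $E\setminus U$ is continuous. $\tilde u$ denotes a quasi-continuous $m$-version of $u$. Measures. $\mathcal{M}_{0,b}$ is the space of finite signed Borel measures on $E$ charging no set of $\mathrm{Cap}_{(0)}$ zero (diffuse measures); $\|\mu\|_{TV}=|\mu|(E)$. Potentials. $(G_\alpha)_{\alpha>0}$ is the $L^2(E;m)$-resolvent of $\mathcal{E}$, extended to nonnegative Borel functions by monotone limits; for nonnegative Borel $\eta$, $G\eta=\sup_{\alpha>0}G_\alpha\eta$ $m$-a.e.; for signed $\eta$ with $G|\eta|<\infty$ $m$-a.e., $G\eta=G\eta^+-G\eta^-$. For $\eta\in L^1(E;m)$, $G\eta$ has a quasi-continuous $m$-version $\widetilde{G\eta}$. Carathéodory: $f(\cdot,y)$ is measurable for each $y$, and $f(x,\cdot)$ is continuous for each $x$. Solution. $u:E\to\mathbb{R}$ (measurable) is a solution of $-Lu=f(\cdot,u)+\mu$ in the sense of duality if (a) $f(\cdot,u)\in L^1(E;m)$,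 and (b) for every $\eta\in L^1(E;m)$ such that $G|\eta|$ is bounded, $$\int_E u\,\eta\,dm=\int_E f(x,u(x))\,G\eta(x)\,m(dx)+\int_E\widetilde{G\eta}\,d\mu .$$ Truncation: $T_k(u)(x)=((-k)\vee u(x))\wedge k$. *)

theory Defs
  imports "HOL-Analysis.Analysis"
begin

text \<open>
  Elements of \<open>L\<^sup>2(E;m)\<close> and the other \<open>m\<close>-classes are represented by Borel functions on the
  type \<open>'a\<close> (the space \<open>E\<close>). A form is a pair \<open>D\<close>, \<open>\<E>\<close> of a set of functions and a two-place map,
  required to respect equality \<open>m\<close>-a.e.; values of \<open>\<E>\<close> outside \<open>D\<close> are irrelevant.
\<close>

section \<open>Measures\<close>

definition Radon_full_support :: "'a::metric_space measure \<Rightarrow> bool" where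
  "Radon_full_support m \<longleftrightarrow>
     sets m = sets borel \<and>
     (\<forall>K. compact K \<longrightarrow> emeasure m K < \<infinity>) \<and>
     {x. \<forall>U. open U \<longrightarrow> x \<in> U \<longrightarrow> emeasure m U > 0} = UNIV"

text \<open>Finite signed Borel measures are real-valued countably additive set functions
  (only their values on Borel sets matter).\<close>

definition finite_signed_measure :: "('a::topological_space set \<Rightarrow> real) \<Rightarrow> bool" where
  "finite_signed_measure \<mu> \<longleftrightarrow>
     \<mu> {} = 0 \<and>
     (\<forall>A. range A \<subseteq> sets borel \<longrightarrow> disjoint_family A \<longrightarrow> (\<lambda>n. \<mu> (A n)) sums \<mu> (\<Union>n. A n))"

text \<open>Jordan decomposition: \<open>\<mu>\<^sup>+(A)\<close> is the supremum of \<open>\<mu>(B)\<close> over Borel \<open>B \<subseteq> A\<close>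
  (\<open>B = {}\<close> is allowed, so that \<open>ennreal\<close> cutting off negative values is harmless), and
  \<open>\<mu>\<^sup>- = (-\<mu>)\<^sup>+\<close>.\<close>

definition pos_part :: "('a::topological_space set \<Rightarrow> real) \<Rightarrow> 'a measure" where
  "pos_part \<mu> = measure_of UNIV (sets borel) (\<lambda>A. SUP B\<in>{B \<in> sets borel. B \<subseteq> A}. ennreal (\<mu> B))"

definition neg_part :: "('a::topological_space set \<Rightarrow> real) \<Rightarrow> 'a measure" where
  "neg_part \<mu> = pos_part (\<lambda>A. - \<mu> A)"

definition variation :: "('a::topological_space set \<Rightarrow> real) \<Rightarrow> 'a set \<Rightarrow> ennreal" where
  "variation \<mu> A = emeasure (pos_part \<mu>) A + emeasure (neg_part \<mu>) A"

definition TV_norm :: "('a::topological_space set \<Rightarrow> real) \<Rightarrow> real" where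
  "TV_norm \<mu> = enn2real (variation \<mu> UNIV)"

definition signed_integral :: "('a::topological_space set \<Rightarrow> real) \<Rightarrow> ('a \<Rightarrow> real) \<Rightarrow> real" where
  "signed_integral \<mu> w = (LINT x|pos_part \<mu>. w x) - (LINT x|neg_part \<mu>. w x)"


section \<open>Dirichlet forms\<close>

definition L2 :: "'a measure \<Rightarrow> ('a \<Rightarrow> real) set" where
  "L2 m = {u \<in> borel_measurable m. integrable m (\<lambda>x. (u x)\<^sup>2)}"

definition L2_inner :: "'a measure \<Rightarrow> ('a \<Rightarrow> real) \<Rightarrow> ('a \<Rightarrow> real) \<Rightarrow> real" where
  "L2_inner m u v = (LINT x|m. u x * v x)"

definition form_alpha ::
    "'a measure \<Rightarrow> (('a \<Rightarrow> real) \<Rightarrow> ('a \<Rightarrow> real) \<Rightarrow> real) \<Rightarrow> real \<Rightarrow> ('a \<Rightarrow> real) \<Rightarrow> ('a \<Rightarrow> real) \<Rightarrow> real"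
  where "form_alpha m \<E> \<alpha> u v = \<E> u v + \<alpha> * L2_inner m u v"

definition form_Cauchy ::
    "(('a \<Rightarrow> real) \<Rightarrow> ('a \<Rightarrow> real) \<Rightarrow> real) \<Rightarrow> (nat \<Rightarrow> 'a \<Rightarrow> real) \<Rightarrow> bool" where
  "form_Cauchy \<E> s \<longleftrightarrow>
     (\<forall>e>0. \<exists>N. \<forall>i\<ge>N. \<forall>j\<ge>N. \<E> (\<lambda>x. s i x - s j x) (\<lambda>x. s i x - s j x) < e)"

definition symmetric_form ::
    "'a measure \<Rightarrow> ('a \<Rightarrow> real) set \<Rightarrow> (('a \<Rightarrow> real) \<Rightarrow> ('a \<Rightarrow> real) \<Rightarrow> real) \<Rightarrow> bool" where
  "symmetric_form m D \<E> \<longleftrightarrow>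
     D \<subseteq> L2 m \<and>
     (\<lambda>x. 0) \<in> D \<and>
     (\<forall>u\<in>D. \<forall>v\<in>D. (\<lambda>x. u x + v x) \<in> D) \<and>
     (\<forall>c. \<forall>u\<in>D. (\<lambda>x. c * u x) \<in> D) \<and>
     (\<forall>u\<in>D. \<forall>v\<in>borel_measurable m. (AE x in m. u x = v x) \<longrightarrow> v \<in> D \<and> (\<forall>w\<in>D. \<E> v w = \<E> u w)) \<and>
     (\<forall>f\<in>L2 m. \<forall>e>0. \<exists>u\<in>D. L2_inner m (\<lambda>x. f x - u x) (\<lambda>x. f x - u x) < e) \<and>
     (\<forall>u\<in>D. \<forall>v\<in>D. \<forall>w\<in>D. \<E> (\<lambda>x. u x + v x) w = \<E> u w + \<E> v w) \<and>
     (\<forall>c. \<forall>u\<in>D. \<forall>v\<in>D. \<E> (\<lambda>x. c * u x) v = c * \<E> u v) \<and>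
     (\<forall>u\<in>D. \<forall>v\<in>D. \<E> u v = \<E> v u) \<and>
     (\<forall>u\<in>D. 0 \<le> \<E> u u)"

definition closed_form ::
    "'a measure \<Rightarrow> ('a \<Rightarrow> real) set \<Rightarrow> (('a \<Rightarrow> real) \<Rightarrow> ('a \<Rightarrow> real) \<Rightarrow> real) \<Rightarrow> bool" where
  "closed_form m D \<E> \<longleftrightarrow>
     (\<forall>s. (\<forall>n. s n \<in> D) \<and> form_Cauchy (form_alpha m \<E> 1) s \<longrightarrow>
       (\<exists>u\<in>D. (\<lambda>n. form_alpha m \<E> 1 (\<lambda>x. s n x - u x) (\<lambda>x. s n x - u x)) \<longlonglongrightarrow> 0))"

definition Markovian ::
    "('a \<Rightarrow> real) set \<Rightarrow> (('a \<Rightarrow> real) \<Rightarrow> ('a \<Rightarrow> real) \<Rightarrow> real) \<Rightarrow> bool" where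
  "Markovian D \<E> \<longleftrightarrow>
     (\<forall>u\<in>D. (\<lambda>x. min (max 0 (u x)) 1) \<in> D \<and>
       \<E> (\<lambda>x. min (max 0 (u x)) 1) (\<lambda>x. min (max 0 (u x)) 1) \<le> \<E> u u)"

definition Dirichlet_form ::
    "'a measure \<Rightarrow> ('a \<Rightarrow> real) set \<Rightarrow> (('a \<Rightarrow> real) \<Rightarrow> ('a \<Rightarrow> real) \<Rightarrow> real) \<Rightarrow> bool" where
  "Dirichlet_form m D \<E> \<longleftrightarrow> symmetric_form m D \<E> \<and> closed_form m D \<E> \<and> Markovian D \<E>"

definition Cc :: "('a::topological_space \<Rightarrow> real) set" where
  "Cc = {\<phi>. continuous_on UNIV \<phi> \<and> compact (closure {x. \<phi> x \<noteq> 0})}"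

definition regular_form ::
    "'a::topological_space measure \<Rightarrow> ('a \<Rightarrow> real) set \<Rightarrow> (('a \<Rightarrow> real) \<Rightarrow> ('a \<Rightarrow> real) \<Rightarrow> real) \<Rightarrow> bool" where
  "regular_form m D \<E> \<longleftrightarrow>
     (\<forall>u\<in>D. \<forall>e>0. \<exists>\<phi>\<in>D \<inter> Cc. form_alpha m \<E> 1 (\<lambda>x. u x - \<phi> x) (\<lambda>x. u x - \<phi> x) < e) \<and>
     (\<forall>\<psi>\<in>Cc. \<forall>e>0. \<exists>\<phi>\<in>D \<inter> Cc. \<forall>x. \<bar>\<psi> x - \<phi> x\<bar> < e)"

definition transient_form ::
    "'a measure \<Rightarrow> ('a \<Rightarrow> real) set \<Rightarrow> (('a \<Rightarrow> real) \<Rightarrow> ('a \<Rightarrow> real) \<Rightarrow> real) \<Rightarrow> bool" where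
  "transient_form m D \<E> \<longleftrightarrow>
     (\<exists>g. bounded (range g) \<and> integrable m g \<and> (AE x in m. 0 < g x) \<and>
       (\<forall>u\<in>D. (LINT x|m. \<bar>u x\<bar> * g x) \<le> sqrt (\<E> u u)))"


section \<open>Extended Dirichlet space and capacity\<close>

definition approx_seq ::
    "'a measure \<Rightarrow> ('a \<Rightarrow> real) set \<Rightarrow> (('a \<Rightarrow> real) \<Rightarrow> ('a \<Rightarrow> real) \<Rightarrow> real) \<Rightarrow>
     (nat \<Rightarrow> 'a \<Rightarrow> real) \<Rightarrow> ('a \<Rightarrow> real) \<Rightarrow> bool" where
  "approx_seq m D \<E> s u \<longleftrightarrow>
     (\<forall>n. s n \<in> D) \<and> form_Cauchy \<E> s \<and> (AE x in m. (\<lambda>n. s n x) \<longlonglongrightarrow> u x)"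

definition ext_domain ::
    "'a measure \<Rightarrow> ('a \<Rightarrow> real) set \<Rightarrow> (('a \<Rightarrow> real) \<Rightarrow> ('a \<Rightarrow> real) \<Rightarrow> real) \<Rightarrow> ('a \<Rightarrow> real) set" where
  "ext_domain m D \<E> = {u \<in> borel_measurable m. \<exists>s. approx_seq m D \<E> s u}"

text \<open>\<open>\<E>(u,u)\<close> for \<open>u\<close> in the extended Dirichlet space; for a transient Dirichlet form the limit
  does not depend on the approximating sequence.\<close>

definition ext_energy ::
    "'a measure \<Rightarrow> ('a \<Rightarrow> real) set \<Rightarrow> (('a \<Rightarrow> real) \<Rightarrow> ('a \<Rightarrow> real) \<Rightarrow> real) \<Rightarrow> ('a \<Rightarrow> real) \<Rightarrow> real" where
  "ext_energy m D \<E> u = (THE c. \<exists>s. approx_seq m D \<E> s u \<and> (\<lambda>n. \<E> (s n) (s n)) \<longlonglongrightarrow> c)"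

definition Cap_open ::
    "'a measure \<Rightarrow> ('a \<Rightarrow> real) set \<Rightarrow> (('a \<Rightarrow> real) \<Rightarrow> ('a \<Rightarrow> real) \<Rightarrow> real) \<Rightarrow> 'a set \<Rightarrow> ennreal" where
  "Cap_open m D \<E> U =
     (INF u\<in>{u \<in> ext_domain m D \<E>. AE x in m. x \<in> U \<longrightarrow> 1 \<le> u x}. ennreal (ext_energy m D \<E> u))"

definition Cap ::
    "'a::topological_space measure \<Rightarrow> ('a \<Rightarrow> real) set \<Rightarrow> (('a \<Rightarrow> real) \<Rightarrow> ('a \<Rightarrow> real) \<Rightarrow> real) \<Rightarrow>
     'a set \<Rightarrow> ennreal" where
  "Cap m D \<E> A = (INF U\<in>{U. open U \<and> A \<subseteq> U}. Cap_open m D \<E> U)"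

definition quasi_continuous ::
    "'a::topological_space measure \<Rightarrow> ('a \<Rightarrow> real) set \<Rightarrow> (('a \<Rightarrow> real) \<Rightarrow> ('a \<Rightarrow> real) \<Rightarrow> real) \<Rightarrow>
     ('a \<Rightarrow> real) \<Rightarrow> bool" where
  "quasi_continuous m D \<E> w \<longleftrightarrow>
     (\<forall>\<epsilon>>0. \<exists>U. open U \<and> Cap m D \<E> U < ennreal \<epsilon> \<and> continuous_on (UNIV - U) w)"

text \<open>A quasi-continuous version is unique up to sets of capacity zero, and can be taken Borel by
  changing it on such a set; Borel measurability makes its integral against a diffuse measure
  meaningful in the sense of Bochner.\<close>

definition qc_version ::
    "'a::topological_space measure \<Rightarrow> ('a \<Rightarrow> real) set \<Rightarrow> (('a \<Rightarrow> real) \<Rightarrow> ('a \<Rightarrow> real) \<Rightarrow> real) \<Rightarrow>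
     ('a \<Rightarrow> real) \<Rightarrow> ('a \<Rightarrow> real) \<Rightarrow> bool" where
  "qc_version m D \<E> v w \<longleftrightarrow>
     w \<in> borel_measurable borel \<and> quasi_continuous m D \<E> w \<and> (AE x in m. w x = v x)"

definition diffuse_measure ::
    "'a::topological_space measure \<Rightarrow> ('a \<Rightarrow> real) set \<Rightarrow> (('a \<Rightarrow> real) \<Rightarrow> ('a \<Rightarrow> real) \<Rightarrow> real) \<Rightarrow>
     ('a set \<Rightarrow> real) \<Rightarrow> bool" where
  "diffuse_measure m D \<E> \<mu> \<longleftrightarrow>
     finite_signed_measure \<mu> \<and> (\<forall>A\<in>sets borel. Cap m D \<E> A = 0 \<longrightarrow> variation \<mu> A = 0)"


section \<open>Resolvent and potentials\<close>

text \<open>\<open>G\<^sub>\<alpha>\<close> is \<open>(\<alpha> - L)\<^sup>-\<^sup>1\<close> on \<open>L\<^sup>2(E;m)\<close>: for \<open>f\<close> in \<open>L\<^sup>2\<close>, \<open>G\<^sub>\<alpha> f\<close> is the \<open>m\<close>-a.e. unique element of \<open>D\<close>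
  with \<open>\<E>(G\<^sub>\<alpha> f, v) + \<alpha> (G\<^sub>\<alpha> f, v) = (f, v)\<close> for all \<open>v\<close> in \<open>D\<close>. The generator \<open>L\<close> enters the notion of
  solution below only through \<open>G\<^sub>\<alpha>\<close>. Here and below, choice picks a representative of an
  \<open>m\<close>-class.\<close>

definition resolvent ::
    "'a measure \<Rightarrow> ('a \<Rightarrow> real) set \<Rightarrow> (('a \<Rightarrow> real) \<Rightarrow> ('a \<Rightarrow> real) \<Rightarrow> real) \<Rightarrow> real \<Rightarrow>
     ('a \<Rightarrow> real) \<Rightarrow> 'a \<Rightarrow> real" where
  "resolvent m D \<E> \<alpha> f = (SOME w. w \<in> D \<and> (\<forall>v\<in>D. form_alpha m \<E> \<alpha> w v = L2_inner m f v))"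

text \<open>Extension to nonnegative Borel functions by monotone limits; the result does not depend,
  up to \<open>m\<close>-null sets, on the approximating sequence \<open>h\<close>.\<close>

definition resolvent_nn ::
    "'a measure \<Rightarrow> ('a \<Rightarrow> real) set \<Rightarrow> (('a \<Rightarrow> real) \<Rightarrow> ('a \<Rightarrow> real) \<Rightarrow> real) \<Rightarrow> real \<Rightarrow>
     ('a \<Rightarrow> ennreal) \<Rightarrow> 'a \<Rightarrow> ennreal" where
  "resolvent_nn m D \<E> \<alpha> \<eta> = (SOME w. w \<in> borel_measurable m \<and>
     (\<exists>h. (\<forall>n. h n \<in> L2 m) \<and> (\<forall>n x. 0 \<le> h n x) \<and> (\<forall>x. incseq (\<lambda>n. h n x)) \<and>
       (\<forall>x. (\<lambda>n. ennreal (h n x)) \<longlonglongrightarrow> \<eta> x) \<and>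
       (AE x in m. (\<lambda>n. ennreal (resolvent m D \<E> \<alpha> (h n) x)) \<longlonglongrightarrow> w x)))"

text \<open>The supremum over all \<open>\<alpha> > 0\<close> is taken in the lattice of \<open>m\<close>-classes (essential supremum): a
  pointwise supremum over uncountably many representatives would depend on their choice.\<close>

definition potential_nn ::
    "'a measure \<Rightarrow> ('a \<Rightarrow> real) set \<Rightarrow> (('a \<Rightarrow> real) \<Rightarrow> ('a \<Rightarrow> real) \<Rightarrow> real) \<Rightarrow>
     ('a \<Rightarrow> ennreal) \<Rightarrow> 'a \<Rightarrow> ennreal" where
  "potential_nn m D \<E> \<eta> = (SOME w. w \<in> borel_measurable m \<and>
     (\<forall>\<alpha>>0. AE x in m. resolvent_nn m D \<E> \<alpha> \<eta> x \<le> w x) \<and>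
     (\<forall>w'\<in>borel_measurable m. (\<forall>\<alpha>>0. AE x in m. resolvent_nn m D \<E> \<alpha> \<eta> x \<le> w' x) \<longrightarrow>
       (AE x in m. w x \<le> w' x)))"

text \<open>\<open>G \<eta> = G \<eta>\<^sup>+ - G \<eta>\<^sup>-\<close>, to be used only if \<open>G \<bar>\<eta>\<bar>\<close> is finite \<open>m\<close>-a.e.; \<open>ennreal\<close> of a real is its
  positive part.\<close>

definition potential ::
    "'a measure \<Rightarrow> ('a \<Rightarrow> real) set \<Rightarrow> (('a \<Rightarrow> real) \<Rightarrow> ('a \<Rightarrow> real) \<Rightarrow> real) \<Rightarrow>
     ('a \<Rightarrow> real) \<Rightarrow> 'a \<Rightarrow> real" where
  "potential m D \<E> \<eta> x =
     enn2real (potential_nn m D \<E> (\<lambda>y. ennreal (\<eta> y)) x) -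
     enn2real (potential_nn m D \<E> (\<lambda>y. ennreal (- \<eta> y)) x)"


section \<open>Solutions in the sense of duality\<close>

definition Caratheodory :: "('a::topological_space \<Rightarrow> real \<Rightarrow> real) \<Rightarrow> bool" where
  "Caratheodory f \<longleftrightarrow>
     (\<forall>y. (\<lambda>x. f x y) \<in> borel_measurable borel) \<and> (\<forall>x. continuous_on UNIV (f x))"

text \<open>The integrability of \<open>u \<eta>\<close>, implicit in writing its integral, has to be stated because the
  Bochner integral of a non-integrable function is \<open>0\<close>. The other two integrands are then
  integrable since \<open>G \<eta>\<close> is bounded \<open>m\<close>-a.e. Since quasi-continuous versions exist and differ only
  on sets not charged by \<open>\<mu>\<close>, it is immaterial which version \<open>w\<close> is used.\<close>

definition duality_solution ::
    "'a::topological_space measure \<Rightarrow> ('a \<Rightarrow> real) set \<Rightarrow> (('a \<Rightarrow> real) \<Rightarrow> ('a \<Rightarrow> real) \<Rightarrow> real) \<Rightarrow>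
     ('a \<Rightarrow> real \<Rightarrow> real) \<Rightarrow> ('a set \<Rightarrow> real) \<Rightarrow> ('a \<Rightarrow> real) \<Rightarrow> bool" where
  "duality_solution m D \<E> f \<mu> u \<longleftrightarrow>
     u \<in> borel_measurable m \<and>
     integrable m (\<lambda>x. f x (u x)) \<and>
     (\<forall>\<eta>. integrable m \<eta> \<longrightarrow>
        (\<exists>C::real. AE x in m. potential_nn m D \<E> (\<lambda>y. ennreal \<bar>\<eta> y\<bar>) x \<le> ennreal C) \<longrightarrow>
        integrable m (\<lambda>x. u x * \<eta> x) \<and>
        (\<exists>w. qc_version m D \<E> (potential m D \<E> \<eta>) w \<and>
          (LINT x|m. u x * \<eta> x) =
            (LINT x|m. f x (u x) * potential m D \<E> \<eta> x) + signed_integral \<mu> w))"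

definition trunc :: "real \<Rightarrow> ('a \<Rightarrow> real) \<Rightarrow> 'a \<Rightarrow> real" where
  "trunc k u x = min (max (- k) (u x)) k"

end

theory Submission
  imports Defs
begin

text \<open>
  The idea is to change time. Let \<open>\<rho> = g\<close> on the set where the potential of the reference function
  \<open>g\<close> is at most \<open>n\<close>, and \<open>\<rho> = 0\<close> elsewhere; by the maximum principle \<open>G \<rho> \<le> n\<close>. For \<open>v = T\<^sub>k u\<close>
  and \<open>\<beta> > 0\<close> let \<open>w\<close> solve \<open>\<E>(w,z) = \<beta> \<integral>(v - w) z \<rho> dm\<close>, so that \<open>w = G \<eta>\<close> with
  \<open>\<eta> = \<beta> \<rho> (v - w)\<close> and \<open>\<bar>w\<bar> \<le> k\<close>. Since \<open>(u - v)(v - w) \<ge> 0\<close> pointwise, testing the equation with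
  \<open>\<eta>\<close> yields \<open>\<E>(w,w) + \<beta> \<integral>(v - w)\<^sup>2 \<rho> dm \<le> \<integral>u \<eta> dm \<le> \<integral>f(x,u) w dm + k \<parallel>\<mu>\<parallel>\<close>; no kernel or
  cutoff is needed. As \<open>n, \<beta> \<rightarrow> \<infinity>\<close>, \<open>w \<rightarrow> v\<close> and \<open>\<integral>f(x,u) v dm \<le> 0\<close>, so a Fatou lemma for the energy
  gives \<open>\<E>(v,v) \<le> k \<parallel>\<mu>\<parallel>\<close>, half of the claimed bound.
\<close>

section \<open>Nonnegative quadratic forms\<close>

text \<open>A solution may only be tested with functions whose absolute value has bounded potential,
  while nothing is known beforehand about the energy of v, nor even that v is square integrable with
  respect to m. The weight \<rho> cures both: v is bounded, so \<rho> v lies in L2, and the absolute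
  value of \<eta> is at most 2 k \<beta> \<rho>, whose potential is bounded. In terms of v, w is
  \<beta> times the \<beta>-resolvent of the form viewed in L2 of \<rho> m, which is why it inherits
  the bound k and tends to v. Two obstacles shape the rest. Completeness of D requires a zero-order
  term bounded below, so w is reached through killing rates tending to 0; ordinary and time-changed
  resolvents are treated together as weak solutions of (\<kappa> - L) w = f with a variable
  coefficient \<kappa>, and all comparison principles come from one quadratic minimization.
  Secondly, the energy of v is a limit along sequences in D, so it has to be shown that this limit
  is independent of the sequence and that a.e. convergence with bounded energies suffices.\<close>

lemma discriminant_bound:
  fixes p q r :: real
  assumes "\<And>t. 0 \<le> r + 2 * t * q + t\<^sup>2 * p" "0 \<le> p"
  shows "q\<^sup>2 \<le> r * p"
proof (cases "p = 0")
  case True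
  have "q = 0"
  proof (rule ccontr)
    assume q: "q \<noteq> 0"
    have "0 \<le> r + 2 * (-(r + 1) / (2 * q)) * q" using assms(1)[of "-(r+1)/(2*q)"] True by simp
    also have "2 * (-(r + 1) / (2 * q)) * q = - (r + 1)" using q by simp
    finally show False by simp
  qed
  then show ?thesis using True by simp
next
  case False
  then have p: "p > 0" using assms(2) by simp
  have "0 \<le> p * (r + 2 * (- q / p) * q + (- q / p)\<^sup>2 * p)"
    using assms(1)[of "- q / p"] p by (intro mult_nonneg_nonneg) auto
  also have "\<dots> = r * p - q\<^sup>2" using p by (simp add: field_simps power2_eq_square)
  finally show ?thesis by simp
qed

text \<open>Only semidefinite, because members of \<open>D\<close> are functions and not m-classes.
  Both \<open>\<E>\<close> and all its weighted versions are instances.\<close>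

locale nonneg_form =
  fixes D :: "('a \<Rightarrow> real) set" and a :: "('a \<Rightarrow> real) \<Rightarrow> ('a \<Rightarrow> real) \<Rightarrow> real"
  assumes zero_mem: "(\<lambda>x. 0) \<in> D"
    and add_mem: "\<And>u v. u \<in> D \<Longrightarrow> v \<in> D \<Longrightarrow> (\<lambda>x. u x + v x) \<in> D"
    and scale_mem: "\<And>c u. u \<in> D \<Longrightarrow> (\<lambda>x. c * u x) \<in> D"
    and add_left: "\<And>u v w. u \<in> D \<Longrightarrow> v \<in> D \<Longrightarrow> w \<in> D \<Longrightarrow> a (\<lambda>x. u x + v x) w = a u w + a v w"
    and scale_left: "\<And>c u v. u \<in> D \<Longrightarrow> v \<in> D \<Longrightarrow> a (\<lambda>x. c * u x) v = c * a u v"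
    and sym: "\<And>u v. u \<in> D \<Longrightarrow> v \<in> D \<Longrightarrow> a u v = a v u"
    and nonneg: "\<And>u. u \<in> D \<Longrightarrow> 0 \<le> a u u"
begin

lemma add_scale_mem: "u \<in> D \<Longrightarrow> v \<in> D \<Longrightarrow> (\<lambda>x. u x + c * v x) \<in> D"
  by (intro add_mem scale_mem)

lemma diff_mem: "u \<in> D \<Longrightarrow> v \<in> D \<Longrightarrow> (\<lambda>x. u x - v x) \<in> D"
  using add_scale_mem[of u v "-1"] by simp

lemma add_scale_left:
  "u \<in> D \<Longrightarrow> v \<in> D \<Longrightarrow> w \<in> D \<Longrightarrow> a (\<lambda>x. u x + c * v x) w = a u w + c * a v w"
  by (simp add: add_left scale_left scale_mem)

lemma diff_left: "u \<in> D \<Longrightarrow> v \<in> D \<Longrightarrow> w \<in> D \<Longrightarrow> a (\<lambda>x. u x - v x) w = a u w - a v w"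
  using add_scale_left[of u v w "-1"] by simp

lemma quad_add_scale:
  assumes "u \<in> D" "v \<in> D"
  shows "a (\<lambda>x. u x + c * v x) (\<lambda>x. u x + c * v x) = a u u + 2 * c * a u v + c\<^sup>2 * a v v"
proof -
  let ?w = "\<lambda>x. u x + c * v x"
  have w: "?w \<in> D" using assms by (rule add_scale_mem)
  have 1: "a ?w ?w = a u ?w + c * a v ?w" using assms w by (simp add: add_scale_left)
  have 2: "a u ?w = a u u + c * a u v" using assms w by (simp add: sym[of u ?w] add_scale_left sym[of v u])
  have 3: "a v ?w = a u v + c * a v v" using assms w by (simp add: sym[of v ?w] add_scale_left)
  show ?thesis unfolding 1 2 3 by (simp add: algebra_simps power2_eq_square)
qed

lemma quad_diff:
  assumes "u \<in> D" "v \<in> D"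
  shows "a (\<lambda>x. u x - v x) (\<lambda>x. u x - v x) = a u u - 2 * a u v + a v v"
  using quad_add_scale[OF assms, of "-1"] by simp

lemma quad_scale: "u \<in> D \<Longrightarrow> a (\<lambda>x. c * u x) (\<lambda>x. c * u x) = c\<^sup>2 * a u u"
  using quad_add_scale[OF zero_mem, of u c] scale_left[OF zero_mem, of _ 0] zero_mem
  by simp

lemma Cauchy_Schwarz:
  assumes "u \<in> D" "v \<in> D"
  shows "\<bar>a u v\<bar> \<le> sqrt (a u u) * sqrt (a v v)"
proof -
  have "(a u v)\<^sup>2 \<le> a u u * a v v"
  proof (rule discriminant_bound)
    show "0 \<le> a u u + 2 * t * a u v + t\<^sup>2 * a v v" for t
      using nonneg[OF add_scale_mem[OF assms, of t]] quad_add_scale[OF assms, of t] by simp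
  qed (use assms nonneg in auto)
  then show ?thesis
    by (metis real_sqrt_abs real_sqrt_le_mono real_sqrt_mult)
qed

lemma triangle:
  assumes "u \<in> D" "v \<in> D"
  shows "sqrt (a (\<lambda>x. u x + v x) (\<lambda>x. u x + v x)) \<le> sqrt (a u u) + sqrt (a v v)"
proof (rule real_le_lsqrt)
  have "a (\<lambda>x. u x + v x) (\<lambda>x. u x + v x) = a u u + 2 * a u v + a v v"
    using quad_add_scale[OF assms, of 1] by simp
  also have "\<dots> \<le> a u u + 2 * (sqrt (a u u) * sqrt (a v v)) + a v v"
    using Cauchy_Schwarz[OF assms] by linarith
  also have "\<dots> = (sqrt (a u u) + sqrt (a v v))\<^sup>2"
    using assms nonneg by (simp add: power2_sum)
  finally show "a (\<lambda>x. u x + v x) (\<lambda>x. u x + v x) \<le> (sqrt (a u u) + sqrt (a v v))\<^sup>2" .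
qed (use assms nonneg in simp_all)

lemma sqrt_diff_le:
  assumes "u \<in> D" "v \<in> D"
  shows "\<bar>sqrt (a u u) - sqrt (a v v)\<bar> \<le> sqrt (a (\<lambda>x. u x - v x) (\<lambda>x. u x - v x))"
proof -
  have e: "a (\<lambda>x. v x - u x) (\<lambda>x. v x - u x) = a (\<lambda>x. u x - v x) (\<lambda>x. u x - v x)"
    using assms by (simp add: quad_diff sym[of v u])
  show ?thesis
    using triangle[OF diff_mem[OF assms] assms(2)] triangle[OF diff_mem[OF assms(2,1)] assms(1)] e
    by (simp add: abs_le_iff)
qed

text \<open>The projection argument of Hilbert space theory, kept at the level of sequences: by the
  parallelogram law, near-minimizers over midpoint-convex sets are Cauchy. The sets may shrink with
  n, because the infima then increase to a finite limit \<open>d\<close>. A constant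
  \<open>K\<close> yields the Riesz theorem; tails of a sequence, with l = 0, yield the Fatou
  lemma.\<close>

lemma minimizing_sequence:
  fixes l :: "('a \<Rightarrow> real) \<Rightarrow> real" and K :: "nat \<Rightarrow> ('a \<Rightarrow> real) set"
  defines "J \<equiv> \<lambda>w. a w w - 2 * l w"
  assumes l_add: "\<And>u v. u \<in> D \<Longrightarrow> v \<in> D \<Longrightarrow> l (\<lambda>x. u x + v x) = l u + l v"
    and l_scale: "\<And>c u. u \<in> D \<Longrightarrow> l (\<lambda>x. c * u x) = c * l u"
    and sub: "\<And>n. K n \<subseteq> D"
    and dec: "\<And>n. K (Suc n) \<subseteq> K n"
    and mid: "\<And>n u v. u \<in> K n \<Longrightarrow> v \<in> K n \<Longrightarrow> (\<lambda>x. (1/2) * (u x + v x)) \<in> K n"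
    and below: "\<And>w. w \<in> D \<Longrightarrow> L \<le> J w"
    and upper: "\<And>n. \<exists>y\<in>K n. J y \<le> B"
  obtains c d where "\<And>n. c n \<in> K n" "form_Cauchy a c" "(\<lambda>n. J (c n)) \<longlonglongrightarrow> d"
    "\<And>t. (\<And>n. \<exists>y\<in>K n. J y \<le> t) \<Longrightarrow> d \<le> t"
    "\<And>n. J (c n) \<le> d + inverse (real (Suc n))"
proof -
  define \<delta> where "\<delta> n = Inf (J ` K n)" for n
  have decle: "K j \<subseteq> K i" if "i \<le> j" for i j
    using lift_Suc_antimono_le[of K, OF dec that] .
  have ne: "J ` K n \<noteq> {}" for n using upper[of n] by auto
  have bdd: "bdd_below (J ` K n)" for n
    using sub[of n] below by (intro bdd_belowI[of _ L]) auto
  have \<delta>_le: "\<delta> n \<le> J y" if "y \<in> K n" for n y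
    unfolding \<delta>_def using bdd that by (intro cInf_lower) auto
  have "mono \<delta>"
    unfolding \<delta>_def using ne bdd decle
    by (intro monoI cInf_superset_mono) (auto simp: subset_iff image_iff)
  have \<delta>B: "\<delta> n \<le> B" for n using upper[of n] \<delta>_le by fastforce
  have "\<delta> \<longlonglongrightarrow> (SUP n. \<delta> n)"
    using \<open>mono \<delta>\<close> \<delta>B by (intro LIMSEQ_incseq_SUP) (auto intro!: bdd_aboveI2)
  define d where "d = (SUP n. \<delta> n)"
  have \<delta>d: "\<delta> \<longlonglongrightarrow> d" using \<open>\<delta> \<longlonglongrightarrow> (SUP n. \<delta> n)\<close> d_def by simp
  have \<delta>_le_d: "\<delta> n \<le> d" for n
    using incseq_le[OF \<open>mono \<delta>\<close> \<delta>d] .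
  have "\<exists>y\<in>K n. J y < \<delta> n + inverse (real (Suc n))" for n
  proof -
    have "Inf (J ` K n) < \<delta> n + inverse (real (Suc n))" unfolding \<delta>_def by simp
    then show ?thesis using cInf_less_iff[OF ne bdd] by auto
  qed
  then obtain c where c: "\<And>n. c n \<in> K n" "\<And>n. J (c n) < \<delta> n + inverse (real (Suc n))"
    by metis
  have cD: "c n \<in> D" for n using c(1) sub by blast
  have lim: "(\<lambda>n. J (c n)) \<longlonglongrightarrow> d"
  proof (rule tendsto_sandwich[OF _ _ \<delta>d])
    show "(\<lambda>n. \<delta> n + inverse (real (Suc n))) \<longlonglongrightarrow> d"
      using tendsto_add[OF \<delta>d LIMSEQ_inverse_real_of_nat] by simp
  qed (use \<delta>_le[OF c(1)] c(2) in \<open>auto intro!: always_eventually less_imp_le\<close>)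
  \<comment> \<open>Parallelogram law for \<open>J\<close>: the linear terms at the two points and
    at the midpoint cancel.\<close>
  have key: "a (\<lambda>x. c i x - c j x) (\<lambda>x. c i x - c j x) \<le> 2 * J (c i) + 2 * J (c j) - 4 * \<delta> n"
    if "n \<le> i" "n \<le> j" for n i j
  proof -
    let ?w = "\<lambda>x. (1/2) * (c i x + c j x)"
    have "?w \<in> K n" using c(1) decle that by (intro mid) blast+
    then have "\<delta> n \<le> J ?w" by (rule \<delta>_le)
    moreover have "a ?w ?w = (1/2)\<^sup>2 * (a (c i) (c i) + 2 * a (c i) (c j) + a (c j) (c j))"
      using quad_scale[OF add_mem[OF cD cD], of "1/2" i j] quad_add_scale[OF cD cD, of i 1 j] by simp
    moreover have "l ?w = (1/2) * (l (c i) + l (c j))"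
      using l_scale[OF add_mem[OF cD cD], of "1/2"] l_add[OF cD cD] by simp
    ultimately show ?thesis
      unfolding J_def using quad_diff[OF cD cD, of i j] by (simp add: power2_eq_square)
  qed
  have "form_Cauchy a c"
    unfolding form_Cauchy_def
  proof (intro allI impI)
    fix e :: real assume "e > 0"
    \<comment> \<open>These margins make the right side of \<open>key\<close> less than 4 * (e/8) +
      4 * (e/8) = e.\<close>
    have "\<forall>\<^sub>F n in sequentially. d - e/8 < \<delta> n \<and> J (c n) < d + e / 8"
      using order_tendstoD(1)[OF \<delta>d, of "d - e/8"] order_tendstoD(2)[OF lim, of "d + e/8"] \<open>e > 0\<close>
      by (simp add: eventually_conj)
    then obtain N where N: "\<And>n. n \<ge> N \<Longrightarrow> d - e/8 < \<delta> n \<and> J (c n) < d + e / 8"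
      by (auto simp: eventually_sequentially)
    have "a (\<lambda>x. c i x - c j x) (\<lambda>x. c i x - c j x) < e" if "i \<ge> N" "j \<ge> N" for i j
      using key[OF that] N[OF that(1)] N[OF that(2)] N[of N] by linarith
    then show "\<exists>N. \<forall>i\<ge>N. \<forall>j\<ge>N. a (\<lambda>x. c i x - c j x) (\<lambda>x. c i x - c j x) < e" by blast
  qed
  moreover have "d \<le> t" if "\<And>n. \<exists>y\<in>K n. J y \<le> t" for t
  proof (rule LIMSEQ_le_const2[OF \<delta>d], intro exI allI impI)
    show "\<delta> n \<le> t" for n using that[of n] \<delta>_le by fastforce
  qed
  moreover have "J (c n) \<le> d + inverse (real (Suc n))" for n
    using c(2)[of n] \<delta>_le_d[of n] by linarith
  ultimately show ?thesis using that c(1) lim by blast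
qed

text \<open>Near-minimizers of a w w - 2 l w satisfy the Euler equation a w v = l v up to an error
  that vanishes with n, and by Cauchy-Schwarz both sides pass to the limit along the Cauchy
  sequence.\<close>

lemma Riesz_representation:
  fixes l :: "('a \<Rightarrow> real) \<Rightarrow> real"
  assumes complete: "\<And>s. (\<And>n. s n \<in> D) \<Longrightarrow> form_Cauchy a s \<Longrightarrow>
      \<exists>u\<in>D. (\<lambda>n. a (\<lambda>x. s n x - u x) (\<lambda>x. s n x - u x)) \<longlonglongrightarrow> 0"
    and l_add: "\<And>u v. u \<in> D \<Longrightarrow> v \<in> D \<Longrightarrow> l (\<lambda>x. u x + v x) = l u + l v"
    and l_scale: "\<And>c u. u \<in> D \<Longrightarrow> l (\<lambda>x. c * u x) = c * l u"
    and l_bound: "\<And>v. v \<in> D \<Longrightarrow> \<bar>l v\<bar> \<le> M * sqrt (a v v)"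
  obtains w where "w \<in> D" "\<And>v. v \<in> D \<Longrightarrow> a w v = l v"
proof -
  have below: "- M\<^sup>2 \<le> a w w - 2 * l w" if "w \<in> D" for w
  proof -
    have "0 \<le> (sqrt (a w w) - M)\<^sup>2" by simp
    also have "\<dots> = a w w - 2 * (M * sqrt (a w w)) + M\<^sup>2"
      using nonneg[OF that] by (simp add: power2_diff)
    finally show ?thesis using l_bound[OF that] by linarith
  qed
  have l0: "l (\<lambda>x. 0) = 0" using l_scale[OF zero_mem, of 0] by simp
  have a0: "a (\<lambda>x. 0) (\<lambda>x. 0) = 0" using quad_scale[OF zero_mem, of 0] by simp
  obtain c d where c: "\<And>n. c n \<in> D" "form_Cauchy a c" "(\<lambda>n. a (c n) (c n) - 2 * l (c n)) \<longlonglongrightarrow> d"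
    "\<And>t. (\<And>n::nat. \<exists>y\<in>D. a y y - 2 * l y \<le> t) \<Longrightarrow> d \<le> t"
    "\<And>n. a (c n) (c n) - 2 * l (c n) \<le> d + inverse (real (Suc n))"
  proof (rule minimizing_sequence[of l "\<lambda>_. D" "- M\<^sup>2" 0])
    show "\<exists>y\<in>D. a y y - 2 * l y \<le> 0" using zero_mem l0 a0 by force
    show "(\<lambda>x. (1/2) * (u x + v x)) \<in> D" if "u \<in> D" "v \<in> D" for u v
      using that by (intro scale_mem add_mem)
  qed (auto intro: l_add l_scale below)
  have dmin: "d \<le> a y y - 2 * l y" if "y \<in> D" for y using c(4) that by blast
  obtain w where w: "w \<in> D" "(\<lambda>n. a (\<lambda>x. c n x - w x) (\<lambda>x. c n x - w x)) \<longlonglongrightarrow> 0"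
    using complete[OF c(1,2)] by blast
  have "a w v = l v" if v: "v \<in> D" for v
  proof -
    have 1: "\<bar>a (c n) v - l v\<bar> \<le> sqrt (inverse (real (Suc n)) * a v v)" for n
    proof -
      \<comment> \<open>The polynomial is J(c n + t v) - J(c n) + 1/(n+1), which is nonnegative
        since \<open>J (c n)\<close> exceeds the lower bound \<open>d\<close> of J by at most
        1/(n+1).\<close>
      have "(a (c n) v - l v)\<^sup>2 \<le> inverse (real (Suc n)) * a v v"
      proof (rule discriminant_bound)
        fix t
        have "l (\<lambda>x. c n x + t * v x) = l (c n) + t * l v"
          using c(1) v by (simp add: l_add l_scale scale_mem)
        then show "0 \<le> inverse (real (Suc n)) + 2 * t * (a (c n) v - l v) + t\<^sup>2 * a v v"
          using dmin[OF add_scale_mem[OF c(1) v, of n t]] quad_add_scale[OF c(1) v, of n t] c(5)[of n]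
          by (simp add: algebra_simps)
      qed (use nonneg v in auto)
      then show ?thesis by (metis real_sqrt_abs real_sqrt_le_mono)
    qed
    have "(\<lambda>n. a (c n) v - l v) \<longlonglongrightarrow> 0"
    proof (rule Lim_null_comparison[OF always_eventually])
      show "\<forall>n. norm (a (c n) v - l v) \<le> sqrt (inverse (real (Suc n)) * a v v)" using 1 by simp
      show "(\<lambda>n. sqrt (inverse (real (Suc n)) * a v v)) \<longlonglongrightarrow> 0"
        using tendsto_real_sqrt[OF tendsto_mult_left_zero[OF LIMSEQ_inverse_real_of_nat, of "a v v"]] by simp
    qed
    moreover have "(\<lambda>n. a (c n) v - a w v) \<longlonglongrightarrow> 0"
    proof (rule Lim_null_comparison[OF always_eventually])
      show "\<forall>n. norm (a (c n) v - a w v)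
          \<le> sqrt (a (\<lambda>x. c n x - w x) (\<lambda>x. c n x - w x)) * sqrt (a v v)"
        using Cauchy_Schwarz[OF diff_mem[OF c(1) w(1)] v] diff_left[OF c(1) w(1) v] by simp
      show "(\<lambda>n. sqrt (a (\<lambda>x. c n x - w x) (\<lambda>x. c n x - w x)) * sqrt (a v v)) \<longlonglongrightarrow> 0"
        using tendsto_mult[OF tendsto_real_sqrt[OF w(2)] tendsto_const, of "sqrt (a v v)"] by simp
    qed
    ultimately have "(\<lambda>n. (a (c n) v - l v) - (a (c n) v - a w v)) \<longlonglongrightarrow> 0 - 0" by (rule tendsto_diff)
    then have "(\<lambda>n::nat. a w v - l v) \<longlonglongrightarrow> 0" by simp
    then show ?thesis by (simp add: LIMSEQ_const_iff)
  qed
  then show ?thesis using that w(1) by blast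
qed

end


section \<open>Weighted forms and the minimization property of resolvents\<close>

lemma L2_measurable[measurable_dest]: "u \<in> L2 m \<Longrightarrow> u \<in> borel_measurable m"
  by (simp add: L2_def)

lemma L2_mult_integrable:
  assumes "u \<in> L2 m" "v \<in> L2 m"
  shows "integrable m (\<lambda>x. u x * v x)"
proof (rule Bochner_Integration.integrable_bound)
  show "integrable m (\<lambda>x. (u x)\<^sup>2 + (v x)\<^sup>2)" using assms by (simp add: L2_def)
  show "AE x in m. norm (u x * v x) \<le> norm ((u x)\<^sup>2 + (v x)\<^sup>2)"
  proof (rule AE_I2)
    fix x
    have "2 * (\<bar>u x\<bar> * \<bar>v x\<bar>) \<le> (u x)\<^sup>2 + (v x)\<^sup>2"
      using sum_squares_bound[of "\<bar>u x\<bar>" "\<bar>v x\<bar>"] by simp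
    moreover have "0 \<le> \<bar>u x\<bar> * \<bar>v x\<bar>" by simp
    ultimately have "\<bar>u x\<bar> * \<bar>v x\<bar> \<le> (u x)\<^sup>2 + (v x)\<^sup>2" by linarith
    then show "norm (u x * v x) \<le> norm ((u x)\<^sup>2 + (v x)\<^sup>2)" by (simp add: abs_mult)
  qed
qed (use assms in \<open>auto simp: L2_def\<close>)

lemma L2_bound:
  assumes "v \<in> L2 m" "u \<in> borel_measurable m" "AE x in m. \<bar>u x\<bar> \<le> C * \<bar>v x\<bar>"
  shows "u \<in> L2 m"
proof -
  have "integrable m (\<lambda>x. (u x)\<^sup>2)"
  proof (rule Bochner_Integration.integrable_bound)
    show "integrable m (\<lambda>x. C\<^sup>2 * (v x)\<^sup>2)" using assms(1) by (simp add: L2_def)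
    show "AE x in m. norm ((u x)\<^sup>2) \<le> norm (C\<^sup>2 * (v x)\<^sup>2)"
      using assms(3)
    proof eventually_elim
      case (elim x)
      have "\<bar>u x\<bar>\<^sup>2 \<le> (C * \<bar>v x\<bar>)\<^sup>2" using elim by (intro power_mono) auto
      then show ?case by (simp add: power_mult_distrib)
    qed
  qed (use assms(2) in simp)
  then show ?thesis using assms(2) by (simp add: L2_def)
qed

lemma L2_add:
  assumes "u \<in> L2 m" "v \<in> L2 m"
  shows "(\<lambda>x. u x + v x) \<in> L2 m"
proof -
  have "integrable m (\<lambda>x. (u x)\<^sup>2 + 2 * (u x * v x) + (v x)\<^sup>2)"
    using assms L2_mult_integrable[OF assms] by (simp add: L2_def)
  moreover have "(\<lambda>x. (u x + v x)\<^sup>2) = (\<lambda>x. (u x)\<^sup>2 + 2 * (u x * v x) + (v x)\<^sup>2)"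
    by (simp add: power2_sum algebra_simps fun_eq_iff)
  ultimately have "integrable m (\<lambda>x. (u x + v x)\<^sup>2)" by simp
  then show ?thesis using assms by (auto simp: L2_def)
qed

lemma L2_mult_bounded:
  assumes "v \<in> L2 m" "\<kappa> \<in> borel_measurable m" "\<And>x. \<bar>\<kappa> x\<bar> \<le> C"
  shows "(\<lambda>x. \<kappa> x * v x) \<in> L2 m"
proof (rule L2_bound[OF assms(1)])
  have [measurable]: "v \<in> borel_measurable m" using assms(1) by (rule L2_measurable)
  show "(\<lambda>x. \<kappa> x * v x) \<in> borel_measurable m" using assms(2) by measurable
  show "AE x in m. \<bar>\<kappa> x * v x\<bar> \<le> C * \<bar>v x\<bar>"
    unfolding abs_mult using assms(3) by (intro AE_I2 mult_right_mono) auto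
qed

lemma L2_scale: "v \<in> L2 m \<Longrightarrow> (\<lambda>x. c * v x) \<in> L2 m"
  by (rule L2_mult_bounded[of v m "\<lambda>_. c" "\<bar>c\<bar>"]) auto

lemma L2_diff: "u \<in> L2 m \<Longrightarrow> v \<in> L2 m \<Longrightarrow> (\<lambda>x. u x - v x) \<in> L2 m"
  using L2_add[OF _ L2_scale[of v m "-1"], of u] by simp

lemma L2_abs: "u \<in> L2 m \<Longrightarrow> (\<lambda>x. \<bar>u x\<bar>) \<in> L2 m"
  by (auto simp: L2_def)

lemma L2_of_bounded_integrable:
  assumes "integrable m u" "AE x in m. \<bar>u x\<bar> \<le> C"
  shows "u \<in> L2 m"
proof -
  have "integrable m (\<lambda>x. (u x)\<^sup>2)"
  proof (rule Bochner_Integration.integrable_bound)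
    show "integrable m (\<lambda>x. C * \<bar>u x\<bar>)" using assms(1) by auto
    show "AE x in m. norm ((u x)\<^sup>2) \<le> norm (C * \<bar>u x\<bar>)"
      using assms(2)
    proof eventually_elim
      case (elim x)
      have "\<bar>u x\<bar> * \<bar>u x\<bar> \<le> C * \<bar>u x\<bar>" using elim by (intro mult_right_mono) auto
      also have "\<dots> \<le> norm (C * \<bar>u x\<bar>)" by simp
      finally show ?case by (simp add: power2_eq_square abs_mult)
    qed
  qed (use assms(1) in simp)
  then show ?thesis using assms(1) by (simp add: L2_def)
qed

lemma integral_nonneg_eq_0_AE:
  fixes h :: "'a \<Rightarrow> real"
  assumes "integrable m h" "AE x in m. 0 \<le> h x" "(LINT x|m. h x) \<le> 0"
  shows "AE x in m. h x = 0"
  using assms integral_nonneg_AE[OF assms(2)] integral_nonneg_eq_0_iff_AE[OF assms(1,2)] by linarith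

text \<open>The bounds make the weighted form equivalent to \<open>\<E>\<^sub>1\<close>, hence complete.\<close>

definition weight :: "'a measure \<Rightarrow> ('a \<Rightarrow> real) \<Rightarrow> bool" where
  "weight m \<kappa> \<longleftrightarrow> \<kappa> \<in> borel_measurable m \<and> (\<exists>\<alpha>>0. \<exists>C. \<forall>x. \<alpha> \<le> \<kappa> x \<and> \<kappa> x \<le> C)"

lemma weight_const: "\<alpha> > 0 \<Longrightarrow> weight m (\<lambda>x. \<alpha>)"
  unfolding weight_def by auto

definition weighted_form ::
    "'a measure \<Rightarrow> (('a \<Rightarrow> real) \<Rightarrow> ('a \<Rightarrow> real) \<Rightarrow> real) \<Rightarrow> ('a \<Rightarrow> real) \<Rightarrow> ('a \<Rightarrow> real) \<Rightarrow> ('a \<Rightarrow> real) \<Rightarrow> real"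
  where "weighted_form m \<E> \<kappa> u v = \<E> u v + (LINT x|m. \<kappa> x * (u x * v x))"

lemma weighted_form_const: "weighted_form m \<E> (\<lambda>x. \<alpha>) = form_alpha m \<E> \<alpha>"
  by (simp add: weighted_form_def form_alpha_def L2_inner_def fun_eq_iff)

section \<open>The equation (\<kappa> - L) w = f: existence, linearity, uniqueness\<close>

locale dirichlet =
  fixes m :: "'a measure" and D :: "('a \<Rightarrow> real) set"
    and \<E> :: "('a \<Rightarrow> real) \<Rightarrow> ('a \<Rightarrow> real) \<Rightarrow> real"
  assumes Dirichlet_form: "Dirichlet_form m D \<E>"
begin

lemma mem_L2: "u \<in> D \<Longrightarrow> u \<in> L2 m"
  using Dirichlet_form unfolding Dirichlet_form_def symmetric_form_def by blast

lemma mem_measurable: "u \<in> D \<Longrightarrow> u \<in> borel_measurable m"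
  by (simp add: mem_L2 L2_measurable)

lemma AE_form: "u \<in> D \<Longrightarrow> v \<in> borel_measurable m \<Longrightarrow> AE x in m. u x = v x \<Longrightarrow> w \<in> D \<Longrightarrow> \<E> v w = \<E> u w"
  using Dirichlet_form unfolding Dirichlet_form_def symmetric_form_def by blast

sublocale E: nonneg_form D \<E>
proof
qed (use Dirichlet_form in \<open>auto simp: Dirichlet_form_def symmetric_form_def\<close>)

lemma weight_integrable:
  assumes "weight m \<kappa>" "u \<in> L2 m" "v \<in> L2 m"
  shows "integrable m (\<lambda>x. \<kappa> x * (u x * v x))"
proof -
  obtain \<alpha> C where \<alpha>: "\<alpha> > 0" "\<And>x. \<alpha> \<le> \<kappa> x \<and> \<kappa> x \<le> C" using assms(1) unfolding weight_def by blast
  have "\<bar>\<kappa> x\<bar> \<le> C" for x using \<alpha>(1) \<alpha>(2)[of x] by linarith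
  then have "(\<lambda>x. \<kappa> x * u x) \<in> L2 m"
    using assms by (intro L2_mult_bounded[of u m \<kappa> C]) (auto simp: weight_def)
  from L2_mult_integrable[OF this assms(3)] show ?thesis by (simp add: mult.assoc)
qed

lemma weight_nonneg: "weight m \<kappa> \<Longrightarrow> 0 \<le> \<kappa> x"
  unfolding weight_def by (meson less_le_trans order_less_imp_le)

lemma nonneg_form_weighted:
  assumes \<kappa>: "weight m \<kappa>"
  shows "nonneg_form D (weighted_form m \<E> \<kappa>)"
proof
  note int = weight_integrable[OF \<kappa> mem_L2 mem_L2]
  fix u v w c assume [simp]: "u \<in> D" "v \<in> D"
  show "(\<lambda>x. u x + v x) \<in> D" "(\<lambda>x. c * u x) \<in> D"
    by (simp_all add: E.add_mem E.scale_mem)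
  show "weighted_form m \<E> \<kappa> (\<lambda>x. c * u x) v = c * weighted_form m \<E> \<kappa> u v"
    using int[of u v] by (simp add: weighted_form_def E.scale_left algebra_simps)
  show "weighted_form m \<E> \<kappa> u v = weighted_form m \<E> \<kappa> v u"
    by (simp add: weighted_form_def E.sym mult.commute mult.left_commute)
  show "0 \<le> weighted_form m \<E> \<kappa> u u"
    unfolding weighted_form_def
    using E.nonneg[of u] by (simp add: integral_nonneg_AE weight_nonneg[OF \<kappa>])
  assume [simp]: "w \<in> D"
  show "weighted_form m \<E> \<kappa> (\<lambda>x. u x + v x) w = weighted_form m \<E> \<kappa> u w + weighted_form m \<E> \<kappa> v w"
    using int[of u w] int[of v w] by (simp add: weighted_form_def E.add_left algebra_simps)
qed (rule E.zero_mem)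

lemma weighted_complete:
  assumes \<kappa>: "weight m \<kappa>" and s: "\<And>n. s n \<in> D" "form_Cauchy (weighted_form m \<E> \<kappa>) s"
  shows "\<exists>u\<in>D. (\<lambda>n. weighted_form m \<E> \<kappa> (\<lambda>x. s n x - u x) (\<lambda>x. s n x - u x)) \<longlonglongrightarrow> 0"
proof -
  obtain \<alpha> C where \<alpha>: "\<alpha> > 0" "\<And>x. \<alpha> \<le> \<kappa> x \<and> \<kappa> x \<le> C" using \<kappa> unfolding weight_def by blast
  define c1 where "c1 = min 1 \<alpha>"
  define c2 where "c2 = max 1 C"
  have c1: "c1 > 0" using \<alpha>(1) by (simp add: c1_def)
  note int = weight_integrable[OF \<kappa> mem_L2 mem_L2] weight_integrable[OF weight_const mem_L2 mem_L2, of 1]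
  have lower: "c1 * form_alpha m \<E> 1 w w \<le> weighted_form m \<E> \<kappa> w w" if w: "w \<in> D" for w
  proof -
    have "c1 * \<E> w w \<le> 1 * \<E> w w"
      unfolding c1_def using E.nonneg[OF w] by (intro mult_right_mono) auto
    moreover have "c1 * (LINT x|m. w x * w x) \<le> (LINT x|m. \<kappa> x * (w x * w x))"
      unfolding integral_mult_right_zero[symmetric] using int[of w w] w \<alpha>
      by (intro integral_mono) (auto simp: c1_def intro!: mult_right_mono intro: min.coboundedI2)
    ultimately show ?thesis by (simp add: form_alpha_def weighted_form_def L2_inner_def algebra_simps)
  qed
  have upper: "weighted_form m \<E> \<kappa> w w \<le> c2 * form_alpha m \<E> 1 w w" if w: "w \<in> D" for w
  proof -
    have "1 * \<E> w w \<le> c2 * \<E> w w"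
      unfolding c2_def using E.nonneg[OF w] by (intro mult_right_mono) auto
    moreover have "(LINT x|m. \<kappa> x * (w x * w x)) \<le> c2 * (LINT x|m. w x * w x)"
      unfolding integral_mult_right_zero[symmetric] using int[of w w] w \<alpha>
      by (intro integral_mono) (auto simp: c2_def intro!: mult_right_mono intro: max.coboundedI2)
    ultimately show ?thesis by (simp add: form_alpha_def weighted_form_def L2_inner_def algebra_simps)
  qed
  have "form_Cauchy (form_alpha m \<E> 1) s"
    unfolding form_Cauchy_def
  proof (intro allI impI)
    fix e :: real assume "e > 0"
    then have "c1 * e > 0" using c1 by simp
    then obtain N where N: "\<And>i j. i \<ge> N \<Longrightarrow> j \<ge> N \<Longrightarrow>
        weighted_form m \<E> \<kappa> (\<lambda>x. s i x - s j x) (\<lambda>x. s i x - s j x) < c1 * e"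
      using s(2) unfolding form_Cauchy_def by blast
    have "form_alpha m \<E> 1 (\<lambda>x. s i x - s j x) (\<lambda>x. s i x - s j x) < e" if "i \<ge> N" "j \<ge> N" for i j
      using lower[OF E.diff_mem[OF s(1) s(1)], of i j] N[OF that] c1
      by (smt (verit) mult_le_cancel_left_pos)
    then show "\<exists>N. \<forall>i\<ge>N. \<forall>j\<ge>N. form_alpha m \<E> 1 (\<lambda>x. s i x - s j x) (\<lambda>x. s i x - s j x) < e" by blast
  qed
  then obtain u where u: "u \<in> D" "(\<lambda>n. form_alpha m \<E> 1 (\<lambda>x. s n x - u x) (\<lambda>x. s n x - u x)) \<longlonglongrightarrow> 0"
    using Dirichlet_form s(1) unfolding Dirichlet_form_def closed_form_def by blast
  have "(\<lambda>n. weighted_form m \<E> \<kappa> (\<lambda>x. s n x - u x) (\<lambda>x. s n x - u x)) \<longlonglongrightarrow> 0"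
  proof (rule tendsto_sandwich[of "\<lambda>_. 0"])
    show "(\<lambda>n. c2 * form_alpha m \<E> 1 (\<lambda>x. s n x - u x) (\<lambda>x. s n x - u x)) \<longlonglongrightarrow> 0"
      using tendsto_mult_right_zero[OF u(2)] .
  qed (use upper nonneg_form.nonneg[OF nonneg_form_weighted[OF \<kappa>]] E.diff_mem[OF s(1) u(1)]
      in \<open>auto intro!: always_eventually\<close>)
  then show ?thesis using u(1) by blast
qed

text \<open>The weak form of (\<kappa> - L) w = f. It is a relation rather than a chosen function
  because w is determined only up to m-null sets; a constant \<kappa> gives the resolvent,
  \<open>time_change_weight\<close> the time-changed equation.\<close>

definition solves :: "('a \<Rightarrow> real) \<Rightarrow> ('a \<Rightarrow> real) \<Rightarrow> ('a \<Rightarrow> real) \<Rightarrow> bool" where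
  "solves \<kappa> f w \<longleftrightarrow> w \<in> D \<and> (\<forall>z\<in>D. weighted_form m \<E> \<kappa> w z = L2_inner m f z)"

lemma solves_mem: "solves \<kappa> f w \<Longrightarrow> w \<in> D"
  by (simp add: solves_def)

lemma solves_L2: "solves \<kappa> f w \<Longrightarrow> w \<in> L2 m"
  by (simp add: solves_def mem_L2)

lemma solves_measurable: "solves \<kappa> f w \<Longrightarrow> w \<in> borel_measurable m"
  by (simp add: solves_def mem_measurable)

lemma ex_solves:
  assumes \<kappa>: "weight m \<kappa>" and f: "f \<in> L2 m"
  shows "\<exists>w. solves \<kappa> f w"
proof -
  interpret K: nonneg_form D "weighted_form m \<E> \<kappa>" by (rule nonneg_form_weighted[OF \<kappa>])
  obtain \<alpha> C where \<alpha>: "\<alpha> > 0" "\<And>x. \<alpha> \<le> \<kappa> x \<and> \<kappa> x \<le> C" using \<kappa> unfolding weight_def by blast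
  note int = L2_mult_integrable[OF f mem_L2]
  have sq: "(LINT x|m. f x * v x)\<^sup>2 \<le> (LINT x|m. (f x)\<^sup>2) * (LINT x|m. (v x)\<^sup>2)" if v: "v \<in> D" for v
  proof (rule discriminant_bound)
    fix t
    have "0 \<le> (LINT x|m. (f x + t * v x)\<^sup>2)" by simp
    also have "(\<lambda>x. (f x + t * v x)\<^sup>2) = (\<lambda>x. (f x)\<^sup>2 + 2 * t * (f x * v x) + t\<^sup>2 * (v x)\<^sup>2)"
      by (simp add: fun_eq_iff power2_sum power_mult_distrib algebra_simps)
    also have "(LINT x|m. \<dots> x) = (LINT x|m. (f x)\<^sup>2) + 2 * t * (LINT x|m. f x * v x) + t\<^sup>2 * (LINT x|m. (v x)\<^sup>2)"
      using f mem_L2[OF v] int[OF v] by (simp add: L2_def)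
    finally show "0 \<le> (LINT x|m. (f x)\<^sup>2) + 2 * t * (LINT x|m. f x * v x) + t\<^sup>2 * (LINT x|m. (v x)\<^sup>2)" .
  qed simp
  define M where "M = sqrt (LINT x|m. (f x)\<^sup>2) / sqrt \<alpha>"
  have bound: "\<bar>L2_inner m f v\<bar> \<le> M * sqrt (weighted_form m \<E> \<kappa> v v)" if v: "v \<in> D" for v
  proof -
    have "\<alpha> * (LINT x|m. (v x)\<^sup>2) \<le> (LINT x|m. \<kappa> x * (v x * v x))"
      unfolding integral_mult_right_zero[symmetric]
      using weight_integrable[OF \<kappa> mem_L2[OF v] mem_L2[OF v]] mem_L2[OF v] \<alpha>(2)
      by (intro integral_mono) (auto simp: L2_def power2_eq_square intro!: mult_right_mono)
    then have 1: "\<alpha> * (LINT x|m. (v x)\<^sup>2) \<le> weighted_form m \<E> \<kappa> v v"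
      unfolding weighted_form_def using E.nonneg[OF v] by simp
    have "\<bar>L2_inner m f v\<bar> \<le> sqrt ((LINT x|m. (f x)\<^sup>2) * (LINT x|m. (v x)\<^sup>2))"
      unfolding L2_inner_def using sq[OF v] by (metis real_sqrt_abs real_sqrt_le_mono)
    also have "\<dots> = M * sqrt (\<alpha> * (LINT x|m. (v x)\<^sup>2))"
      unfolding M_def using \<alpha>(1) by (simp add: real_sqrt_mult)
    also have "\<dots> \<le> M * sqrt (weighted_form m \<E> \<kappa> v v)"
      using 1 by (intro mult_left_mono real_sqrt_le_mono) (auto simp: M_def \<alpha>(1) less_imp_le)
    finally show ?thesis .
  qed
  obtain w where "w \<in> D" "\<And>v. v \<in> D \<Longrightarrow> weighted_form m \<E> \<kappa> w v = L2_inner m f v"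
  proof (rule K.Riesz_representation[of "L2_inner m f" M])
    show "L2_inner m f (\<lambda>x. u x + v x) = L2_inner m f u + L2_inner m f v" if "u \<in> D" "v \<in> D" for u v
      using int[OF that(1)] int[OF that(2)] by (simp add: L2_inner_def algebra_simps)
    show "L2_inner m f (\<lambda>x. c * u x) = c * L2_inner m f u" if "u \<in> D" for c u
      by (simp add: L2_inner_def mult.left_commute)
  qed (use weighted_complete[OF \<kappa>] bound in auto)
  then show ?thesis unfolding solves_def by blast
qed

lemma solves_add_scale:
  assumes \<kappa>: "weight m \<kappa>" and "f \<in> L2 m" "g \<in> L2 m" "solves \<kappa> f u" "solves \<kappa> g v"
  shows "solves \<kappa> (\<lambda>x. f x + c * g x) (\<lambda>x. u x + c * v x)"
proof -
  interpret K: nonneg_form D "weighted_form m \<E> \<kappa>" by (rule nonneg_form_weighted[OF \<kappa>])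
  have "L2_inner m (\<lambda>x. f x + c * g x) z = L2_inner m f z + c * L2_inner m g z" if z: "z \<in> D" for z
    using L2_mult_integrable[OF assms(2) mem_L2[OF z]] L2_mult_integrable[OF assms(3) mem_L2[OF z]]
    by (simp add: L2_inner_def algebra_simps)
  moreover have "weighted_form m \<E> \<kappa> (\<lambda>x. u x + c * v x) z = L2_inner m f z + c * L2_inner m g z"
    if z: "z \<in> D" for z
    using K.add_scale_left[OF solves_mem[OF assms(4)] solves_mem[OF assms(5)] z, of c] assms(4,5) z
    unfolding solves_def by metis
  ultimately show ?thesis
    using K.add_scale_mem[OF solves_mem[OF assms(4)] solves_mem[OF assms(5)], of c] unfolding solves_def by metis
qed

lemma solves_diff:
  assumes \<kappa>: "weight m \<kappa>" and "f \<in> L2 m" "g \<in> L2 m" "solves \<kappa> f u" "solves \<kappa> g v"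
  shows "solves \<kappa> (\<lambda>x. f x - g x) (\<lambda>x. u x - v x)"
proof -
  have "(\<lambda>x. f x + - 1 * g x) = (\<lambda>x. f x - g x)" "(\<lambda>x. u x + - 1 * v x) = (\<lambda>x. u x - v x)"
    by auto
  then show ?thesis using solves_add_scale[OF assms, of "-1"] by metis
qed

lemma solves_scale:
  assumes "weight m \<kappa>" "f \<in> L2 m" "solves \<kappa> f w"
  shows "solves \<kappa> (\<lambda>x. c * f x) (\<lambda>x. c * w x)"
proof -
  have "(\<lambda>x. h x + (c - 1) * h x) = (\<lambda>x. c * h x)" for h :: "'a \<Rightarrow> real"
    by (simp add: algebra_simps)
  then show ?thesis using solves_add_scale[OF assms(1,2,2,3,3), of "c - 1"] by metis
qed

lemma solves_energy:
  assumes \<kappa>: "weight m \<kappa>" and w: "solves \<kappa> f w"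
  shows "\<E> w w + (LINT x|m. \<kappa> x * (w x)\<^sup>2) = (LINT x|m. f x * w x)"
    and "\<E> w w \<le> (LINT x|m. f x * w x)"
proof -
  show 1: "\<E> w w + (LINT x|m. \<kappa> x * (w x)\<^sup>2) = (LINT x|m. f x * w x)"
    using w by (simp add: solves_def weighted_form_def L2_inner_def power2_eq_square)
  have "0 \<le> (LINT x|m. \<kappa> x * (w x)\<^sup>2)"
    using weight_nonneg[OF \<kappa>] by (intro integral_nonneg_AE) simp
  then show "\<E> w w \<le> (LINT x|m. f x * w x)" using 1 by simp
qed

text \<open>Test with w itself; the splitting 2 \<alpha> f w <= f^2 + \<alpha>^2 w^2 lets half of
  the left side absorb the last term. This gives uniqueness m-a.e. and continuity in L2.\<close>

lemma solves_bound:
  assumes \<kappa>: "weight m \<kappa>" "\<And>x. \<alpha> \<le> \<kappa> x" "\<alpha> > 0" and f: "f \<in> L2 m" and w: "solves \<kappa> f w"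
  shows "\<alpha>\<^sup>2 * (LINT x|m. (w x)\<^sup>2) \<le> (LINT x|m. (f x)\<^sup>2)"
proof -
  have wD: "w \<in> D" using w by (rule solves_mem)
  have i1: "integrable m (\<lambda>x. (w x)\<^sup>2)" "integrable m (\<lambda>x. (f x)\<^sup>2)"
    using mem_L2[OF wD] f by (auto simp: L2_def)
  have "\<alpha> * (LINT x|m. (w x)\<^sup>2) \<le> (LINT x|m. \<kappa> x * (w x * w x))"
    unfolding integral_mult_right_zero[symmetric]
    using weight_integrable[OF \<kappa>(1) mem_L2[OF wD] mem_L2[OF wD]] i1 \<kappa>(2)
    by (intro integral_mono) (auto simp: power2_eq_square intro!: mult_right_mono)
  also have "\<dots> \<le> weighted_form m \<E> \<kappa> w w"
    unfolding weighted_form_def using E.nonneg[OF wD] by simp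
  also have "\<dots> = (LINT x|m. f x * w x)" using w wD by (simp add: solves_def L2_inner_def)
  finally have 1: "\<alpha> * (LINT x|m. (w x)\<^sup>2) \<le> (LINT x|m. f x * w x)" .
  have "2 * \<alpha> * (LINT x|m. f x * w x) = (LINT x|m. 2 * \<alpha> * (f x * w x))" by simp
  also have "\<dots> \<le> (LINT x|m. (f x)\<^sup>2 + \<alpha>\<^sup>2 * (w x)\<^sup>2)"
  proof (rule integral_mono)
    show "2 * \<alpha> * (f x * w x) \<le> (f x)\<^sup>2 + \<alpha>\<^sup>2 * (w x)\<^sup>2" for x
      using sum_squares_bound[of "f x" "\<alpha> * w x"] by (simp add: power_mult_distrib algebra_simps)
  qed (use i1 L2_mult_integrable[OF f mem_L2[OF wD]] in auto)
  also have "\<dots> = (LINT x|m. (f x)\<^sup>2) + \<alpha>\<^sup>2 * (LINT x|m. (w x)\<^sup>2)" using i1 by simp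
  finally have "2 * \<alpha> * (LINT x|m. f x * w x) \<le> (LINT x|m. (f x)\<^sup>2) + \<alpha>\<^sup>2 * (LINT x|m. (w x)\<^sup>2)" .
  moreover have "2 * \<alpha> * (\<alpha> * (LINT x|m. (w x)\<^sup>2)) \<le> 2 * \<alpha> * (LINT x|m. f x * w x)"
    using 1 \<kappa>(3) by (intro mult_left_mono) auto
  ultimately show ?thesis by (simp add: power2_eq_square)
qed

lemma solves_unique:
  assumes \<kappa>: "weight m \<kappa>" and f: "f \<in> L2 m" and "g \<in> L2 m" "AE x in m. f x = g x"
    and w: "solves \<kappa> f w" "solves \<kappa> g v"
  shows "AE x in m. w x = v x"
proof -
  obtain \<alpha> where \<alpha>: "\<alpha> > 0" "\<And>x. \<alpha> \<le> \<kappa> x" using \<kappa> unfolding weight_def by blast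
  have "\<alpha>\<^sup>2 * (LINT x|m. (w x - v x)\<^sup>2) \<le> (LINT x|m. (f x - g x)\<^sup>2)"
    using solves_bound[OF \<kappa> \<alpha>(2,1) L2_diff[OF assms(2,3)] solves_diff[OF \<kappa> assms(2,3) w]] .
  also have "\<dots> = 0" using assms(4) by (intro integral_eq_zero_AE) auto
  finally have "(LINT x|m. (w x - v x)\<^sup>2) \<le> 0" using \<alpha>(1) by (simp add: mult_le_0_iff)
  then have "AE x in m. (w x - v x)\<^sup>2 = 0"
    using L2_diff[OF solves_L2[OF w(1)] solves_L2[OF w(2)]]
    by (intro integral_nonneg_eq_0_AE) (auto simp: L2_def)
  then show ?thesis by simp
qed

section \<open>Clipping, positivity and comparison\<close>

lemma clip_mem_energy:
  assumes u: "u \<in> D" and c: "c \<ge> 0"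
  shows "(\<lambda>x. min (max 0 (u x)) c) \<in> D"
    and "\<E> (\<lambda>x. min (max 0 (u x)) c) (\<lambda>x. min (max 0 (u x)) c) \<le> \<E> u u"
proof -
  have "(\<lambda>x. min (max 0 (u x)) c) \<in> D \<and> \<E> (\<lambda>x. min (max 0 (u x)) c) (\<lambda>x. min (max 0 (u x)) c) \<le> \<E> u u"
  proof (cases "c = 0")
    case True
    have "(\<lambda>x. min (max 0 (u x)) c) = (\<lambda>x. 0)" using True by (auto simp: fun_eq_iff)
    then show ?thesis using E.zero_mem E.quad_scale[OF E.zero_mem, of 0] E.nonneg[OF u] by simp
  next
    case False
    then have c: "c > 0" using c by simp
    \<comment> \<open>The Markov property concerns the interval from 0 to 1 only; clipping at c is
      clipping at 1 conjugated by a scaling, and the factors c^2 cancel in the energy.\<close>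
    let ?p = "\<lambda>x. min (max 0 ((1/c) * u x)) 1"
    have e: "(\<lambda>x. min (max 0 (u x)) c) = (\<lambda>x. c * ?p x)"
      using c by (auto simp: fun_eq_iff min_def max_def field_simps)
    have "?p \<in> D" "\<E> ?p ?p \<le> \<E> (\<lambda>x. (1/c) * u x) (\<lambda>x. (1/c) * u x)"
      using Dirichlet_form E.scale_mem[OF u, of "1/c"] unfolding Dirichlet_form_def Markovian_def by auto
    moreover have "c\<^sup>2 * \<E> (\<lambda>x. (1/c) * u x) (\<lambda>x. (1/c) * u x) = \<E> u u"
      using E.quad_scale[OF u, of "1/c"] c by (simp add: power2_eq_square)
    moreover have "\<E> (\<lambda>x. c * ?p x) (\<lambda>x. c * ?p x) = c\<^sup>2 * \<E> ?p ?p"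
      using E.quad_scale[OF \<open>?p \<in> D\<close>] .
    ultimately show ?thesis unfolding e
      using E.scale_mem[of ?p c] mult_left_mono[of "\<E> ?p ?p" "\<E> (\<lambda>x. (1/c) * u x) (\<lambda>x. (1/c) * u x)" "c\<^sup>2"]
      by auto
  qed
  then show "(\<lambda>x. min (max 0 (u x)) c) \<in> D"
    "\<E> (\<lambda>x. min (max 0 (u x)) c) (\<lambda>x. min (max 0 (u x)) c) \<le> \<E> u u" by auto
qed

text \<open>The solution \<open>w\<close> minimizes a quadratic functional, the energy part of which decreases under
  clipping.\<close>

lemma solves_clip:
  fixes c :: real
  assumes \<kappa>: "weight m \<kappa>" "\<And>x. \<alpha> \<le> \<kappa> x" and f: "f \<in> L2 m" and w: "solves \<kappa> f w" and c: "c \<ge> 0"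
  defines "y \<equiv> \<lambda>x. min (max 0 (w x)) c"
  shows "\<alpha> * (LINT x|m. (y x - w x)\<^sup>2) \<le> (LINT x|m. (y x - w x) * (\<kappa> x * (y x + w x) - 2 * f x))"
    and "integrable m (\<lambda>x. (y x - w x)\<^sup>2)"
    and "integrable m (\<lambda>x. (y x - w x) * (\<kappa> x * (y x + w x) - 2 * f x))"
proof -
  interpret K: nonneg_form D "weighted_form m \<E> \<kappa>" by (rule nonneg_form_weighted[OF \<kappa>(1)])
  have wD: "w \<in> D" using w by (rule solves_mem)
  have yD: "y \<in> D" and Ey: "\<E> y y \<le> \<E> w w" using clip_mem_energy[OF wD c] by (simp_all add: y_def)
  have dD: "(\<lambda>x. y x - w x) \<in> D" by (rule E.diff_mem[OF yD wD])
  show i1: "integrable m (\<lambda>x. (y x - w x)\<^sup>2)" using mem_L2[OF dD] by (simp add: L2_def)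
  have ik: "integrable m (\<lambda>x. \<kappa> x * ((y x - w x) * (y x + w x)))"
    using weight_integrable[OF \<kappa>(1) mem_L2[OF dD] mem_L2[OF E.add_mem[OF yD wD]]] .
  have if': "integrable m (\<lambda>x. f x * (y x - w x))" using L2_mult_integrable[OF f mem_L2[OF dD]] .
  have eq: "(\<lambda>x. (y x - w x) * (\<kappa> x * (y x + w x) - 2 * f x)) =
      (\<lambda>x. \<kappa> x * ((y x - w x) * (y x + w x)) - 2 * (f x * (y x - w x)))"
    by (simp add: fun_eq_iff algebra_simps)
  show "integrable m (\<lambda>x. (y x - w x) * (\<kappa> x * (y x + w x) - 2 * f x))"
    unfolding eq using ik if' by simp
  note kk = weight_integrable[OF \<kappa>(1) mem_L2 mem_L2]
  have "\<alpha> * (LINT x|m. (y x - w x)\<^sup>2) \<le> (LINT x|m. \<kappa> x * ((y x - w x) * (y x - w x)))"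
    unfolding integral_mult_right_zero[symmetric] using kk[OF dD dD] i1 \<kappa>(2)
    by (intro integral_mono) (auto simp: power2_eq_square intro!: mult_right_mono)
  also have "\<dots> \<le> weighted_form m \<E> \<kappa> (\<lambda>x. y x - w x) (\<lambda>x. y x - w x)"
    unfolding weighted_form_def using E.nonneg[OF dD] by simp
  also have "\<dots> = weighted_form m \<E> \<kappa> y y - 2 * weighted_form m \<E> \<kappa> w y + weighted_form m \<E> \<kappa> w w"
    using K.quad_diff[OF yD wD] K.sym[OF yD wD] by simp
  also have "\<dots> = weighted_form m \<E> \<kappa> y y - weighted_form m \<E> \<kappa> w w - 2 * (LINT x|m. f x * (y x - w x))"
  proof -
    have "weighted_form m \<E> \<kappa> w y = (LINT x|m. f x * y x)" "weighted_form m \<E> \<kappa> w w = (LINT x|m. f x * w x)"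
      using w yD wD by (auto simp: solves_def L2_inner_def)
    then show ?thesis
      using L2_mult_integrable[OF f mem_L2[OF yD]] L2_mult_integrable[OF f mem_L2[OF wD]]
      by (simp add: right_diff_distrib)
  qed
  \<comment> \<open>The Markov property enters here through \<open>Ey\<close>. What remains is of
    order zero, so its sign can be examined pointwise.\<close>
  also have "\<dots> \<le> (LINT x|m. \<kappa> x * (y x * y x)) - (LINT x|m. \<kappa> x * (w x * w x)) - 2 * (LINT x|m. f x * (y x - w x))"
    unfolding weighted_form_def using Ey by simp
  also have "(LINT x|m. \<kappa> x * (y x * y x)) - (LINT x|m. \<kappa> x * (w x * w x)) =
      (LINT x|m. \<kappa> x * ((y x - w x) * (y x + w x)))"
    using kk[OF yD yD] kk[OF wD wD]
    by (subst Bochner_Integration.integral_diff[symmetric]) (auto simp: algebra_simps)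
  finally show "\<alpha> * (LINT x|m. (y x - w x)\<^sup>2) \<le> (LINT x|m. (y x - w x) * (\<kappa> x * (y x + w x) - 2 * f x))"
    unfolding eq using ik if' by simp
qed

text \<open>Under the two sign conditions the integrand on the right of \<open>solves_clip\<close>
  is nonpositive where w > c and where w < 0, and zero elsewhere; hence w equals its clipping a.e.
  The condition \<open>upper\<close> is imposed only where w exceeds c, which is what allows a
  maximum principle for data carried by a set.\<close>

lemma solves_clip_eq:
  assumes \<kappa>: "weight m \<kappa>" and f: "f \<in> L2 m" and w: "solves \<kappa> f w" and c: "c \<ge> 0"
    and upper: "AE x in m. w x > c \<longrightarrow> 2 * f x \<le> \<kappa> x * (c + w x)"
    and lower: "AE x in m. 0 \<le> f x"
  shows "AE x in m. 0 \<le> w x \<and> w x \<le> c"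
proof -
  obtain \<alpha> where \<alpha>: "\<alpha> > 0" "\<And>x. \<alpha> \<le> \<kappa> x" using \<kappa> unfolding weight_def by blast
  let ?y = "\<lambda>x. min (max 0 (w x)) c"
  have "(LINT x|m. (?y x - w x) * (\<kappa> x * (?y x + w x) - 2 * f x)) \<le> 0"
  proof -
    have "0 \<le> (LINT x|m. - ((?y x - w x) * (\<kappa> x * (?y x + w x) - 2 * f x)))"
    proof (rule integral_nonneg_AE)
      show "AE x in m. 0 \<le> - ((?y x - w x) * (\<kappa> x * (?y x + w x) - 2 * f x))"
        using upper lower
      proof eventually_elim
        case (elim x)
        have k: "0 \<le> \<kappa> x" using weight_nonneg[OF \<kappa>] .
        consider "w x > c" | "w x < 0" | "0 \<le> w x" "w x \<le> c" by linarith
        then have "(?y x - w x) * (\<kappa> x * (?y x + w x) - 2 * f x) \<le> 0"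
        proof cases
          case 1
          then have "?y x = c" using c by auto
          then show ?thesis using 1 elim by (simp add: mult_nonpos_nonneg)
        next
          case 2
          then have "?y x = 0" using c by auto
          moreover have "\<kappa> x * w x \<le> 0" using k 2 by (simp add: mult_nonneg_nonpos)
          ultimately show ?thesis using 2 elim
            by (simp add: zero_le_mult_iff)
        qed auto
        then show ?case by simp
      qed
    qed
    then show ?thesis by simp
  qed
  then have "\<alpha> * (LINT x|m. (?y x - w x)\<^sup>2) \<le> 0"
    using solves_clip(1)[OF \<kappa> \<alpha>(2) f w c] by linarith
  then have "(LINT x|m. (?y x - w x)\<^sup>2) \<le> 0" using \<alpha>(1) by (simp add: mult_le_0_iff)
  then have "AE x in m. (?y x - w x)\<^sup>2 = 0"
    using solves_clip(2)[OF \<kappa> \<alpha>(2) f w c] by (intro integral_nonneg_eq_0_AE) auto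
  then show ?thesis
  proof eventually_elim
    case (elim x)
    then have "w x = ?y x" by simp
    then show ?case using c by linarith
  qed
qed

text \<open>Positivity without an upper bound on w. Clipping acts from both sides, so w is clipped
  to the interval from 0 to n; cutting at n costs at most the integral of 2 f (w - n)^+, which tends
  to 0 by dominated convergence.\<close>

lemma solves_nonneg:
  assumes \<kappa>: "weight m \<kappa>" and f: "f \<in> L2 m" and w: "solves \<kappa> f w" and f0: "AE x in m. 0 \<le> f x"
  shows "AE x in m. 0 \<le> w x"
proof -
  obtain \<alpha> where \<alpha>: "\<alpha> > 0" "\<And>x. \<alpha> \<le> \<kappa> x" using \<kappa> unfolding weight_def by blast
  have wL: "w \<in> L2 m" using w by (rule solves_L2)
  have m[measurable]: "w \<in> borel_measurable m" "f \<in> borel_measurable m" using wL f by (auto simp: L2_measurable)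
  have ineg: "integrable m (\<lambda>x. (min 0 (w x))\<^sup>2)"
    using L2_bound[OF wL, of "\<lambda>x. min 0 (w x)" 1] by (auto simp: L2_def)
  have le: "\<alpha> * (LINT x|m. (min 0 (w x))\<^sup>2) \<le> (LINT x|m. 2 * (f x * max 0 (w x - real n)))" for n
  proof -
    let ?y = "\<lambda>x. min (max 0 (w x)) (real n)"
    have int: "integrable m (\<lambda>x. 2 * (f x * max 0 (w x - real n)))"
      using L2_mult_integrable[OF f L2_bound[OF wL, of "\<lambda>x. max 0 (w x - real n)" 1]] by (auto simp: max_def)
    have "\<alpha> * (LINT x|m. (min 0 (w x))\<^sup>2) \<le> \<alpha> * (LINT x|m. (?y x - w x)\<^sup>2)"
      using \<alpha>(1) ineg solves_clip(2)[OF \<kappa> \<alpha>(2) f w, of "real n"]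
      by (intro mult_left_mono integral_mono) (auto simp: min_def max_def)
    also have "\<dots> \<le> (LINT x|m. (?y x - w x) * (\<kappa> x * (?y x + w x) - 2 * f x))"
      using solves_clip(1)[OF \<kappa> \<alpha>(2) f w, of "real n"] by simp
    also have "\<dots> \<le> (LINT x|m. 2 * (f x * max 0 (w x - real n)))"
    proof (rule integral_mono_AE)
      show "AE x in m. (?y x - w x) * (\<kappa> x * (?y x + w x) - 2 * f x) \<le> 2 * (f x * max 0 (w x - real n))"
        using f0
      proof eventually_elim
        case (elim x)
        have k: "0 \<le> \<kappa> x" using weight_nonneg[OF \<kappa>] .
        consider "w x > real n" | "w x < 0" | "0 \<le> w x" "w x \<le> real n" by linarith
        then show ?case
        proof cases
          case 1
          then have y: "?y x = real n" by auto
          have "0 \<le> (w x - real n) * (\<kappa> x * (real n + w x))" using 1 k by simp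
          then show ?thesis unfolding y using 1 by (simp add: algebra_simps)
        next
          case 2
          then have y: "?y x = 0" by auto
          have "\<kappa> x * w x \<le> 0" using k 2 by (simp add: mult_nonneg_nonpos)
          then have "(- w x) * (\<kappa> x * w x - 2 * f x) \<le> 0" using 2 elim by (intro mult_nonneg_nonpos) auto
          then show ?thesis unfolding y using 2 by (simp add: max_def)
        next
          case 3
          then have "?y x = w x" by auto
          then show ?thesis using 3 by (simp add: max_def)
        qed
      qed
    qed (use solves_clip(3)[OF \<kappa> \<alpha>(2) f w, of "real n"] int in auto)
    finally show ?thesis .
  qed
  have "(\<lambda>n. LINT x|m. 2 * (f x * max 0 (w x - real n))) \<longlonglongrightarrow> (LINT x|m. 0)"
  proof (rule integral_dominated_convergence)
    show "integrable m (\<lambda>x. 2 * \<bar>f x * w x\<bar>)" using L2_mult_integrable[OF f wL] by auto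
    show "AE x in m. (\<lambda>n. 2 * (f x * max 0 (w x - real n))) \<longlonglongrightarrow> 0"
    proof (rule AE_I2, rule tendsto_eventually)
      fix x
      show "\<forall>\<^sub>F n in sequentially. 2 * (f x * max 0 (w x - real n)) = 0"
        using eventually_ge_at_top[of "nat \<lceil>w x\<rceil>"]
        by eventually_elim (auto simp: max_def nat_ceiling_le_eq)
    qed
    show "AE x in m. norm (2 * (f x * max 0 (w x - real n))) \<le> 2 * \<bar>f x * w x\<bar>" for n
      by (auto simp: abs_mult max_def intro!: AE_I2 mult_left_mono)
  qed auto
  then have "\<alpha> * (LINT x|m. (min 0 (w x))\<^sup>2) \<le> 0"
    by (intro LIMSEQ_le_const) (use le in \<open>auto simp only: integral_zero\<close>)
  then have "(LINT x|m. (min 0 (w x))\<^sup>2) \<le> 0" using \<alpha>(1) by (simp add: mult_le_0_iff)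
  then have "AE x in m. (min 0 (w x))\<^sup>2 = 0" using ineg by (intro integral_nonneg_eq_0_AE) auto
  then show ?thesis by eventually_elim (auto simp: min_def split: if_splits)
qed

lemma solves_mono:
  assumes \<kappa>: "weight m \<kappa>" and "f \<in> L2 m" "g \<in> L2 m" "solves \<kappa> f u" "solves \<kappa> g v" "AE x in m. f x \<le> g x"
  shows "AE x in m. u x \<le> v x"
  using solves_nonneg[OF \<kappa> L2_diff[OF assms(3,2)] solves_diff[OF \<kappa> assms(3,2,5,4)]] assms(6) by auto

text \<open>A generalized resolvent equation: the difference of the zero-order terms moves to the
  right side. Combined with \<open>solves_mono\<close> it gives every monotonicity in the killing
  rate, and it relates time-changed solutions to ordinary resolvents.\<close>

lemma solves_change_weight:
  assumes "weight m \<kappa>" "weight m \<kappa>'" and f: "f \<in> L2 m" and w: "solves \<kappa> f w"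
  shows "solves \<kappa>' (\<lambda>x. f x + (\<kappa>' x - \<kappa> x) * w x) w"
proof -
  have wD: "w \<in> D" using w by (rule solves_mem)
  have "weighted_form m \<E> \<kappa>' w z = L2_inner m (\<lambda>x. f x + (\<kappa>' x - \<kappa> x) * w x) z" if z: "z \<in> D" for z
  proof -
    note i = weight_integrable[OF assms(1) mem_L2[OF wD] mem_L2[OF z]]
      weight_integrable[OF assms(2) mem_L2[OF wD] mem_L2[OF z]] L2_mult_integrable[OF f mem_L2[OF z]]
    have "weighted_form m \<E> \<kappa>' w z = weighted_form m \<E> \<kappa> w z +
        ((LINT x|m. \<kappa>' x * (w x * z x)) - (LINT x|m. \<kappa> x * (w x * z x)))"
      by (simp add: weighted_form_def)
    also have "\<dots> = (LINT x|m. f x * z x) + ((LINT x|m. \<kappa>' x * (w x * z x)) - (LINT x|m. \<kappa> x * (w x * z x)))"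
      using w z by (simp add: solves_def L2_inner_def)
    also have "\<dots> = (LINT x|m. f x * z x + (\<kappa>' x * (w x * z x) - \<kappa> x * (w x * z x)))"
      using i by simp
    finally show ?thesis by (simp add: L2_inner_def algebra_simps)
  qed
  then show ?thesis using wD by (simp add: solves_def)
qed

end


section \<open>Potentials of square integrable functions\<close>

text \<open>Killing rates decreasing to 0. A countable family suffices because resolvents of
  nonnegative functions are monotone in the rate, and countably many a.e. statements can be combined
  into one.\<close>

definition rate :: "nat \<Rightarrow> real" where
  "rate j = inverse (real (Suc j))"

lemma rate_pos: "0 < rate j"
  by (simp add: rate_def)

lemma rate_antimono: "i \<le> j \<Longrightarrow> rate j \<le> rate i"
  by (simp add: rate_def)

lemma rate_tendsto: "rate \<longlonglongrightarrow> 0"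
  unfolding rate_def by (rule LIMSEQ_inverse_real_of_nat)

lemma ex_rate_le: "0 < e \<Longrightarrow> \<exists>j. rate j \<le> e"
  using reals_Archimedean[of e] unfolding rate_def by (meson less_imp_le)

lemma L2_tendsto_AE_subseq:
  assumes "\<And>n. u n \<in> L2 m" "v \<in> L2 m" "(\<lambda>n. LINT x|m. (u n x - v x)\<^sup>2) \<longlonglongrightarrow> 0"
  shows "\<exists>r::nat\<Rightarrow>nat. strict_mono r \<and> (AE x in m. (\<lambda>n. u (r n) x) \<longlonglongrightarrow> v x)"
proof -
  have "\<exists>r::nat\<Rightarrow>nat. strict_mono r \<and> (AE x in m. (\<lambda>n. (u (r n) x - v x)\<^sup>2) \<longlonglongrightarrow> 0)"
    using L2_diff[OF assms(1,2)] assms(3)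
    by (intro tendsto_L1_AE_subseq[where u="\<lambda>n x. (u n x - v x)\<^sup>2"]) (auto simp: L2_def)
  then obtain r :: "nat \<Rightarrow> nat" where r: "strict_mono r" "AE x in m. (\<lambda>n. (u (r n) x - v x)\<^sup>2) \<longlonglongrightarrow> 0"
    by blast
  have "AE x in m. (\<lambda>n. u (r n) x) \<longlonglongrightarrow> v x"
    using r(2)
  proof eventually_elim
    case (elim x)
    have "(\<lambda>n. \<bar>u (r n) x - v x\<bar>) \<longlonglongrightarrow> 0" using tendsto_real_sqrt[OF elim] by simp
    then show ?case by (simp add: LIM_zero_iff tendsto_rabs_zero_iff)
  qed
  then show ?thesis using r(1) by blast
qed

context dirichlet
begin

abbreviation R :: "real \<Rightarrow> ('a \<Rightarrow> real) \<Rightarrow> 'a \<Rightarrow> real" where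
  "R \<equiv> resolvent m D \<E>"

lemma resolvent_solves:
  assumes "\<alpha> > 0" "f \<in> L2 m"
  shows "solves (\<lambda>_. \<alpha>) f (R \<alpha> f)"
  using someI_ex[of "\<lambda>w. w \<in> D \<and> (\<forall>v\<in>D. form_alpha m \<E> \<alpha> w v = L2_inner m f v)"]
    ex_solves[OF weight_const[OF assms(1)] assms(2)]
  unfolding solves_def weighted_form_const resolvent_def by blast

lemma resolvent_measurable[measurable]:
  "\<alpha> > 0 \<Longrightarrow> f \<in> L2 m \<Longrightarrow> R \<alpha> f \<in> borel_measurable m"
  using resolvent_solves solves_measurable by blast

lemma resolvent_nonneg:
  "\<alpha> > 0 \<Longrightarrow> f \<in> L2 m \<Longrightarrow> AE x in m. 0 \<le> f x \<Longrightarrow> AE x in m. 0 \<le> R \<alpha> f x"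
  using solves_nonneg[OF weight_const _ resolvent_solves] .

lemma resolvent_mono:
  assumes "\<alpha> > 0" "f \<in> L2 m" "g \<in> L2 m" "AE x in m. f x \<le> g x"
  shows "AE x in m. R \<alpha> f x \<le> R \<alpha> g x"
  using solves_mono[OF weight_const[OF assms(1)] assms(2,3) resolvent_solves[OF assms(1,2)]
      resolvent_solves[OF assms(1,3)] assms(4)] .

text \<open>\<open>R \<beta> f\<close> solves the \<alpha>-equation with the right side f +
  (\<alpha> - \<beta>) \<open>R \<beta> f\<close>, which is at most f.\<close>

lemma resolvent_antimono:
  assumes "0 < \<alpha>" "\<alpha> \<le> \<beta>" "f \<in> L2 m" "AE x in m. 0 \<le> f x"
  shows "AE x in m. R \<beta> f x \<le> R \<alpha> f x"
proof -
  have \<beta>: "\<beta> > 0" using assms by simp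
  have s: "solves (\<lambda>_. \<alpha>) (\<lambda>x. f x + (\<alpha> - \<beta>) * R \<beta> f x) (R \<beta> f)"
    using solves_change_weight[OF weight_const[OF \<beta>] weight_const[OF assms(1)] assms(3) resolvent_solves[OF \<beta> assms(3)]] .
  show ?thesis
  proof (rule solves_mono[OF weight_const[OF assms(1)] _ assms(3) s resolvent_solves[OF assms(1,3)]])
    show "(\<lambda>x. f x + (\<alpha> - \<beta>) * R \<beta> f x) \<in> L2 m"
      by (intro L2_add L2_scale assms solves_L2[OF resolvent_solves[OF \<beta> assms(3)]])
    show "AE x in m. f x + (\<alpha> - \<beta>) * R \<beta> f x \<le> f x"
      using resolvent_nonneg[OF \<beta> assms(3,4)] by eventually_elim (use assms(2) in \<open>simp add: mult_nonpos_nonneg\<close>)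
  qed
qed

lemma solves_tendsto_AE_subseq:
  assumes \<kappa>: "weight m \<kappa>" and f: "\<And>n. f n \<in> L2 m" "g \<in> L2 m"
    and w: "\<And>n. solves \<kappa> (f n) (w n)" "solves \<kappa> g v"
    and lim: "(\<lambda>n. LINT x|m. (f n x - g x)\<^sup>2) \<longlonglongrightarrow> 0"
  shows "\<exists>r::nat\<Rightarrow>nat. strict_mono r \<and> (AE x in m. (\<lambda>n. w (r n) x) \<longlonglongrightarrow> v x)"
proof -
  obtain \<alpha> where \<alpha>: "\<alpha> > 0" "\<And>x. \<alpha> \<le> \<kappa> x" using \<kappa> unfolding weight_def by blast
  have "(\<lambda>n. LINT x|m. (w n x - v x)\<^sup>2) \<longlonglongrightarrow> 0"
  proof (rule tendsto_sandwich[of "\<lambda>_. 0"])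
    have "(LINT x|m. (w n x - v x)\<^sup>2) \<le> (LINT x|m. (f n x - g x)\<^sup>2) / \<alpha>\<^sup>2" for n
      using solves_bound[OF \<kappa> \<alpha>(2,1) L2_diff[OF f] solves_diff[OF \<kappa> f w], of n] \<alpha>(1)
      by (simp add: field_simps)
    then show "\<forall>\<^sub>F n in sequentially. (LINT x|m. (w n x - v x)\<^sup>2) \<le> (LINT x|m. (f n x - g x)\<^sup>2) / \<alpha>\<^sup>2"
      by simp
    show "(\<lambda>n. (LINT x|m. (f n x - g x)\<^sup>2) / \<alpha>\<^sup>2) \<longlonglongrightarrow> 0"
      using tendsto_divide[OF lim tendsto_const, of "\<alpha>\<^sup>2"] \<alpha>(1) by simp
  qed auto
  then show ?thesis using solves_L2[OF w(1)] solves_L2[OF w(2)] by (intro L2_tendsto_AE_subseq)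
qed

lemma L2_pos_part: "f \<in> L2 m \<Longrightarrow> (\<lambda>x. max 0 (f x)) \<in> L2 m"
  by (rule L2_bound[of f m _ 1]) auto

text \<open>Shows that the choice in \<open>resolvent_nn\<close> is harmless: any admissible
  sequence \<open>h\<close> converges in L2 to the positive part of \<eta>, so a subsequence of its
  resolvents converges a.e. to the resolvent of that part. The positive part appears because
  \<open>ennreal\<close> sends negative reals to 0.\<close>

lemma resolvent_nn_eq:
  assumes \<alpha>: "\<alpha> > 0" and \<eta>: "\<eta> \<in> L2 m"
  shows "AE x in m. resolvent_nn m D \<E> \<alpha> (\<lambda>y. ennreal (\<eta> y)) x = ennreal (R \<alpha> (\<lambda>y. max 0 (\<eta> y)) x)"
proof -
  let ?p = "\<lambda>y. max 0 (\<eta> y)"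
  define P where "P w \<longleftrightarrow> w \<in> borel_measurable m \<and>
     (\<exists>h. (\<forall>n. h n \<in> L2 m) \<and> (\<forall>n x. 0 \<le> h n x) \<and> (\<forall>x. incseq (\<lambda>n. h n x)) \<and>
       (\<forall>x. (\<lambda>n. ennreal (h n x)) \<longlonglongrightarrow> ennreal (\<eta> x)) \<and>
       (AE x in m. (\<lambda>n. ennreal (R \<alpha> (h n) x)) \<longlonglongrightarrow> w x))" for w :: "'a \<Rightarrow> ennreal"
  have p: "?p \<in> L2 m" using \<eta> by (rule L2_pos_part)
  have [measurable]: "?p \<in> borel_measurable m" "R \<alpha> ?p \<in> borel_measurable m"
    using p \<alpha> by (auto intro: resolvent_measurable L2_measurable)
  have enn: "ennreal (max 0 t) = ennreal t" for t
    by (auto simp: max_def ennreal_neg)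
  \<comment> \<open>The constant sequence shows that the choice has a candidate.\<close>
  have "P (\<lambda>x. ennreal (R \<alpha> ?p x))"
    unfolding P_def using p enn by (intro conjI exI[of _ "\<lambda>_. ?p"]) (auto simp: incseq_def)
  moreover have "resolvent_nn m D \<E> \<alpha> (\<lambda>y. ennreal (\<eta> y)) = (SOME w. P w)"
    unfolding resolvent_nn_def P_def ..
  ultimately have "P (resolvent_nn m D \<E> \<alpha> (\<lambda>y. ennreal (\<eta> y)))"
    by (metis someI)
  then obtain h where h: "\<And>n. h n \<in> L2 m" "\<And>n x. 0 \<le> h n x" "\<And>x. incseq (\<lambda>n. h n x)"
    "\<And>x. (\<lambda>n. ennreal (h n x)) \<longlonglongrightarrow> ennreal (\<eta> x)"
    "AE x in m. (\<lambda>n. ennreal (R \<alpha> (h n) x)) \<longlonglongrightarrow> resolvent_nn m D \<E> \<alpha> (\<lambda>y. ennreal (\<eta> y)) x"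
    unfolding P_def by blast
  have hlim: "(\<lambda>n. h n x) \<longlonglongrightarrow> ?p x" for x
  proof (rule tendsto_ennrealD)
    show "(\<lambda>n. ennreal (h n x)) \<longlonglongrightarrow> ennreal (?p x)" using h(4)[of x] enn by simp
  qed (use h(2) in auto)
  have hle: "h n x \<le> ?p x" for n x using incseq_le[OF h(3) hlim] .
  have "(\<lambda>n. LINT x|m. (h n x - ?p x)\<^sup>2) \<longlonglongrightarrow> (LINT x|m. 0)"
  proof (rule integral_dominated_convergence)
    show "integrable m (\<lambda>x. (?p x)\<^sup>2)" using p by (simp add: L2_def)
    show "(\<lambda>x. (h n x - ?p x)\<^sup>2) \<in> borel_measurable m" for n
      using L2_measurable[OF h(1)[of n]] by measurable
    show "AE x in m. (\<lambda>n. (h n x - ?p x)\<^sup>2) \<longlonglongrightarrow> 0"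
    proof (rule AE_I2)
      fix x show "(\<lambda>n. (h n x - ?p x)\<^sup>2) \<longlonglongrightarrow> 0"
        using tendsto_power[OF tendsto_diff[OF hlim[of x] tendsto_const[of "?p x"]], of 2] by simp
    qed
    show "AE x in m. norm ((h n x - ?p x)\<^sup>2) \<le> (?p x)\<^sup>2" for n
    proof (rule AE_I2)
      fix x
      have "\<bar>h n x - ?p x\<bar> \<le> \<bar>?p x\<bar>" using h(2)[of n x] hle[of n x] by linarith
      then show "norm ((h n x - ?p x)\<^sup>2) \<le> (?p x)\<^sup>2" unfolding abs_le_square_iff by simp
    qed
  qed auto
  then obtain r :: "nat \<Rightarrow> nat" where r: "strict_mono r" "AE x in m. (\<lambda>n. R \<alpha> (h (r n)) x) \<longlonglongrightarrow> R \<alpha> ?p x"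
    using solves_tendsto_AE_subseq[where f=h and w="\<lambda>n. R \<alpha> (h n)", OF weight_const[OF \<alpha>] h(1) p
        resolvent_solves[OF \<alpha> h(1)] resolvent_solves[OF \<alpha> p]]
    by auto
  from h(5) r(2) show ?thesis
  proof eventually_elim
    case (elim x)
    have "(\<lambda>n. ennreal (R \<alpha> (h (r n)) x)) \<longlonglongrightarrow> resolvent_nn m D \<E> \<alpha> (\<lambda>y. ennreal (\<eta> y)) x"
      using LIMSEQ_subseq_LIMSEQ[OF elim(1) r(1)] by (simp add: o_def)
    moreover have "(\<lambda>n. ennreal (R \<alpha> (h (r n)) x)) \<longlonglongrightarrow> ennreal (R \<alpha> ?p x)"
      using elim(2) by (rule tendsto_ennrealI)
    ultimately show ?case by (rule LIMSEQ_unique)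
  qed
qed

text \<open>The essential supremum over all \<alpha> > 0 is attained along the rates, since every
  \<alpha> dominates some \<open>rate j\<close>. The countable supremum is therefore an admissible
  candidate for the choice, and any two candidates dominate each other a.e.\<close>

lemma potential_nn_eq:
  assumes \<eta>: "\<eta> \<in> L2 m"
  shows "AE x in m. potential_nn m D \<E> (\<lambda>y. ennreal (\<eta> y)) x = (SUP j. ennreal (R (rate j) (\<lambda>y. max 0 (\<eta> y)) x))"
    and "potential_nn m D \<E> (\<lambda>y. ennreal (\<eta> y)) \<in> borel_measurable m"
proof -
  let ?p = "\<lambda>y. max 0 (\<eta> y)"
  let ?S = "\<lambda>x. SUP j. ennreal (R (rate j) ?p x)"
  define P where "P w \<longleftrightarrow> w \<in> borel_measurable m \<and>
     (\<forall>\<alpha>>0. AE x in m. resolvent_nn m D \<E> \<alpha> (\<lambda>y. ennreal (\<eta> y)) x \<le> w x) \<and>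
     (\<forall>w'\<in>borel_measurable m. (\<forall>\<alpha>>0. AE x in m. resolvent_nn m D \<E> \<alpha> (\<lambda>y. ennreal (\<eta> y)) x \<le> w' x) \<longrightarrow>
       (AE x in m. w x \<le> w' x))" for w :: "'a \<Rightarrow> ennreal"
  have p: "?p \<in> L2 m" using \<eta> by (rule L2_pos_part)
  have [measurable]: "R (rate j) ?p \<in> borel_measurable m" for j
    using p rate_pos by (rule resolvent_measurable[rotated])
  have Sm: "?S \<in> borel_measurable m" by measurable
  have PS: "P ?S"
    unfolding P_def
  proof (intro conjI allI impI ballI)
    show "?S \<in> borel_measurable m" by (rule Sm)
    fix \<alpha> :: real assume \<alpha>: "\<alpha> > 0"
    obtain j where j: "rate j \<le> \<alpha>" using ex_rate_le[OF \<alpha>] by blast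
    have "AE x in m. R \<alpha> ?p x \<le> R (rate j) ?p x"
      using resolvent_antimono[OF rate_pos j p] by simp
    with resolvent_nn_eq[OF \<alpha> \<eta>]
    show "AE x in m. resolvent_nn m D \<E> \<alpha> (\<lambda>y. ennreal (\<eta> y)) x \<le> ?S x"
    proof eventually_elim
      case (elim x)
      have "ennreal (R \<alpha> ?p x) \<le> ennreal (R (rate j) ?p x)" using elim(2) by (rule ennreal_leI)
      also have "\<dots> \<le> ?S x" by (rule SUP_upper) simp
      finally show ?case using elim(1) by simp
    qed
  next
    fix w' :: "'a \<Rightarrow> ennreal"
    assume w': "\<forall>\<alpha>>0. AE x in m. resolvent_nn m D \<E> \<alpha> (\<lambda>y. ennreal (\<eta> y)) x \<le> w' x"
    have "AE x in m. \<forall>j. ennreal (R (rate j) ?p x) \<le> w' x"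
      unfolding AE_all_countable
    proof
      fix j
      from w' rate_pos have "AE x in m. resolvent_nn m D \<E> (rate j) (\<lambda>y. ennreal (\<eta> y)) x \<le> w' x" by blast
      with resolvent_nn_eq[OF rate_pos \<eta>, of j]
      show "AE x in m. ennreal (R (rate j) ?p x) \<le> w' x" by eventually_elim simp
    qed
    then show "AE x in m. ?S x \<le> w' x" by eventually_elim (auto intro: SUP_least)
  qed
  moreover have "potential_nn m D \<E> (\<lambda>y. ennreal (\<eta> y)) = (SOME w. P w)"
    unfolding potential_nn_def P_def ..
  ultimately have Pp: "P (potential_nn m D \<E> (\<lambda>y. ennreal (\<eta> y)))"
    by (metis someI)
  then show "potential_nn m D \<E> (\<lambda>y. ennreal (\<eta> y)) \<in> borel_measurable m" by (simp add: P_def)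
  have least: "AE x in m. w x \<le> w' x" if "P w" "P w'" for w w'
    using mp[OF bspec[OF that(1)[unfolded P_def, THEN conjunct2, THEN conjunct2]
          that(2)[unfolded P_def, THEN conjunct1]] that(2)[unfolded P_def, THEN conjunct2, THEN conjunct1]] .
  show "AE x in m. potential_nn m D \<E> (\<lambda>y. ennreal (\<eta> y)) x = ?S x"
    using least[OF Pp PS] least[OF PS Pp] by eventually_elim (rule antisym)
qed

lemma potential_measurable:
  assumes "\<eta> \<in> L2 m"
  shows "potential m D \<E> \<eta> \<in> borel_measurable m"
proof -
  have "(\<lambda>x. - \<eta> x) \<in> L2 m" using L2_scale[OF assms, of "-1"] by simp
  note [measurable] = potential_nn_eq(2)[OF assms] potential_nn_eq(2)[OF this]
  show ?thesis unfolding potential_def[abs_def] by measurable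
qed

text \<open>The uniform bound \<open>C\<close> excludes the value infinity, which
  \<open>enn2real\<close> would turn into 0.\<close>

lemma potential_nn_limit:
  assumes \<eta>: "\<eta> \<in> L2 m" and bd: "\<And>j. AE x in m. R (rate j) (\<lambda>y. max 0 (\<eta> y)) x \<le> C"
  shows "AE x in m. (\<lambda>j. R (rate j) (\<lambda>y. max 0 (\<eta> y)) x) \<longlonglongrightarrow> enn2real (potential_nn m D \<E> (\<lambda>y. ennreal (\<eta> y)) x)"
proof -
  let ?p = "\<lambda>y. max 0 (\<eta> y)"
  have p: "?p \<in> L2 m" using \<eta> by (rule L2_pos_part)
  have "AE x in m. \<forall>j. 0 \<le> R (rate j) ?p x \<and> R (rate j) ?p x \<le> C \<and> R (rate j) ?p x \<le> R (rate (Suc j)) ?p x"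
    unfolding AE_all_countable
  proof
    fix j
    have "AE x in m. 0 \<le> R (rate j) ?p x" by (intro resolvent_nonneg rate_pos p) simp
    moreover have "AE x in m. R (rate j) ?p x \<le> R (rate (Suc j)) ?p x"
      by (intro resolvent_antimono rate_pos p rate_antimono) simp_all
    ultimately show "AE x in m. 0 \<le> R (rate j) ?p x \<and> R (rate j) ?p x \<le> C \<and> R (rate j) ?p x \<le> R (rate (Suc j)) ?p x"
      using bd[of j] by eventually_elim simp
  qed
  with potential_nn_eq(1)[OF \<eta>] show ?thesis
  proof eventually_elim
    case (elim x)
    let ?r = "\<lambda>j. R (rate j) ?p x"
    have inc: "incseq ?r" using elim(2) by (intro incseq_SucI) simp
    have bb: "bdd_above (range ?r)" using elim(2) by (intro bdd_aboveI2[of _ _ C]) simp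
    have lim: "?r \<longlonglongrightarrow> (SUP j. ?r j)" by (rule LIMSEQ_incseq_SUP[OF bb inc])
    have "(\<lambda>j. ennreal (?r j)) \<longlonglongrightarrow> ennreal (SUP j. ?r j)" using lim by (rule tendsto_ennrealI)
    moreover have "(\<lambda>j. ennreal (?r j)) \<longlonglongrightarrow> (SUP j. ennreal (?r j))"
      using inc by (intro LIMSEQ_SUP) (auto simp: incseq_def intro: ennreal_leI)
    ultimately have "(SUP j. ennreal (?r j)) = ennreal (SUP j. ?r j)" by (rule LIMSEQ_unique[rotated])
    moreover have "0 \<le> (SUP j. ?r j)" using elim(2) incseq_le[OF inc lim, of 0] by (meson order_trans)
    ultimately show ?case using lim elim(1) by simp
  qed
qed

text \<open>A bound on the resolvents of the absolute value controls those of both the positive and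
  the negative part; by linearity their difference is the resolvent of \<eta>.\<close>

lemma potential_eq_limit:
  assumes \<eta>: "\<eta> \<in> L2 m"
    and bd: "\<And>j. AE x in m. R (rate j) (\<lambda>y. \<bar>\<eta> y\<bar>) x \<le> C"
  shows "AE x in m. (\<lambda>j. R (rate j) \<eta> x) \<longlonglongrightarrow> potential m D \<E> \<eta> x"
    and "AE x in m. potential_nn m D \<E> (\<lambda>y. ennreal \<bar>\<eta> y\<bar>) x \<le> ennreal C"
proof -
  have \<eta>': "(\<lambda>x. - \<eta> x) \<in> L2 m" using L2_scale[OF \<eta>, of "-1"] by simp
  note a = L2_abs[OF \<eta>] and p = L2_pos_part[OF \<eta>] L2_pos_part[OF \<eta>']
  have b: "AE x in m. R (rate j) (\<lambda>y. max 0 (\<eta> y)) x \<le> C" "AE x in m. R (rate j) (\<lambda>y. max 0 (- \<eta> y)) x \<le> C" for j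
    using bd[of j] resolvent_mono[OF rate_pos p(1) a, of j] resolvent_mono[OF rate_pos p(2) a, of j]
    by auto
  have "AE x in m. \<forall>j. R (rate j) (\<lambda>y. max 0 (\<eta> y)) x - R (rate j) (\<lambda>y. max 0 (- \<eta> y)) x = R (rate j) \<eta> x"
    unfolding AE_all_countable
  proof
    fix j
    have "AE x in m. (\<lambda>x. R (rate j) (\<lambda>y. max 0 (\<eta> y)) x - R (rate j) (\<lambda>y. max 0 (- \<eta> y)) x) x = R (rate j) \<eta> x"
    proof (rule solves_unique[OF weight_const[OF rate_pos[of j]] L2_diff[OF p] \<eta>])
      show "AE x in m. max 0 (\<eta> x) - max 0 (- \<eta> x) = \<eta> x" by (auto simp: max_def)
    qed (intro solves_diff weight_const resolvent_solves rate_pos p \<eta>)+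
    then show "AE x in m. R (rate j) (\<lambda>y. max 0 (\<eta> y)) x - R (rate j) (\<lambda>y. max 0 (- \<eta> y)) x = R (rate j) \<eta> x" by simp
  qed
  with potential_nn_limit[OF \<eta> b(1)] potential_nn_limit[OF \<eta>' b(2)]
  show "AE x in m. (\<lambda>j. R (rate j) \<eta> x) \<longlonglongrightarrow> potential m D \<E> \<eta> x"
  proof eventually_elim
    case (elim x)
    show ?case using tendsto_diff[OF elim(1,2)] elim(3) unfolding potential_def by simp
  qed
  have "AE x in m. \<forall>j. R (rate j) (\<lambda>y. \<bar>\<eta> y\<bar>) x \<le> C" unfolding AE_all_countable using bd by blast
  with potential_nn_eq(1)[OF a]
  show "AE x in m. potential_nn m D \<E> (\<lambda>y. ennreal \<bar>\<eta> y\<bar>) x \<le> ennreal C"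
    by eventually_elim (auto intro!: SUP_least ennreal_leI)
qed

end


section \<open>Transience and time change\<close>

text \<open>The reference function is taken nonnegative and bounded at every point; the main theorem
  arranges this by passing to the positive part.\<close>

locale transient_dirichlet = dirichlet +
  fixes g :: "'a \<Rightarrow> real" and Cg :: real
  assumes g_integrable: "integrable m g"
    and g_nonneg: "0 \<le> g x"
    and g_le: "g x \<le> Cg"
    and g_pos: "AE x in m. 0 < g x"
    and transience: "u \<in> D \<Longrightarrow> (LINT x|m. \<bar>u x\<bar> * g x) \<le> sqrt (\<E> u u)"
begin

section \<open>The reference function and the finiteness of its potential\<close>

lemma g_measurable[measurable]: "g \<in> borel_measurable m"
  using g_integrable by (rule borel_measurable_integrable)

lemma L2_g_bound:
  assumes "f \<in> borel_measurable m" "AE x in m. \<bar>f x\<bar> \<le> c * g x"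
  shows "f \<in> L2 m"
proof (rule L2_bound)
  show "g \<in> L2 m"
    by (rule L2_of_bounded_integrable[OF g_integrable, of Cg]) (use g_nonneg g_le in auto)
qed (use assms g_nonneg in auto)

lemma g_L2: "g \<in> L2 m"
  by (rule L2_g_bound[of _ 1]) (use g_nonneg in auto)

text \<open>The integral t of g times w, for w the resolvent of g, is at most the root of the energy
  of w by transience, and that energy is at most t. So t <= sqrt t, hence t <= 1, uniformly in
  \<alpha>.\<close>

lemma integral_g_resolvent:
  assumes \<alpha>: "\<alpha> > 0"
  shows "(LINT x|m. g x * R \<alpha> g x) \<le> 1"
proof -
  let ?w = "R \<alpha> g"
  have w: "solves (\<lambda>_. \<alpha>) g ?w" by (rule resolvent_solves[OF \<alpha> g_L2])
  have wD: "?w \<in> D" using w by (rule solves_mem)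
  define t where "t = (LINT x|m. g x * ?w x)"
  have w0: "AE x in m. 0 \<le> ?w x" using g_nonneg by (intro resolvent_nonneg[OF \<alpha> g_L2]) auto
  have [measurable]: "?w \<in> borel_measurable m" using w by (rule solves_measurable)
  have "t = (LINT x|m. \<bar>?w x\<bar> * g x)"
    unfolding t_def by (rule integral_cong_AE) (use w0 in auto)
  also have "\<dots> \<le> sqrt (\<E> ?w ?w)" by (rule transience[OF wD])
  also have "\<dots> \<le> sqrt t"
    using solves_energy(2)[OF weight_const[OF \<alpha>] w] by (simp add: t_def)
  finally have le: "t \<le> sqrt t" .
  have "t \<ge> 0" unfolding t_def using w0 g_nonneg by (intro integral_nonneg_AE) auto
  show ?thesis
  proof (rule ccontr)
    assume "\<not> ?thesis"
    then have t1: "t > 1" by (simp add: t_def)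
    have "t * t \<le> t" using mult_mono[OF le le] \<open>t \<ge> 0\<close> by simp
    then show False using t1 by simp
  qed
qed

text \<open>By monotone convergence the uniform bound passes to the supremum over j, which is then
  finite wherever g > 0 up to a null set. Hence the sets \<open>level n\<close> exhaust the space up
  to a null set.\<close>

lemma resolvent_g_bounded_AE: "AE x in m. \<exists>n::nat. \<forall>j. R (rate j) g x \<le> real n"
proof -
  have [measurable]: "R (rate j) g \<in> borel_measurable m" for j
    by (rule resolvent_measurable[OF rate_pos g_L2])
  have nn: "AE x in m. 0 \<le> R (rate j) g x" for j
    using g_nonneg by (intro resolvent_nonneg[OF rate_pos g_L2]) auto
  let ?F = "\<lambda>j x. ennreal (g x * R (rate j) g x)"
  have inc: "AE x in m. ?F j x \<le> ?F (Suc j) x" for j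
  proof -
    have "AE x in m. R (rate j) g x \<le> R (rate (Suc j)) g x"
      using g_nonneg by (intro resolvent_antimono[OF rate_pos rate_antimono g_L2]) auto
    then show ?thesis by eventually_elim (auto intro!: ennreal_leI mult_left_mono g_nonneg)
  qed
  have "(\<integral>\<^sup>+x. (SUP j. ?F j x) \<partial>m) = (SUP j. integral\<^sup>N m (?F j))"
    by (rule nn_integral_monotone_convergence_SUP_AE[of ?F, OF inc]) measurable
  also have "\<dots> \<le> 1"
  proof (rule SUP_least)
    fix j
    have "integral\<^sup>N m (?F j) = ennreal (LINT x|m. g x * R (rate j) g x)"
      using nn[of j] g_nonneg L2_mult_integrable[OF g_L2 solves_L2[OF resolvent_solves[OF rate_pos g_L2]]]
      by (intro nn_integral_eq_integral) auto
    also have "\<dots> \<le> ennreal 1" by (intro ennreal_leI integral_g_resolvent rate_pos)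
    finally show "integral\<^sup>N m (?F j) \<le> 1" by simp
  qed
  finally have "(\<integral>\<^sup>+x. (SUP j. ?F j x) \<partial>m) \<noteq> \<infinity>" by (auto simp: top_unique)
  then have "AE x in m. (SUP j. ?F j x) \<noteq> \<infinity>" by (intro nn_integral_PInf_AE) measurable
  with g_pos show ?thesis
  proof eventually_elim
    case (elim x)
    then obtain s where s: "(SUP j. ?F j x) = ennreal s" "0 \<le> s" by (cases "SUP j. ?F j x") auto
    obtain n :: nat where n: "s / g x \<le> real n" using real_arch_simple by blast
    have "R (rate j) g x \<le> real n" for j
    proof -
      have "?F j x \<le> ennreal s" unfolding s(1)[symmetric] by (rule SUP_upper) simp
      then have "g x * R (rate j) g x \<le> s" using s(2) by (simp add: ennreal_le_iff)
      then have "R (rate j) g x \<le> s / g x" using elim(1) by (simp add: field_simps)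
      then show ?thesis using n by simp
    qed
    then show ?case by blast
  qed
qed

text \<open>The resolvents along the rates stand in for the potential of g, which makes the set
  measurable for the chosen representatives.\<close>

definition level :: "nat \<Rightarrow> 'a set" where
  "level n = {x \<in> space m. \<forall>j. R (rate j) g x \<le> real n}"

definition g_cut :: "nat \<Rightarrow> 'a \<Rightarrow> real" where
  "g_cut n x = g x * indicator (level n) x"

lemma level_sets[measurable]: "level n \<in> sets m"
proof -
  have [measurable]: "R (rate j) g \<in> borel_measurable m" for j
    by (rule resolvent_measurable[OF rate_pos g_L2])
  show ?thesis unfolding level_def by measurable
qed

lemma g_cut_measurable[measurable]: "g_cut n \<in> borel_measurable m"
  unfolding g_cut_def[abs_def] by measurable

lemma g_cut_bounds: "0 \<le> g_cut n x" "g_cut n x \<le> g x"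
  using g_nonneg by (auto simp: g_cut_def indicator_def)

lemma g_cut_L2: "g_cut n \<in> L2 m"
  using g_cut_bounds by (intro L2_g_bound[of _ 1]) auto

lemma g_cut_tendsto: "AE x in m. (\<lambda>n. g_cut n x) \<longlonglongrightarrow> g x"
proof -
  have "AE x in m. x \<in> space m" by simp
  with resolvent_g_bounded_AE show ?thesis
  proof eventually_elim
    case (elim x)
    then obtain n :: nat where n: "\<And>j. R (rate j) g x \<le> real n" by blast
    have "g_cut i x = g x" if "i \<ge> n" for i
    proof -
      have "R (rate j) g x \<le> real i" for j using n[of j] that by simp
      then show ?thesis using elim by (simp add: g_cut_def level_def)
    qed
    then show ?case by (intro tendsto_eventually) (auto simp: eventually_sequentially)
  qed
qed

text \<open>A maximum principle: the potential of a function carried by \<open>level n\<close> is bounded by \<open>n\<close>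
  as soon as it is bounded by \<open>n\<close> on \<open>level n\<close>.\<close>

lemma resolvent_g_cut_le: "AE x in m. R (rate j) (g_cut n) x \<le> real n"
proof -
  have le: "AE x in m. R (rate j) (g_cut n) x \<le> R (rate j) g x"
    using g_cut_bounds by (intro resolvent_mono rate_pos g_cut_L2 g_L2) auto
  have "AE x in m. 0 \<le> R (rate j) (g_cut n) x \<and> R (rate j) (g_cut n) x \<le> real n"
  proof (rule solves_clip_eq[OF weight_const[OF rate_pos] g_cut_L2 resolvent_solves[OF rate_pos g_cut_L2]])
    show "AE x in m. real n < R (rate j) (g_cut n) x \<longrightarrow> 2 * g_cut n x \<le> rate j * (real n + R (rate j) (g_cut n) x)"
      using le
    proof eventually_elim
      case (elim x)
      show ?case
      proof
        assume 1: "real n < R (rate j) (g_cut n) x"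
        \<comment> \<open>On \<open>level n\<close> the comparison \<open>le\<close> already bounds
          the resolvent by n, so an excess over n can occur only where \<open>g_cut n\<close>
          vanishes.\<close>
        then have "x \<notin> level n" using elim by (auto simp: level_def intro!: exI[of _ j])
        then have "g_cut n x = 0" by (simp add: g_cut_def)
        then show "2 * g_cut n x \<le> rate j * (real n + R (rate j) (g_cut n) x)"
          using 1 rate_pos[of j] by simp
      qed
    qed
  qed (use g_cut_bounds in auto)
  then show ?thesis by auto
qed

text \<open>Comparison with c times the resolvent of \<open>g_cut n\<close>. The first bound makes
  \<eta> an admissible test function; the second dominates the error terms in
  \<open>potential_time_change\<close>.\<close>

lemma resolvent_g_cut_bound:
  assumes "\<eta> \<in> borel_measurable m" "AE x in m. \<bar>\<eta> x\<bar> \<le> c * g_cut n x" "c \<ge> 0"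
  shows "AE x in m. R (rate j) (\<lambda>y. \<bar>\<eta> y\<bar>) x \<le> c * real n"
    and "AE x in m. \<bar>R (rate j) \<eta> x\<bar> \<le> c * real n"
    and "\<eta> \<in> L2 m"
proof -
  note [measurable] = assms(1)
  show \<eta>: "\<eta> \<in> L2 m"
    using assms(2) g_cut_bounds(1) by (intro L2_bound[OF g_cut_L2[of n], of _ c]) auto
  have w: "solves (\<lambda>_. rate j) (\<lambda>x. c * g_cut n x) (\<lambda>x. c * R (rate j) (g_cut n) x)"
    by (intro solves_scale weight_const rate_pos g_cut_L2 resolvent_solves)
  have cL: "(\<lambda>x. c * g_cut n x) \<in> L2 m" by (intro L2_scale g_cut_L2)
  have le: "AE x in m. c * R (rate j) (g_cut n) x \<le> c * real n"
    using resolvent_g_cut_le[of j n] by eventually_elim (use assms(3) in \<open>simp add: mult_left_mono\<close>)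
  have "AE x in m. R (rate j) (\<lambda>y. \<bar>\<eta> y\<bar>) x \<le> c * R (rate j) (g_cut n) x"
    using solves_mono[OF weight_const[OF rate_pos] L2_abs[OF \<eta>] cL resolvent_solves[OF rate_pos L2_abs[OF \<eta>]] w assms(2)] .
  then show "AE x in m. R (rate j) (\<lambda>y. \<bar>\<eta> y\<bar>) x \<le> c * real n"
    using le by eventually_elim simp
  have s: "AE x in m. \<eta> x \<le> c * g_cut n x" "AE x in m. - \<eta> x \<le> c * g_cut n x"
    using assms(2) by (auto elim!: AE_mp)
  have "AE x in m. R (rate j) \<eta> x \<le> c * R (rate j) (g_cut n) x"
    using solves_mono[OF weight_const[OF rate_pos] \<eta> cL resolvent_solves[OF rate_pos \<eta>] w s(1)] .
  moreover
  have "(\<lambda>x. - \<eta> x) \<in> L2 m" using L2_scale[OF \<eta>, of "-1"] by simp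
  moreover have "solves (\<lambda>_. rate j) (\<lambda>x. - \<eta> x) (\<lambda>x. - R (rate j) \<eta> x)"
    using solves_scale[OF weight_const[OF rate_pos] \<eta> resolvent_solves[OF rate_pos \<eta>], where c="-1"] by simp
  ultimately have "AE x in m. R (rate j) \<eta> x \<le> c * R (rate j) (g_cut n) x"
    "AE x in m. - R (rate j) \<eta> x \<le> c * R (rate j) (g_cut n) x"
    using solves_mono[OF weight_const[OF rate_pos] _ cL _ w s(2)] by blast+
  then show "AE x in m. \<bar>R (rate j) \<eta> x\<bar> \<le> c * real n"
    using le by eventually_elim simp
qed

text \<open>Adding the killing rate \<open>rate j\<close> keeps the solutions of the time-changed equation in \<open>D\<close>; without it
  they would only lie in the extended domain.\<close>

definition time_change_weight :: "real \<Rightarrow> nat \<Rightarrow> nat \<Rightarrow> 'a \<Rightarrow> real" where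
  "time_change_weight \<beta> n j x = rate j + \<beta> * g_cut n x"

section \<open>The time-changed equation and its limit as the killing vanishes\<close>

lemma weight_time_change:
  assumes \<beta>: "\<beta> > 0"
  shows "weight m (time_change_weight \<beta> n j)"
proof -
  have "time_change_weight \<beta> n j \<in> borel_measurable m" unfolding time_change_weight_def[abs_def] by measurable
  moreover have "rate j \<le> time_change_weight \<beta> n j x \<and> time_change_weight \<beta> n j x \<le> rate j + \<beta> * Cg" for x
    using \<beta> g_cut_bounds[of n x] g_le[of x] by (simp add: time_change_weight_def)
  ultimately show ?thesis unfolding weight_def using rate_pos by blast
qed

lemma g_cut_mult_L2:
  assumes [measurable]: "v \<in> borel_measurable m" and "AE x in m. \<bar>v x\<bar> \<le> k"
  shows "(\<lambda>x. \<beta> * g_cut n x * v x) \<in> L2 m"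
proof (rule L2_bound[OF g_cut_L2[of n]])
  show "AE x in m. \<bar>\<beta> * g_cut n x * v x\<bar> \<le> (\<bar>\<beta>\<bar> * k) * \<bar>g_cut n x\<bar>"
    using assms(2)
  proof eventually_elim
    case (elim x)
    have "\<bar>\<beta> * g_cut n x * v x\<bar> = (\<bar>\<beta>\<bar> * \<bar>g_cut n x\<bar>) * \<bar>v x\<bar>" by (simp add: abs_mult)
    also have "\<dots> \<le> (\<bar>\<beta>\<bar> * \<bar>g_cut n x\<bar>) * k" using elim by (intro mult_left_mono) auto
    finally show ?case by (simp add: mult_ac)
  qed
qed measurable

text \<open>For nonnegative data, where a solution exceeds k the weight times the excess level
  dominates the right side, so clipping at k changes nothing. Lowering the killing rate raises the
  solution: \<open>W j\<close> solves the next equation with a right side that is smaller by a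
  multiple of the nonnegative function \<open>W j\<close>.\<close>

lemma time_change_monotone:
  assumes \<beta>: "\<beta> > 0" and v: "v \<in> borel_measurable m" "AE x in m. 0 \<le> v x \<and> v x \<le> k" and k: "k \<ge> 0"
    and W: "\<And>j. solves (time_change_weight \<beta> n j) (\<lambda>x. \<beta> * g_cut n x * v x) (W j)"
  shows "AE x in m. \<forall>j. 0 \<le> W j x \<and> W j x \<le> k \<and> W j x \<le> W (Suc j) x"
  unfolding AE_all_countable
proof
  fix j
  let ?f = "\<lambda>x. \<beta> * g_cut n x * v x"
  have f: "?f \<in> L2 m" using v by (intro g_cut_mult_L2[of v k]) auto
  have f0: "AE x in m. 0 \<le> ?f x" using v(2) by eventually_elim (use \<beta> g_cut_bounds in simp)
  have 1: "AE x in m. 0 \<le> W j x \<and> W j x \<le> k"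
  proof (rule solves_clip_eq[OF weight_time_change[OF \<beta>] f W k _ f0])
    show "AE x in m. k < W j x \<longrightarrow> 2 * (\<beta> * g_cut n x * v x) \<le> time_change_weight \<beta> n j x * (k + W j x)"
      using v(2)
    proof eventually_elim
      case (elim x)
      show ?case
      proof
        assume W: "k < W j x"
        have "2 * (\<beta> * g_cut n x * v x) \<le> \<beta> * g_cut n x * (k + W j x)"
          using mult_left_mono[of "2 * v x" "k + W j x" "\<beta> * g_cut n x"] elim W \<beta> g_cut_bounds by simp
        also have "\<dots> \<le> time_change_weight \<beta> n j x * (k + W j x)"
          using W k rate_pos[of j] by (intro mult_right_mono) (auto simp: time_change_weight_def)
        finally show "2 * (\<beta> * g_cut n x * v x) \<le> time_change_weight \<beta> n j x * (k + W j x)" .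
      qed
    qed
  qed
  have s: "solves (time_change_weight \<beta> n (Suc j)) (\<lambda>x. ?f x + (time_change_weight \<beta> n (Suc j) x - time_change_weight \<beta> n j x) * W j x) (W j)"
    by (rule solves_change_weight[OF weight_time_change[OF \<beta>] weight_time_change[OF \<beta>] f W])
  have eq: "(\<lambda>x. ?f x + (time_change_weight \<beta> n (Suc j) x - time_change_weight \<beta> n j x) * W j x) = (\<lambda>x. ?f x + (rate (Suc j) - rate j) * W j x)"
    by (simp add: time_change_weight_def)
  have "AE x in m. W j x \<le> W (Suc j) x"
  proof (rule solves_mono[OF weight_time_change[OF \<beta>] _ f s[unfolded eq] W])
    show "(\<lambda>x. ?f x + (rate (Suc j) - rate j) * W j x) \<in> L2 m"
      by (intro L2_add f L2_scale solves_L2[OF W])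
    show "AE x in m. ?f x + (rate (Suc j) - rate j) * W j x \<le> ?f x"
      using 1
    proof eventually_elim
      case (elim x)
      have "(rate (Suc j) - rate j) * W j x \<le> 0"
        using elim rate_antimono[of j "Suc j"] by (intro mult_nonpos_nonneg) auto
      then show ?case by simp
    qed
  qed
  with 1 show "AE x in m. 0 \<le> W j x \<and> W j x \<le> k \<and> W j x \<le> W (Suc j) x" by eventually_elim simp
qed

text \<open>Monotonicity in j holds for nonnegative data only, so the positive and negative parts of
  v are solved separately. Both solutions lie between 0 and k, hence their difference is bounded by
  k, not by 2 k; this is what keeps the constant in the final estimate.\<close>

lemma time_change_limit:
  assumes \<beta>: "\<beta> > 0" and v[measurable]: "v \<in> borel_measurable m" and vk: "AE x in m. \<bar>v x\<bar> \<le> k" and k: "k \<ge> 0"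
  obtains W w where "\<And>j. solves (time_change_weight \<beta> n j) (\<lambda>x. \<beta> * g_cut n x * v x) (W j)"
    "w \<in> borel_measurable m" "\<And>j. AE x in m. \<bar>W j x\<bar> \<le> k" "\<And>x. \<bar>w x\<bar> \<le> k"
    "AE x in m. (\<lambda>j. W j x) \<longlonglongrightarrow> w x"
proof -
  define vp where "vp = (\<lambda>x. max 0 (v x))"
  define vn where "vn = (\<lambda>x. max 0 (- v x))"
  have vm[measurable]: "vp \<in> borel_measurable m" "vn \<in> borel_measurable m"
    unfolding vp_def vn_def by measurable
  have bd: "AE x in m. 0 \<le> vp x \<and> vp x \<le> k" "AE x in m. 0 \<le> vn x \<and> vn x \<le> k"
    using vk k by (auto simp: vp_def vn_def)
  have L: "(\<lambda>x. \<beta> * g_cut n x * vp x) \<in> L2 m" "(\<lambda>x. \<beta> * g_cut n x * vn x) \<in> L2 m"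
    using bd by (auto intro!: g_cut_mult_L2[of _ k])
  obtain P where P: "\<And>j. solves (time_change_weight \<beta> n j) (\<lambda>x. \<beta> * g_cut n x * vp x) (P j)"
    using ex_solves[OF weight_time_change[OF \<beta>] L(1)] by metis
  obtain N where N: "\<And>j. solves (time_change_weight \<beta> n j) (\<lambda>x. \<beta> * g_cut n x * vn x) (N j)"
    using ex_solves[OF weight_time_change[OF \<beta>] L(2)] by metis
  define W where "W j x = P j x - N j x" for j x
  have eq: "(\<lambda>x. \<beta> * g_cut n x * vp x - \<beta> * g_cut n x * vn x) = (\<lambda>x. \<beta> * g_cut n x * v x)"
    by (auto simp: vp_def vn_def fun_eq_iff max_def)
  have W: "solves (time_change_weight \<beta> n j) (\<lambda>x. \<beta> * g_cut n x * v x) (W j)" for j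
    using solves_diff[OF weight_time_change[OF \<beta>] L P N] unfolding eq W_def[abs_def] .
  \<comment> \<open>Clipping the limit changes it only on a null set, but makes the bound k hold at
    every point, including those where the limit does not exist.\<close>
  define w where "w x = min (max (- k) (lim (\<lambda>j. W j x))) k" for x
  have [measurable]: "W j \<in> borel_measurable m" for j using W by (rule solves_measurable)
  have PN: "AE x in m. (\<forall>j. \<bar>W j x\<bar> \<le> k) \<and> convergent (\<lambda>j. W j x)"
    using time_change_monotone[OF \<beta> vm(1) bd(1) k P] time_change_monotone[OF \<beta> vm(2) bd(2) k N]
  proof eventually_elim
    case (elim x)
    have "\<bar>W j x\<bar> \<le> k" for j using elim(1)[rule_format, of j] elim(2)[rule_format, of j] unfolding W_def by linarith
    moreover have conv: "convergent X" if "\<forall>j. 0 \<le> X j \<and> X j \<le> k \<and> X j \<le> X (Suc j)" for X :: "nat \<Rightarrow> real"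
      using that by (intro Bseq_monoseq_convergent BseqI'[of _ k] incseq_imp_monoseq incseq_SucI) auto
    then have "convergent (\<lambda>j. P j x)" "convergent (\<lambda>j. N j x)"
      using elim(1) conv[of "\<lambda>j. P j x"] elim(2) conv[of "\<lambda>j. N j x"] by simp_all
    ultimately show ?case unfolding W_def by (auto intro: convergent_diff)
  qed
  have "AE x in m. (\<lambda>j. W j x) \<longlonglongrightarrow> w x"
    using PN
  proof eventually_elim
    case (elim x)
    then have l: "(\<lambda>j. W j x) \<longlonglongrightarrow> lim (\<lambda>j. W j x)" by (simp add: convergent_LIMSEQ_iff)
    have "lim (\<lambda>j. W j x) \<le> k" using elim by (intro LIMSEQ_le_const2[OF l]) (auto simp: abs_le_iff)
    moreover have "- k \<le> lim (\<lambda>j. W j x)"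
      using elim by (intro LIMSEQ_le_const[OF l]) (auto simp: abs_le_iff minus_le_iff)
    ultimately show ?case using l by (simp add: w_def)
  qed
  moreover have "w \<in> borel_measurable m" unfolding w_def[abs_def] by measurable
  moreover have "\<bar>w x\<bar> \<le> k" for x using k by (auto simp: w_def)
  moreover have "AE x in m. \<bar>W j x\<bar> \<le> k" for j using PN by eventually_elim simp
  ultimately show ?thesis using that[of W w] W by blast
qed

text \<open>The error \<open>e j\<close> between the resolvent of \<eta> and \<open>W j\<close>
  solves the equation with rate j and right side \<beta> \<rho> (W j - w). Its energy is therefore
  at most the integral of that right side times \<open>e j\<close>, which tends to 0 by dominated
  convergence. Transience turns this into convergence in L1 with weight g, so the limits of the
  resolvents and of \<open>W j\<close> agree a.e.\<close>

lemma potential_time_change: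
  assumes \<beta>: "\<beta> > 0" and v[measurable]: "v \<in> borel_measurable m" and vk: "AE x in m. \<bar>v x\<bar> \<le> k" and k: "k \<ge> 0"
    and W: "\<And>j. solves (time_change_weight \<beta> n j) (\<lambda>x. \<beta> * g_cut n x * v x) (W j)"
    and w[measurable]: "w \<in> borel_measurable m" and Wk: "\<And>j. AE x in m. \<bar>W j x\<bar> \<le> k" and wk: "\<And>x. \<bar>w x\<bar> \<le> k"
    and lim: "AE x in m. (\<lambda>j. W j x) \<longlonglongrightarrow> w x"
  defines "\<eta> \<equiv> \<lambda>x. \<beta> * g_cut n x * (v x - w x)"
  shows "AE x in m. potential m D \<E> \<eta> x = w x"
    and "\<eta> \<in> L2 m" and "integrable m \<eta>"
    and "AE x in m. potential_nn m D \<E> (\<lambda>y. ennreal \<bar>\<eta> y\<bar>) x \<le> ennreal (2 * k * \<beta> * real n)"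
proof -
  let ?c = "2 * k * \<beta>"
  have c: "?c \<ge> 0" using k \<beta> by simp
  have \<eta>m[measurable]: "\<eta> \<in> borel_measurable m" unfolding \<eta>_def by measurable
  have [measurable]: "W j \<in> borel_measurable m" for j using W by (rule solves_measurable)
  have bd: "AE x in m. \<bar>\<eta> x\<bar> \<le> ?c * g_cut n x"
    using vk
  proof eventually_elim
    case (elim x)
    have "\<bar>v x - w x\<bar> \<le> 2 * k" using elim wk[of x] by linarith
    then have "\<beta> * g_cut n x * \<bar>v x - w x\<bar> \<le> \<beta> * g_cut n x * (2 * k)"
      using \<beta> g_cut_bounds by (intro mult_left_mono) auto
    then show ?case using \<beta> g_cut_bounds(1)[of n x] by (simp add: \<eta>_def abs_mult mult_ac)
  qed
  note b = resolvent_g_cut_bound[OF \<eta>m bd c]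
  show \<eta>L: "\<eta> \<in> L2 m" by (rule b(3))
  show "integrable m \<eta>"
  proof (rule Bochner_Integration.integrable_bound)
    show "integrable m (\<lambda>x. ?c * g x)" using g_integrable by simp
    show "AE x in m. norm (\<eta> x) \<le> norm (?c * g x)"
      using bd
    proof eventually_elim
      case (elim x)
      have "?c * g_cut n x \<le> ?c * g x" using c g_cut_bounds by (intro mult_left_mono)
      then show ?case using elim by simp
    qed
  qed measurable
  note pot = potential_eq_limit[OF \<eta>L b(1)]
  show "AE x in m. potential_nn m D \<E> (\<lambda>y. ennreal \<bar>\<eta> y\<bar>) x \<le> ennreal (2 * k * \<beta> * real n)"
    by (rule pot(2))
  define e where "e j x = R (rate j) \<eta> x - W j x" for j x
  let ?h = "\<lambda>j x. \<beta> * g_cut n x * (W j x - w x)"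
  have fL: "(\<lambda>x. \<beta> * g_cut n x * v x) \<in> L2 m" using vk by (intro g_cut_mult_L2) auto
  have sW: "solves (\<lambda>_. rate j) (\<lambda>x. \<beta> * g_cut n x * v x + (rate j - time_change_weight \<beta> n j x) * W j x) (W j)" for j
    by (rule solves_change_weight[OF weight_time_change[OF \<beta>] weight_const[OF rate_pos] fL W])
  have gL: "(\<lambda>x. \<beta> * g_cut n x * v x + (rate j - time_change_weight \<beta> n j x) * W j x) \<in> L2 m" for j
  proof -
    have "(\<lambda>x. \<beta> * g_cut n x * W j x) \<in> L2 m" using Wk[of j] by (intro g_cut_mult_L2) auto
    from L2_diff[OF fL this] show ?thesis by (simp add: time_change_weight_def algebra_simps)
  qed
  have eeq: "(\<lambda>x. \<eta> x - (\<beta> * g_cut n x * v x + (rate j - time_change_weight \<beta> n j x) * W j x)) = ?h j" for j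
    by (simp add: \<eta>_def time_change_weight_def algebra_simps)
  have es: "solves (\<lambda>_. rate j) (?h j) (e j)" for j
    using solves_diff[OF weight_const[OF rate_pos] \<eta>L gL resolvent_solves[OF rate_pos \<eta>L] sW, of j]
    unfolding eeq e_def[abs_def] .
  have [measurable]: "e j \<in> borel_measurable m" for j using es by (rule solves_measurable)
  \<comment> \<open>The first summand bounds the resolvent of \<eta>, through
    \<open>resolvent_g_cut_bound\<close>; the second bounds \<open>W j\<close>.\<close>
  let ?M = "?c * real n + k"
  have eM: "AE x in m. \<bar>e j x\<bar> \<le> ?M" for j
    using b(2)[of j] Wk[of j] by eventually_elim (simp add: e_def)
  have "(\<lambda>j. LINT x|m. ?h j x * e j x) \<longlonglongrightarrow> (LINT x|m. 0)"
  proof (rule integral_dominated_convergence)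
    show "integrable m (\<lambda>x. ?c * ?M * g x)" using g_integrable by simp
    show "AE x in m. norm (?h j x * e j x) \<le> ?c * ?M * g x" for j
      using Wk[of j] eM[of j]
    proof eventually_elim
      case (elim x)
      have 1: "\<bar>W j x - w x\<bar> \<le> 2 * k" using elim wk[of x] by linarith
      have "\<beta> * g_cut n x * \<bar>W j x - w x\<bar> \<le> \<beta> * g x * (2 * k)"
        using \<beta> g_cut_bounds g_nonneg 1 by (intro mult_mono) auto
      then have "\<beta> * g_cut n x * \<bar>W j x - w x\<bar> * \<bar>e j x\<bar> \<le> \<beta> * g x * (2 * k) * ?M"
        by (rule mult_mono) (use \<beta> g_nonneg k elim in auto)
      then show ?case using \<beta> g_cut_bounds(1)[of n x] by (simp add: abs_mult mult_ac)
    qed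
    show "AE x in m. (\<lambda>j. ?h j x * e j x) \<longlonglongrightarrow> 0"
    proof -
      have "AE x in m. \<forall>j. \<bar>e j x\<bar> \<le> ?M" unfolding AE_all_countable using eM by blast
      with lim show ?thesis
      proof eventually_elim
        case (elim x)
        have "(\<lambda>j. ?h j x) \<longlonglongrightarrow> \<beta> * g_cut n x * (w x - w x)"
          by (intro tendsto_intros elim)
        then have h0: "(\<lambda>j. ?h j x) \<longlonglongrightarrow> 0" by simp
        show ?case
        proof (rule Lim_null_comparison[OF always_eventually])
          show "\<forall>j. norm (?h j x * e j x) \<le> \<bar>?h j x\<bar> * ?M"
            using elim(2) by (auto simp: abs_mult intro!: mult_left_mono)
          show "(\<lambda>j. \<bar>?h j x\<bar> * ?M) \<longlonglongrightarrow> 0"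
            using tendsto_mult[OF tendsto_rabs[OF h0] tendsto_const, of ?M] by simp
        qed
      qed
    qed
  qed measurable
  then have up: "(\<lambda>j. sqrt (LINT x|m. ?h j x * e j x)) \<longlonglongrightarrow> 0"
    using tendsto_real_sqrt by fastforce
  have le: "(LINT x|m. norm (\<bar>e j x\<bar> * g x)) \<le> sqrt (LINT x|m. ?h j x * e j x)" for j
  proof -
    have "(LINT x|m. norm (\<bar>e j x\<bar> * g x)) = (LINT x|m. \<bar>e j x\<bar> * g x)"
      using g_nonneg by simp
    also have "\<dots> \<le> sqrt (\<E> (e j) (e j))" by (rule transience[OF solves_mem[OF es]])
    also have "\<dots> \<le> sqrt (LINT x|m. ?h j x * e j x)"
      using solves_energy(2)[OF weight_const[OF rate_pos] es] by simp
    finally show ?thesis .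
  qed
  have "(\<lambda>j. LINT x|m. norm (\<bar>e j x\<bar> * g x)) \<longlonglongrightarrow> 0"
    by (rule tendsto_sandwich[OF _ _ tendsto_const up]) (use le in \<open>simp_all add: always_eventually\<close>)
  then obtain r :: "nat \<Rightarrow> nat" where r: "strict_mono r" "AE x in m. (\<lambda>j. \<bar>e (r j) x\<bar> * g x) \<longlonglongrightarrow> 0"
    using tendsto_L1_AE_subseq[of m "\<lambda>j x. \<bar>e j x\<bar> * g x"]
      L2_mult_integrable[OF L2_abs[OF solves_L2[OF es]] g_L2] by auto
  from pot(1) lim r(2) g_pos show "AE x in m. potential m D \<E> \<eta> x = w x"
  proof eventually_elim
    case (elim x)
    have "(\<lambda>j. e j x) \<longlonglongrightarrow> potential m D \<E> \<eta> x - w x"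
      unfolding e_def by (intro tendsto_diff elim)
    then have "(\<lambda>j. e (r j) x) \<longlonglongrightarrow> potential m D \<E> \<eta> x - w x"
      using LIMSEQ_subseq_LIMSEQ[OF _ r(1)] by (fastforce simp: o_def)
    then have "(\<lambda>j. \<bar>e (r j) x\<bar> * g x) \<longlonglongrightarrow> \<bar>potential m D \<E> \<eta> x - w x\<bar> * g x"
      by (intro tendsto_intros)
    with elim(3) have "\<bar>potential m D \<E> \<eta> x - w x\<bar> * g x = 0" by (rule LIMSEQ_unique[rotated])
    then show ?case using elim(4) by simp
  qed
qed

end


section \<open>Finite signed measures and quasi-continuity\<close>

lemma finite_signed_measure_Un:
  assumes \<mu>: "finite_signed_measure \<mu>" and "A \<in> sets borel" "B \<in> sets borel" "A \<inter> B = {}"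
  shows "\<mu> (A \<union> B) = \<mu> A + \<mu> B"
proof -
  have "range (binaryset A B) \<subseteq> sets borel" using assms by (simp add: range_binaryset_eq)
  moreover have "disjoint_family (binaryset A B)"
    using assms(4) by (auto simp: disjoint_family_on_def binaryset_def)
  ultimately have "(\<lambda>n. \<mu> (binaryset A B n)) sums \<mu> (A \<union> B)"
    using \<mu> unfolding finite_signed_measure_def by (metis UN_binaryset_eq)
  moreover have "(\<lambda>n. \<mu> (binaryset A B n)) sums (\<mu> A + \<mu> B)"
    using \<mu> by (intro binaryset_sums) (simp add: finite_signed_measure_def)
  ultimately show ?thesis by (rule sums_unique2)
qed

text \<open>Call a set bad if \<mu> is unbounded on its Borel subsets. A bad set contains a bad
  subset whose removal takes away mass at least 1 in absolute value; iterating gives disjoint pieces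
  whose masses do not tend to 0, against countable additivity.\<close>

lemma finite_signed_measure_bounded:
  assumes \<mu>: "finite_signed_measure \<mu>"
  shows "\<exists>c. \<forall>A\<in>sets borel. \<bar>\<mu> A\<bar> \<le> c"
proof (rule ccontr)
  define bad where "bad A \<longleftrightarrow> A \<in> sets borel \<and> (\<forall>c. \<exists>B\<in>sets borel. B \<subseteq> A \<and> \<bar>\<mu> B\<bar> > c)" for A
  assume "\<not> ?thesis"
  then have bad_UNIV: "bad UNIV" unfolding bad_def by (auto simp: not_le)
  have step: "\<exists>A'. bad A' \<and> A' \<subseteq> A \<and> 1 \<le> \<bar>\<mu> (A - A')\<bar>" if badA: "bad A" for A
  proof -
    have A: "A \<in> sets borel" using badA by (simp add: bad_def)
    \<comment> \<open>The surplus 1 + |\<mu> A| makes \<mu> at least 1 in absolute value on both B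
      and A - B, so either one may be removed; one of the two is bad.\<close>
    obtain B where B: "B \<in> sets borel" "B \<subseteq> A" "\<bar>\<mu> B\<bar> > 1 + \<bar>\<mu> A\<bar>"
      using badA[unfolded bad_def, THEN conjunct2, THEN spec, of "1 + \<bar>\<mu> A\<bar>"] by auto
    have "\<mu> A = \<mu> B + \<mu> (A - B)"
      using finite_signed_measure_Un[OF \<mu> B(1), of "A - B"] A B by (simp add: Un_absorb1)
    then have AB: "1 \<le> \<bar>\<mu> (A - B)\<bar>" using B(3) by linarith
    show ?thesis
    proof (cases "bad B")
      case True
      then show ?thesis using AB B by blast
    next
      case False
      then obtain c where c: "\<And>C. C \<in> sets borel \<Longrightarrow> C \<subseteq> B \<Longrightarrow> \<bar>\<mu> C\<bar> \<le> c"
        using B(1) unfolding bad_def by (meson not_le)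
      have "bad (A - B)"
        unfolding bad_def
      proof (intro conjI allI)
        fix c'
        obtain C where C: "C \<in> sets borel" "C \<subseteq> A" "\<bar>\<mu> C\<bar> > c + c'"
          using badA[unfolded bad_def, THEN conjunct2, THEN spec, of "c + c'"] by auto
        have "\<mu> C = \<mu> (C \<inter> B) + \<mu> (C - B)"
          using finite_signed_measure_Un[OF \<mu>, of "C \<inter> B" "C - B"] C B by (simp add: Int_Diff_Un Int_Diff_disjoint)
        moreover have "\<bar>\<mu> (C \<inter> B)\<bar> \<le> c" using c C B by simp
        ultimately have "\<bar>\<mu> (C - B)\<bar> > c'" using C(3) by linarith
        then show "\<exists>C\<in>sets borel. C \<subseteq> A - B \<and> \<bar>\<mu> C\<bar> > c'"
          using C B by (intro bexI[of _ "C - B"]) auto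
      qed (use A B in auto)
      moreover have "A - (A - B) = B" using B by blast
      ultimately show ?thesis using B(3) by (intro exI[of _ "A - B"]) auto
    qed
  qed
  have "\<exists>F. \<forall>n::nat. bad (F n) \<and> (F (Suc n) \<subseteq> F n \<and> 1 \<le> \<bar>\<mu> (F n - F (Suc n))\<bar>)"
    by (rule dependent_nat_choice) (use bad_UNIV step in blast)+
  then obtain F :: "nat \<Rightarrow> _" where F: "\<And>n. bad (F n)" "\<And>n. F (Suc n) \<subseteq> F n"
    "\<And>n. 1 \<le> \<bar>\<mu> (F n - F (Suc n))\<bar>" by blast
  let ?G = "\<lambda>n. F n - F (Suc n)"
  have dec: "F j \<subseteq> F i" if "i \<le> j" for i j using lift_Suc_antimono_le[of F, OF F(2) that] .
  have "?G i \<inter> ?G j = {}" if "i < j" for i j using dec[of "Suc i" j] that by auto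
  then have "disjoint_family ?G"
    unfolding disjoint_family_on_def by (metis inf_commute linorder_neqE_nat)
  moreover have "range ?G \<subseteq> sets borel" using F(1) by (auto simp: bad_def)
  ultimately have "(\<lambda>n. \<mu> (?G n)) sums \<mu> (\<Union>n. ?G n)"
    using \<mu> unfolding finite_signed_measure_def by blast
  then have "(\<lambda>n. \<mu> (?G n)) \<longlonglongrightarrow> 0" by (intro summable_LIMSEQ_zero sums_summable)
  then have "\<forall>\<^sub>F n in sequentially. \<bar>\<mu> (?G n)\<bar> < 1"
    using order_tendstoD(2)[OF tendsto_rabs, of _ 0 _ 1] by fastforce
  then obtain n where "\<bar>\<mu> (?G n)\<bar> < 1" by (auto simp: eventually_sequentially)
  then show False using F(3)[of n] by simp
qed

lemma sets_pos_part: "sets (pos_part \<mu>) = sets borel" and space_pos_part: "space (pos_part \<mu>) = UNIV"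
  unfolding pos_part_def using sets.sigma_sets_eq[of borel] by (simp_all)

text \<open>\<open>measure_of\<close> gives either the prescribed set function or the zero measure,
  and the bound on \<mu> yields a finite total mass in both cases.\<close>

lemma finite_measure_pos_part:
  fixes \<mu> :: "'a::topological_space set \<Rightarrow> real"
  assumes \<mu>: "finite_signed_measure \<mu>"
  shows "finite_measure (pos_part \<mu>)"
proof
  obtain c where c: "\<And>A. A \<in> sets borel \<Longrightarrow> \<bar>\<mu> A\<bar> \<le> c"
    using finite_signed_measure_bounded[OF \<mu>] by blast
  have "emeasure (pos_part \<mu>) UNIV \<le> (SUP B\<in>{B \<in> sets borel. B \<subseteq> UNIV}. ennreal (\<mu> B))"
    unfolding pos_part_def emeasure_measure_of_conv by simp
  also have "\<dots> \<le> ennreal c"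
  proof (rule SUP_least, rule ennreal_leI)
    fix B :: "'a set" assume "B \<in> {B \<in> sets borel. B \<subseteq> UNIV}"
    then show "\<mu> B \<le> c" using c[of B] by simp
  qed
  finally show "emeasure (pos_part \<mu>) (space (pos_part \<mu>)) \<noteq> \<infinity>"
    unfolding space_pos_part by (auto simp: top_unique)
qed

lemma finite_signed_measure_uminus:
  "finite_signed_measure \<mu> \<Longrightarrow> finite_signed_measure (\<lambda>A. - \<mu> A)"
  unfolding finite_signed_measure_def by (auto intro: sums_minus)

lemma (in finite_measure) abs_integral_le:
  fixes w :: "'a \<Rightarrow> real"
  assumes "w \<in> borel_measurable M" "AE x in M. \<bar>w x\<bar> \<le> k"
  shows "\<bar>LINT x|M. w x\<bar> \<le> k * measure M (space M)"
proof -
  have "integrable M w" using assms by (intro integrable_const_bound[of _ k]) auto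
  then have "\<bar>LINT x|M. w x\<bar> \<le> (LINT x|M. \<bar>w x\<bar>)" by (intro integral_abs_bound)
  also have "\<dots> \<le> (LINT x|M. k)"
    using \<open>integrable M w\<close> assms by (intro integral_mono_AE) auto
  finally show ?thesis by (simp add: mult.commute)
qed

lemma signed_integral_bound:
  assumes \<mu>: "finite_signed_measure \<mu>" and w[measurable]: "w \<in> borel_measurable borel"
    and null: "variation \<mu> {x. \<bar>w x\<bar> > k} = 0"
  shows "\<bar>signed_integral \<mu> w\<bar> \<le> k * TV_norm \<mu>"
proof -
  have fin: "finite_measure (pos_part \<mu>)" "finite_measure (neg_part \<mu>)"
    unfolding neg_part_def using finite_measure_pos_part[OF \<mu>]
      finite_measure_pos_part[OF finite_signed_measure_uminus[OF \<mu>]] by auto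
  have sets: "sets (pos_part \<mu>) = sets borel" "sets (neg_part \<mu>) = sets borel"
    unfolding neg_part_def by (rule sets_pos_part)+
  have sp: "space (pos_part \<mu>) = UNIV" "space (neg_part \<mu>) = UNIV"
    unfolding neg_part_def by (rule space_pos_part)+
  have m: "w \<in> borel_measurable (pos_part \<mu>)" "w \<in> borel_measurable (neg_part \<mu>)"
    using w by (simp_all cong: measurable_cong_sets add: sets)
  have z: "emeasure (pos_part \<mu>) {x. \<bar>w x\<bar> > k} = 0" "emeasure (neg_part \<mu>) {x. \<bar>w x\<bar> > k} = 0"
    using null by (auto simp: variation_def)
  have S: "{x. \<bar>w x\<bar> > k} \<in> sets borel" by measurable
  have ae: "AE x in pos_part \<mu>. \<bar>w x\<bar> \<le> k" "AE x in neg_part \<mu>. \<bar>w x\<bar> \<le> k"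
    using z S by (auto intro!: AE_I[of _ _ "{x. \<bar>w x\<bar> > k}"] simp: sets)
  note b = finite_measure.abs_integral_le[OF fin(1) m(1) ae(1)] finite_measure.abs_integral_le[OF fin(2) m(2) ae(2)]
  \<comment> \<open>Finiteness of both parts is what makes \<open>enn2real\<close> additive
    here.\<close>
  have "TV_norm \<mu> = measure (pos_part \<mu>) UNIV + measure (neg_part \<mu>) UNIV"
    unfolding TV_norm_def variation_def measure_def
    using finite_measure.emeasure_finite[OF fin(1)] finite_measure.emeasure_finite[OF fin(2)]
    by (intro enn2real_plus) (auto simp: less_top)
  then show ?thesis unfolding signed_integral_def using b by (simp add: sp algebra_simps)
qed

text \<open>Off an open set \<open>U\<close> of small capacity, the exceptional set is relatively open; its union
  with \<open>U\<close> is open and equals \<open>U\<close> up to an \<open>m\<close>-null set, hence has the same capacity.\<close>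

lemma Cap_qc_version_exceeds:
  assumes qc: "qc_version m D \<E> v w" and ae: "AE x in m. \<bar>v x\<bar> \<le> k"
  shows "Cap m D \<E> {x. \<bar>w x\<bar> > k} = 0"
proof -
  let ?A = "{x. \<bar>w x\<bar> > k}"
  have wk: "AE x in m. \<bar>w x\<bar> \<le> k" using qc ae unfolding qc_version_def by auto
  have "Cap m D \<E> ?A \<le> ennreal \<epsilon>" if "\<epsilon> > 0" for \<epsilon>
  proof -
    obtain U where U: "open U" "Cap m D \<E> U < ennreal \<epsilon>" "continuous_on (UNIV - U) w"
      using qc \<open>\<epsilon> > 0\<close> unfolding qc_version_def quasi_continuous_def by blast
    have "continuous_on (UNIV - U) (\<lambda>x. \<bar>w x\<bar>)" using U(3) by (intro continuous_intros)
    then obtain V where V: "open V" "V \<inter> (UNIV - U) = (\<lambda>x. \<bar>w x\<bar>) -` {k<..} \<inter> (UNIV - U)"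
      using open_greaterThan unfolding continuous_on_open_invariant by blast
    have sub: "?A \<subseteq> V \<union> U" using V(2) by auto
    have eq: "AE x in m. x \<in> V \<union> U \<longleftrightarrow> x \<in> U"
      using wk
    proof eventually_elim
      case (elim x)
      have "x \<notin> (\<lambda>x. \<bar>w x\<bar>) -` {k<..}" using elim by simp
      then show ?case using V(2) by auto
    qed
    have "Cap m D \<E> ?A \<le> Cap_open m D \<E> (V \<union> U)"
      unfolding Cap_def using sub V(1) U(1) by (intro INF_lower) auto
    also have "\<dots> \<le> Cap_open m D \<E> U"
      unfolding Cap_open_def
    proof (rule INF_superset_mono)
      show "{u \<in> ext_domain m D \<E>. AE x in m. x \<in> U \<longrightarrow> 1 \<le> u x}
          \<subseteq> {u \<in> ext_domain m D \<E>. AE x in m. x \<in> V \<union> U \<longrightarrow> 1 \<le> u x}"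
      proof
        fix u assume u: "u \<in> {u \<in> ext_domain m D \<E>. AE x in m. x \<in> U \<longrightarrow> 1 \<le> u x}"
        then have "AE x in m. x \<in> U \<longrightarrow> 1 \<le> u x" by blast
        with eq have "AE x in m. x \<in> V \<union> U \<longrightarrow> 1 \<le> u x" by eventually_elim auto
        then show "u \<in> {u \<in> ext_domain m D \<E>. AE x in m. x \<in> V \<union> U \<longrightarrow> 1 \<le> u x}" using u by blast
      qed
    qed simp
    \<comment> \<open>\<open>Cap_open\<close> grows with the set, so passing to larger open sets in
      the definition of \<open>Cap\<close> cannot lower its value at an open U.\<close>
    also have "\<dots> \<le> Cap m D \<E> U"
      unfolding Cap_def Cap_open_def by (intro INF_greatest INF_superset_mono) auto
    also have "\<dots> \<le> ennreal \<epsilon>" using U(2) by simp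
    finally show ?thesis .
  qed
  then have "Cap m D \<E> ?A \<le> 0 + ennreal \<epsilon>" if "\<epsilon> > 0" for \<epsilon> using that by simp
  then have "Cap m D \<E> ?A \<le> 0" by (rule ennreal_le_epsilon)
  then show ?thesis by simp
qed

text \<open>This is where diffuseness enters: a bound known only m-a.e. extends to the
  quasi-continuous version off a set of capacity zero, and \<mu> does not charge that set.\<close>

lemma signed_integral_qc_bound:
  assumes "diffuse_measure m D \<E> \<mu>" "qc_version m D \<E> v w" "AE x in m. \<bar>v x\<bar> \<le> k"
  shows "\<bar>signed_integral \<mu> w\<bar> \<le> k * TV_norm \<mu>"
proof (rule signed_integral_bound)
  show w: "w \<in> borel_measurable borel" using assms(2) by (simp add: qc_version_def)
  show "variation \<mu> {x. \<bar>w x\<bar> > k} = 0"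
    using assms(1) Cap_qc_version_exceeds[OF assms(2,3)] w unfolding diffuse_measure_def by simp
qed (use assms(1) in \<open>simp add: diffuse_measure_def\<close>)


section \<open>Energy on the extended Dirichlet space\<close>

context transient_dirichlet
begin

text \<open>The inequality of transience type makes the sequence Cauchy in L1 with weight \<theta>,
  and Fatou's lemma in the second index identifies the limit as 0. The weight is general because the
  result is applied both to g and to \<open>R 1 g\<close>.\<close>

lemma form_Cauchy_weighted_tendsto_0:
  assumes \<theta>: "\<theta> \<in> borel_measurable m" "AE x in m. 0 \<le> \<theta> x"
    and int: "\<And>y. y \<in> D \<Longrightarrow> integrable m (\<lambda>x. \<bar>y x\<bar> * \<theta> x)"
    and le: "\<And>y. y \<in> D \<Longrightarrow> (LINT x|m. \<bar>y x\<bar> * \<theta> x) \<le> C * sqrt (\<E> y y)" and C: "C > 0"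
    and d: "\<And>n. d n \<in> D" "form_Cauchy \<E> d" "AE x in m. (\<lambda>n. d n x) \<longlonglongrightarrow> 0"
  shows "(\<lambda>n. LINT x|m. \<bar>d n x\<bar> * \<theta> x) \<longlonglongrightarrow> 0"
proof (rule LIMSEQ_I)
  fix e :: real assume e: "e > 0"
  have [measurable]: "\<theta> \<in> borel_measurable m" "d n \<in> borel_measurable m" for n
    using \<theta>(1) mem_measurable[OF d(1)] by auto
  have "(e / (2 * C))\<^sup>2 > 0" using e C by simp
  then obtain N where N: "\<And>i j. i \<ge> N \<Longrightarrow> j \<ge> N \<Longrightarrow> \<E> (\<lambda>x. d i x - d j x) (\<lambda>x. d i x - d j x) < (e / (2 * C))\<^sup>2"
    using d(2) unfolding form_Cauchy_def by blast
  have 1: "(LINT x|m. \<bar>d i x - d j x\<bar> * \<theta> x) \<le> e / 2" if "i \<ge> N" "j \<ge> N" for i j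
  proof -
    have "sqrt (\<E> (\<lambda>x. d i x - d j x) (\<lambda>x. d i x - d j x)) \<le> e / (2 * C)"
      using N[OF that] e C by (intro real_le_lsqrt) auto
    then have "C * sqrt (\<E> (\<lambda>x. d i x - d j x) (\<lambda>x. d i x - d j x)) \<le> e / 2"
      using C by (simp add: field_simps)
    then show ?thesis using le[OF E.diff_mem[OF d(1) d(1)], of i j] by linarith
  qed
  have "norm ((LINT x|m. \<bar>d i x\<bar> * \<theta> x) - 0) < e" if i: "i \<ge> N" for i
  proof -
    have eq: "(\<integral>\<^sup>+x. ennreal (\<bar>y x\<bar> * \<theta> x) \<partial>m) = ennreal (LINT x|m. \<bar>y x\<bar> * \<theta> x)" if "y \<in> D" for y
      using int[OF that] \<theta>(2) by (intro nn_integral_eq_integral) auto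
    have "(\<integral>\<^sup>+x. ennreal (\<bar>d i x\<bar> * \<theta> x) \<partial>m) \<le> (\<integral>\<^sup>+x. liminf (\<lambda>j. ennreal (\<bar>d i x - d j x\<bar> * \<theta> x)) \<partial>m)"
    proof (rule nn_integral_mono_AE)
      show "AE x in m. ennreal (\<bar>d i x\<bar> * \<theta> x) \<le> liminf (\<lambda>j. ennreal (\<bar>d i x - d j x\<bar> * \<theta> x))"
        using d(3)
      proof eventually_elim
        case (elim x)
        have "(\<lambda>j. ennreal (\<bar>d i x - d j x\<bar> * \<theta> x)) \<longlonglongrightarrow> ennreal (\<bar>d i x - 0\<bar> * \<theta> x)"
          by (intro tendsto_intros tendsto_ennrealI elim)
        then have "liminf (\<lambda>j. ennreal (\<bar>d i x - d j x\<bar> * \<theta> x)) = ennreal (\<bar>d i x - 0\<bar> * \<theta> x)"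
          by (intro lim_imp_Liminf) auto
        then show ?case by simp
      qed
    qed
    also have "\<dots> \<le> liminf (\<lambda>j. \<integral>\<^sup>+x. ennreal (\<bar>d i x - d j x\<bar> * \<theta> x) \<partial>m)"
      by (rule nn_integral_liminf) measurable
    also have "\<dots> \<le> limsup (\<lambda>j. \<integral>\<^sup>+x. ennreal (\<bar>d i x - d j x\<bar> * \<theta> x) \<partial>m)"
      by (rule Liminf_le_Limsup) simp
    also have "\<dots> \<le> ennreal (e / 2)"
    proof (rule Limsup_bounded)
      show "\<forall>\<^sub>F j in sequentially. (\<integral>\<^sup>+x. ennreal (\<bar>d i x - d j x\<bar> * \<theta> x) \<partial>m) \<le> ennreal (e / 2)"
        using eventually_ge_at_top[of N]
        by eventually_elim (subst eq[OF E.diff_mem[OF d(1) d(1)]], rule ennreal_leI, rule 1[OF i])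
    qed
    finally have "ennreal (LINT x|m. \<bar>d i x\<bar> * \<theta> x) \<le> ennreal (e / 2)" unfolding eq[OF d(1)] .
    then have "(LINT x|m. \<bar>d i x\<bar> * \<theta> x) \<le> e / 2" using e by (simp add: ennreal_le_iff)
    moreover have "0 \<le> (LINT x|m. \<bar>d i x\<bar> * \<theta> x)" using \<theta>(2) by (intro integral_nonneg_AE) auto
    ultimately show ?thesis using e by simp
  qed
  then show "\<exists>N. \<forall>i\<ge>N. norm ((LINT x|m. \<bar>d i x\<bar> * \<theta> x) - 0) < e" by blast
qed

text \<open>Transience self-improves from \<open>g\<close> to \<open>R 1 g\<close>, because
  \<open>\<integral>\<bar>y\<bar> R\<^sub>1 g = \<integral>\<bar>y\<bar> g - \<E>(\<bar>y\<bar>, R\<^sub>1 g)\<close>.\<close>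

lemma transience_resolvent:
  assumes y: "y \<in> D"
  shows "(LINT x|m. \<bar>y x\<bar> * R 1 g x) \<le> (1 + 2 * sqrt (\<E> (R 1 g) (R 1 g))) * sqrt (\<E> y y)"
proof -
  let ?h = "R 1 g"
  have h: "solves (\<lambda>_. 1) g ?h" by (rule resolvent_solves[OF _ g_L2]) simp
  have hD: "?h \<in> D" using h by (rule solves_mem)
  have h0: "AE x in m. 0 \<le> ?h x" using g_nonneg by (intro resolvent_nonneg[OF _ g_L2]) auto
  have [measurable]: "?h \<in> borel_measurable m" "y \<in> borel_measurable m"
    using mem_measurable hD y by auto
  have my: "(\<lambda>x. - y x) \<in> D" using E.scale_mem[OF y, of "-1"] by simp
  have Emy: "\<E> (\<lambda>x. - y x) (\<lambda>x. - y x) = \<E> y y" using E.quad_scale[OF y, of "-1"] by simp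
  \<comment> \<open>The Markov property clips to bounded intervals from 0 upwards, so |y| is reached
    through min |y| n, a sum of two such clippings. The triangle inequality then produces the factor
    2 in the constant.\<close>
  define p where "p n x = min (max 0 (y x)) (real n) + min (max 0 (- y x)) (real n)" for n x
  have pabs: "p n x = min \<bar>y x\<bar> (real n)" for n x by (auto simp: p_def min_def max_def)
  have c: "(\<lambda>x. min (max 0 (y x)) (real n)) \<in> D" "(\<lambda>x. min (max 0 (- y x)) (real n)) \<in> D" for n
    using clip_mem_energy(1)[OF y, of "real n"] clip_mem_energy(1)[OF my, of "real n"] by auto
  have pD: "p n \<in> D" for n unfolding p_def[abs_def] by (rule E.add_mem[OF c])
  have pE: "sqrt (\<E> (p n) (p n)) \<le> 2 * sqrt (\<E> y y)" for n
  proof -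
    have "sqrt (\<E> (p n) (p n)) \<le> sqrt (\<E> y y) + sqrt (\<E> (\<lambda>x. - y x) (\<lambda>x. - y x))"
      unfolding p_def[abs_def]
      using E.triangle[OF c, of n n] real_sqrt_le_mono[OF clip_mem_energy(2)[OF y, of "real n"]]
        real_sqrt_le_mono[OF clip_mem_energy(2)[OF my, of "real n"]] by linarith
    then show ?thesis unfolding Emy by simp
  qed
  let ?B = "(1 + 2 * sqrt (\<E> ?h ?h)) * sqrt (\<E> y y)"
  have le: "(LINT x|m. p n x * ?h x) \<le> ?B" for n
  proof -
    have "\<E> ?h (p n) + (LINT x|m. ?h x * p n x) = (LINT x|m. g x * p n x)"
      using h pD[of n] by (simp add: solves_def weighted_form_def L2_inner_def)
    moreover have "(LINT x|m. g x * p n x) \<le> (LINT x|m. \<bar>y x\<bar> * g x)"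
      using L2_mult_integrable[OF g_L2 mem_L2[OF pD]] L2_mult_integrable[OF L2_abs[OF mem_L2[OF y]] g_L2]
      by (intro integral_mono) (auto simp: pabs mult.commute[of "g _"] intro!: mult_right_mono g_nonneg)
    moreover note transience[OF y]
    moreover have "- \<E> ?h (p n) \<le> sqrt (\<E> ?h ?h) * (2 * sqrt (\<E> y y))"
    proof -
      have "- \<E> ?h (p n) \<le> sqrt (\<E> ?h ?h) * sqrt (\<E> (p n) (p n))"
        using E.Cauchy_Schwarz[OF hD pD, of n] by linarith
      also have "\<dots> \<le> sqrt (\<E> ?h ?h) * (2 * sqrt (\<E> y y))"
        using pE E.nonneg[OF hD] by (intro mult_left_mono) auto
      finally show ?thesis .
    qed
    ultimately show ?thesis by (simp add: algebra_simps)
  qed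
  have "(\<lambda>n. LINT x|m. p n x * ?h x) \<longlonglongrightarrow> (LINT x|m. \<bar>y x\<bar> * ?h x)"
  proof (rule integral_dominated_convergence)
    show "integrable m (\<lambda>x. \<bar>y x\<bar> * \<bar>?h x\<bar>)"
      by (intro L2_mult_integrable L2_abs mem_L2 y hD)
    show "AE x in m. (\<lambda>n. p n x * ?h x) \<longlonglongrightarrow> \<bar>y x\<bar> * ?h x"
    proof (rule AE_I2, rule tendsto_eventually)
      fix x
      show "\<forall>\<^sub>F n in sequentially. p n x * ?h x = \<bar>y x\<bar> * ?h x"
        using eventually_ge_at_top[of "nat \<lceil>\<bar>y x\<bar>\<rceil>"]
        by eventually_elim (simp add: pabs min_def nat_ceiling_le_eq)
    qed
    show "AE x in m. norm (p n x * ?h x) \<le> \<bar>y x\<bar> * \<bar>?h x\<bar>" for n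
      by (auto simp: pabs abs_mult intro!: mult_right_mono)
    show "(\<lambda>x. p n x * ?h x) \<in> borel_measurable m" for n
      unfolding pabs by measurable
  qed measurable
  then show ?thesis using le by (intro LIMSEQ_le_const2) auto
qed

text \<open>A closability statement without L2 convergence, so \<open>closed_form\<close> does not
  apply directly. The weak limit \<open>l\<close> of the sequence is represented by some p with
  respect to the form with weight 1. Testing with resolvents of functions dominated by g shows p = 0
  a.e., so the sequence tends weakly to 0; being Cauchy, it then also tends to 0 in energy.\<close>

lemma energy_tendsto_0:
  assumes d: "\<And>n. d n \<in> D" "form_Cauchy \<E> d" "AE x in m. (\<lambda>n. d n x) \<longlonglongrightarrow> 0"
  shows "(\<lambda>n. \<E> (d n) (d n)) \<longlonglongrightarrow> 0"
proof -
  let ?h = "R 1 g"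
  have hD: "?h \<in> D" using resolvent_solves[OF _ g_L2, of 1] by (simp add: solves_mem)
  have h0: "AE x in m. 0 \<le> ?h x" using g_nonneg by (intro resolvent_nonneg[OF _ g_L2]) auto
  have lim_g: "(\<lambda>n. LINT x|m. \<bar>d n x\<bar> * g x) \<longlonglongrightarrow> 0"
  proof (rule form_Cauchy_weighted_tendsto_0[where C=1])
    show "integrable m (\<lambda>x. \<bar>y x\<bar> * g x)" if "y \<in> D" for y
      by (intro L2_mult_integrable L2_abs mem_L2 that g_L2)
  qed (use d g_nonneg transience in auto)
  have lim_h: "(\<lambda>n. LINT x|m. \<bar>d n x\<bar> * ?h x) \<longlonglongrightarrow> 0"
  proof (rule form_Cauchy_weighted_tendsto_0[where C="1 + 2 * sqrt (\<E> ?h ?h)"])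
    show "integrable m (\<lambda>x. \<bar>y x\<bar> * ?h x)" if "y \<in> D" for y
      by (intro L2_mult_integrable L2_abs mem_L2 that hD)
    show "1 + 2 * sqrt (\<E> ?h ?h) > 0" using E.nonneg[OF hD] by (simp add: add_pos_nonneg)
  qed (use d h0 transience_resolvent mem_measurable[OF hD] in auto)
  have Cau: "\<exists>N. \<forall>i\<ge>N. \<forall>j\<ge>N. sqrt (\<E> (\<lambda>x. d i x - d j x) (\<lambda>x. d i x - d j x)) < e" if "e > 0" for e
  proof -
    have "e\<^sup>2 > 0" using that by simp
    then obtain N where N: "\<And>i j. i \<ge> N \<Longrightarrow> j \<ge> N \<Longrightarrow> \<E> (\<lambda>x. d i x - d j x) (\<lambda>x. d i x - d j x) < e\<^sup>2"
      using d(2) unfolding form_Cauchy_def by blast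
    then have "sqrt (\<E> (\<lambda>x. d i x - d j x) (\<lambda>x. d i x - d j x)) < e" if "i \<ge> N" "j \<ge> N" for i j
      using that \<open>e > 0\<close> by (intro real_less_lsqrt) auto
    then show ?thesis by blast
  qed
  obtain N1 where N1: "\<And>i j. i \<ge> N1 \<Longrightarrow> j \<ge> N1 \<Longrightarrow> sqrt (\<E> (\<lambda>x. d i x - d j x) (\<lambda>x. d i x - d j x)) < 1"
    using Cau[of 1] by auto
  define M where "M = 1 + sqrt (\<E> (d N1) (d N1))"
  have M0: "M > 0" using E.nonneg[OF d(1)] by (simp add: M_def add_pos_nonneg)
  have M: "sqrt (\<E> (d i) (d i)) \<le> M" if "i \<ge> N1" for i
    using N1[OF that order_refl] E.sqrt_diff_le[OF d(1) d(1), of i N1] unfolding M_def by linarith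
  define l where "l z = lim (\<lambda>n. \<E> (d n) z)" for z
  have l: "(\<lambda>n. \<E> (d n) z) \<longlonglongrightarrow> l z" if z: "z \<in> D" for z
  proof -
    have "Cauchy (\<lambda>n. \<E> (d n) z)"
    proof (rule metric_CauchyI)
      fix e :: real assume e: "e > 0"
      define s where "s = sqrt (\<E> z z) + 1"
      have s: "s > 0" "sqrt (\<E> z z) \<le> s" using E.nonneg[OF z] by (auto simp: s_def add_nonneg_pos)
      then obtain N where N: "\<And>i j. i \<ge> N \<Longrightarrow> j \<ge> N \<Longrightarrow> sqrt (\<E> (\<lambda>x. d i x - d j x) (\<lambda>x. d i x - d j x)) < e / s"
        using Cau[of "e / s"] e by auto
      have "dist (\<E> (d i) z) (\<E> (d j) z) < e" if "i \<ge> N" "j \<ge> N" for i j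
      proof -
        have "dist (\<E> (d i) z) (\<E> (d j) z) = \<bar>\<E> (\<lambda>x. d i x - d j x) z\<bar>"
          using E.diff_left[OF d(1) d(1) z] by (simp add: dist_real_def)
        also have "\<dots> \<le> sqrt (\<E> (\<lambda>x. d i x - d j x) (\<lambda>x. d i x - d j x)) * sqrt (\<E> z z)"
          by (rule E.Cauchy_Schwarz[OF E.diff_mem[OF d(1) d(1)] z])
        also have "\<dots> \<le> sqrt (\<E> (\<lambda>x. d i x - d j x) (\<lambda>x. d i x - d j x)) * s"
          using s E.nonneg[OF E.diff_mem[OF d(1) d(1)]] by (intro mult_left_mono) auto
        also have "\<dots> < e / s * s" using N[OF that] s(1) by (intro mult_strict_right_mono) auto
        finally show ?thesis using s(1) by simp
      qed
      then show "\<exists>N. \<forall>i\<ge>N. \<forall>j\<ge>N. dist (\<E> (d i) z) (\<E> (d j) z) < e" by blast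
    qed
    then show ?thesis unfolding l_def by (simp add: Cauchy_convergent_iff convergent_LIMSEQ_iff)
  qed
  have lunique: "l z = c" if "z \<in> D" "(\<lambda>n. \<E> (d n) z) \<longlonglongrightarrow> c" for z c
    using LIMSEQ_unique[OF l[OF that(1)] that(2)] .
  have w1: "weight m (\<lambda>_. 1)" by (simp add: weight_const)
  interpret K: nonneg_form D "weighted_form m \<E> (\<lambda>_. 1)" by (rule nonneg_form_weighted[OF w1])
  \<comment> \<open>Completeness is available with the weight 1 added, and \<open>l\<close> is
    bounded in that larger norm as well.\<close>
  obtain p where p: "p \<in> D" "\<And>z. z \<in> D \<Longrightarrow> weighted_form m \<E> (\<lambda>_. 1) p z = l z"
  proof (rule K.Riesz_representation[of l M])
    show "l (\<lambda>x. u x + v x) = l u + l v" if "u \<in> D" "v \<in> D" for u v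
    proof (rule lunique)
      have "\<E> (d n) (\<lambda>x. u x + v x) = \<E> (d n) u + \<E> (d n) v" for n
        using that d(1)[of n] by (simp add: E.sym[of "d n"] E.add_left E.add_mem)
      then show "(\<lambda>n. \<E> (d n) (\<lambda>x. u x + v x)) \<longlonglongrightarrow> l u + l v" using that by (simp add: tendsto_add l)
    qed (rule E.add_mem[OF that])
    show "l (\<lambda>x. c * u x) = c * l u" if "u \<in> D" for c u
    proof (rule lunique)
      have "\<E> (d n) (\<lambda>x. c * u x) = c * \<E> (d n) u" for n
        using that d(1)[of n] by (simp add: E.sym[of "d n"] E.scale_left E.scale_mem)
      then show "(\<lambda>n. \<E> (d n) (\<lambda>x. c * u x)) \<longlonglongrightarrow> c * l u" using that by (simp add: tendsto_mult l)
    qed (rule E.scale_mem[OF that])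
    show "\<bar>l z\<bar> \<le> M * sqrt (weighted_form m \<E> (\<lambda>_. 1) z z)" if z: "z \<in> D" for z
    proof (rule LIMSEQ_le_const2[OF tendsto_rabs[OF l[OF z]]], intro exI allI impI)
      fix n assume n: "n \<ge> N1"
      have "\<bar>\<E> (d n) z\<bar> \<le> sqrt (\<E> (d n) (d n)) * sqrt (\<E> z z)" by (rule E.Cauchy_Schwarz[OF d(1) z])
      also have "\<dots> \<le> M * sqrt (weighted_form m \<E> (\<lambda>_. 1) z z)"
        using M[OF n] M0 E.nonneg[OF z] E.nonneg[OF d(1)]
        by (intro mult_mono real_sqrt_le_mono) (auto simp: weighted_form_def)
      finally show "\<bar>\<E> (d n) z\<bar> \<le> M * sqrt (weighted_form m \<E> (\<lambda>_. 1) z z)" .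
    qed
  qed (use weighted_complete[OF w1] in auto)
  have [measurable]: "p \<in> borel_measurable m" using p(1) by (rule mem_measurable)
  \<comment> \<open>Cutting p between -g and g keeps its sign and vanishes, where g > 0, only with
    p. It also makes \<phi> and its resolvent dominated by g and \<open>R 1 g\<close>, against which
    |d n| integrates to 0 in the limit.\<close>
  define \<phi> where "\<phi> x = min (max (p x) (- g x)) (g x)" for x
  have \<phi>g: "\<bar>\<phi> x\<bar> \<le> g x" for x using g_nonneg[of x] by (auto simp: \<phi>_def)
  have [measurable]: "\<phi> \<in> borel_measurable m" unfolding \<phi>_def[abs_def] by measurable
  have \<phi>L: "\<phi> \<in> L2 m" using \<phi>g by (intro L2_g_bound[of _ 1]) auto
  let ?z = "R 1 \<phi>"
  have z: "solves (\<lambda>_. 1) \<phi> ?z" by (rule resolvent_solves[OF _ \<phi>L]) simp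
  have zD: "?z \<in> D" using z by (rule solves_mem)
  have zh: "AE x in m. \<bar>?z x\<bar> \<le> ?h x"
  proof -
    have "AE x in m. ?z x \<le> ?h x"
      using \<phi>g by (intro resolvent_mono[OF _ \<phi>L g_L2]) (auto simp: abs_le_iff)
    moreover have "AE x in m. (\<lambda>x. - 1 * ?z x) x \<le> ?h x"
      using \<phi>g by (intro solves_mono[OF w1 L2_scale[OF \<phi>L] g_L2 solves_scale[OF w1 \<phi>L z]] resolvent_solves g_L2)
         (auto simp: abs_le_iff)
    ultimately show ?thesis by eventually_elim auto
  qed
  have "l ?z = 0"
  proof (rule lunique[OF zD], rule Lim_null_comparison[OF always_eventually])
    show "(\<lambda>n. (LINT x|m. \<bar>d n x\<bar> * g x) + (LINT x|m. \<bar>d n x\<bar> * ?h x)) \<longlonglongrightarrow> 0"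
      using tendsto_add[OF lim_g lim_h] by simp
    show "\<forall>n. norm (\<E> (d n) ?z) \<le> (LINT x|m. \<bar>d n x\<bar> * g x) + (LINT x|m. \<bar>d n x\<bar> * ?h x)"
    proof
      fix n
      have dn: "d n \<in> L2 m" by (rule mem_L2[OF d(1)])
      have "\<E> ?z (d n) + (LINT x|m. ?z x * d n x) = (LINT x|m. \<phi> x * d n x)"
        using z d(1)[of n] by (simp add: solves_def weighted_form_def L2_inner_def)
      moreover have "\<bar>LINT x|m. \<phi> x * d n x\<bar> \<le> (LINT x|m. \<bar>d n x\<bar> * g x)"
      proof -
        have "\<bar>LINT x|m. \<phi> x * d n x\<bar> \<le> (LINT x|m. \<bar>\<phi> x * d n x\<bar>)" by (rule integral_abs_bound)
        also have "\<dots> \<le> (LINT x|m. \<bar>d n x\<bar> * g x)"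
        proof (rule integral_mono)
          show "\<bar>\<phi> x * d n x\<bar> \<le> \<bar>d n x\<bar> * g x" for x
            using mult_left_mono[OF \<phi>g[of x], of "\<bar>d n x\<bar>"] by (simp add: abs_mult mult.commute)
        qed (use L2_mult_integrable[OF \<phi>L dn] L2_mult_integrable[OF L2_abs[OF dn] g_L2] in auto)
        finally show ?thesis .
      qed
      moreover have "\<bar>LINT x|m. ?z x * d n x\<bar> \<le> (LINT x|m. \<bar>d n x\<bar> * ?h x)"
      proof -
        have "\<bar>LINT x|m. ?z x * d n x\<bar> \<le> (LINT x|m. \<bar>?z x * d n x\<bar>)" by (rule integral_abs_bound)
        also have "\<dots> \<le> (LINT x|m. \<bar>d n x\<bar> * ?h x)"
        proof (rule integral_mono_AE)
          show "AE x in m. \<bar>?z x * d n x\<bar> \<le> \<bar>d n x\<bar> * ?h x"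
            using zh by eventually_elim (simp add: abs_mult mult.commute[of "\<bar>R 1 \<phi> _\<bar>"] mult_left_mono)
        qed (use L2_mult_integrable[OF mem_L2[OF zD] dn] L2_mult_integrable[OF L2_abs[OF dn] mem_L2[OF hD]] in auto)
        finally show ?thesis .
      qed
      ultimately show "norm (\<E> (d n) ?z) \<le> (LINT x|m. \<bar>d n x\<bar> * g x) + (LINT x|m. \<bar>d n x\<bar> * ?h x)"
        using E.sym[OF d(1) zD, of n] by simp
    qed
  qed
  \<comment> \<open>By symmetry, representing \<open>l\<close> at the resolvent of \<phi> is the
    same as testing the equation for that resolvent with p.\<close>
  then have "(LINT x|m. \<phi> x * p x) = 0"
    using p z K.sym[OF p(1) zD] p(2)[OF zD] zD by (simp add: solves_def L2_inner_def)
  moreover have "0 \<le> \<phi> x * p x" for x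
    using g_nonneg[of x] by (auto simp: \<phi>_def min_def max_def zero_le_mult_iff)
  ultimately have "AE x in m. \<phi> x * p x = 0"
    using L2_mult_integrable[OF \<phi>L mem_L2[OF p(1)]] by (intro integral_nonneg_eq_0_AE) auto
  with g_pos have p0: "AE x in m. p x = 0"
    by eventually_elim (auto simp: \<phi>_def min_def max_def split: if_splits)
  have l0: "l z = 0" if z: "z \<in> D" for z
  proof -
    have "\<E> p z = \<E> (\<lambda>x. 0) z"
      by (rule AE_form[OF E.zero_mem _ _ z]) (use p0 in auto)
    also have "\<dots> = 0" using E.scale_left[OF E.zero_mem z, of 0] by simp
    finally have "\<E> p z = 0" .
    moreover have "(LINT x|m. 1 * (p x * z x)) = 0" using p0 by (intro integral_eq_zero_AE) auto
    ultimately show ?thesis using p(2)[OF z] by (simp add: weighted_form_def)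
  qed
  show ?thesis
  proof (rule LIMSEQ_I)
    fix e :: real assume e: "e > 0"
    then have "e / (2 * M) > 0" using M0 by simp
    then obtain N where N: "\<And>i j. i \<ge> N \<Longrightarrow> j \<ge> N \<Longrightarrow> sqrt (\<E> (\<lambda>x. d i x - d j x) (\<lambda>x. d i x - d j x)) < e / (2 * M)"
      using Cau by blast
    have "(\<lambda>n. \<E> (d n) (d N)) \<longlonglongrightarrow> 0" using l[OF d(1)] l0[OF d(1)] by metis
    then have "\<forall>\<^sub>F n in sequentially. \<bar>\<E> (d n) (d N)\<bar> < e / 2"
      using order_tendstoD(2)[OF tendsto_rabs_zero, of _ _ "e/2"] e by fastforce
    then obtain N' where N': "\<And>n. n \<ge> N' \<Longrightarrow> \<bar>\<E> (d n) (d N)\<bar> < e / 2" by (auto simp: eventually_sequentially)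
    have "norm (\<E> (d n) (d n) - 0) < e" if "n \<ge> max (max N N') N1" for n
    proof -
      have n: "n \<ge> N" "n \<ge> N'" "n \<ge> N1" using that by auto
      \<comment> \<open>The first term is small by the Cauchy property and the bound
        \<open>M\<close>, the second by weak convergence tested against the fixed
        \<open>d N\<close>.\<close>
      have "\<E> (d n) (d n) = \<E> (\<lambda>x. d n x - d N x) (d n) + \<E> (d n) (d N)"
        using E.diff_left[OF d(1) d(1) d(1), of n N n] E.sym[OF d(1) d(1), of N n] by simp
      moreover have "\<E> (\<lambda>x. d n x - d N x) (d n) \<le> e / (2 * M) * M"
      proof -
        have "\<E> (\<lambda>x. d n x - d N x) (d n) \<le>
            sqrt (\<E> (\<lambda>x. d n x - d N x) (\<lambda>x. d n x - d N x)) * sqrt (\<E> (d n) (d n))"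
          using E.Cauchy_Schwarz[OF E.diff_mem[OF d(1) d(1)] d(1), of n N n] by linarith
        also have "\<dots> \<le> e / (2 * M) * M"
          using N[OF n(1) order_refl] M[OF n(3)] e M0 E.nonneg[OF d(1)] by (intro mult_mono) auto
        finally show ?thesis .
      qed
      ultimately show ?thesis using N'[OF n(2)] M0 E.nonneg[OF d(1)[of n]] by simp
    qed
    then show "\<exists>N. \<forall>n\<ge>N. norm (\<E> (d n) (d n) - 0) < e" by blast
  qed
qed

text \<open>The difference of two approximating sequences is Cauchy and tends to 0 a.e., so its
  energy vanishes in the limit. This is what gives meaning to the definite description in
  \<open>ext_energy\<close>.\<close>

lemma ext_energy_unique:
  assumes s: "approx_seq m D \<E> s u" "(\<lambda>n. \<E> (s n) (s n)) \<longlonglongrightarrow> c"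
    and t: "approx_seq m D \<E> t u" "(\<lambda>n. \<E> (t n) (t n)) \<longlonglongrightarrow> c'"
  shows "c = c'"
proof -
  have sD: "s n \<in> D" and tD: "t n \<in> D" for n using s(1) t(1) by (auto simp: approx_seq_def)
  define d where "d n x = s n x - t n x" for n x
  have dD: "d n \<in> D" for n unfolding d_def[abs_def] by (rule E.diff_mem[OF sD tD])
  have "form_Cauchy \<E> d"
    unfolding form_Cauchy_def
  proof (intro allI impI)
    fix e :: real assume e: "e > 0"
    then have e4: "e / 4 > 0" by simp
    obtain N where N: "\<And>i j. i \<ge> N \<Longrightarrow> j \<ge> N \<Longrightarrow> \<E> (\<lambda>x. s i x - s j x) (\<lambda>x. s i x - s j x) < e / 4"
      using s(1) e4 unfolding approx_seq_def form_Cauchy_def by blast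
    obtain N' where N': "\<And>i j. i \<ge> N' \<Longrightarrow> j \<ge> N' \<Longrightarrow> \<E> (\<lambda>x. t i x - t j x) (\<lambda>x. t i x - t j x) < e / 4"
      using t(1) e4 unfolding approx_seq_def form_Cauchy_def by blast
    have "\<E> (\<lambda>x. d i x - d j x) (\<lambda>x. d i x - d j x) < e" if "i \<ge> max N N'" "j \<ge> max N N'" for i j
    proof -
      let ?a = "\<lambda>x. s i x - s j x" and ?b = "\<lambda>x. t i x - t j x"
      have ab: "?a \<in> D" "?b \<in> D" by (intro E.diff_mem sD tD)+
      have eq: "(\<lambda>x. d i x - d j x) = (\<lambda>x. ?a x - ?b x)" by (simp add: d_def fun_eq_iff)
      have "0 \<le> \<E> (\<lambda>x. ?a x + ?b x) (\<lambda>x. ?a x + ?b x)" by (rule E.nonneg[OF E.add_mem[OF ab]])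
      also have "\<dots> = \<E> ?a ?a + 2 * \<E> ?a ?b + \<E> ?b ?b" using E.quad_add_scale[OF ab, of 1] by simp
      finally have "\<E> (\<lambda>x. ?a x - ?b x) (\<lambda>x. ?a x - ?b x) \<le> 2 * \<E> ?a ?a + 2 * \<E> ?b ?b"
        using E.quad_diff[OF ab] by simp
      also have "\<dots> < e" using N[of i j] N'[of i j] that by simp
      finally show ?thesis unfolding eq .
    qed
    then show "\<exists>N. \<forall>i\<ge>N. \<forall>j\<ge>N. \<E> (\<lambda>x. d i x - d j x) (\<lambda>x. d i x - d j x) < e" by blast
  qed
  moreover have "AE x in m. (\<lambda>n. s n x) \<longlonglongrightarrow> u x" "AE x in m. (\<lambda>n. t n x) \<longlonglongrightarrow> u x"
    using s(1) t(1) by (auto simp: approx_seq_def)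
  then have "AE x in m. (\<lambda>n. d n x) \<longlonglongrightarrow> 0"
  proof eventually_elim
    case (elim x)
    then show ?case using tendsto_diff[OF elim] by (simp add: d_def)
  qed
  ultimately have "(\<lambda>n. \<E> (d n) (d n)) \<longlonglongrightarrow> 0" by (intro energy_tendsto_0 dD)
  then have d0: "(\<lambda>n. sqrt (\<E> (d n) (d n))) \<longlonglongrightarrow> 0" using tendsto_real_sqrt by fastforce
  have "(\<lambda>n. sqrt (\<E> (s n) (s n)) - sqrt (\<E> (t n) (t n))) \<longlonglongrightarrow> 0"
  proof (rule Lim_null_comparison[OF always_eventually d0])
    show "\<forall>n. norm (sqrt (\<E> (s n) (s n)) - sqrt (\<E> (t n) (t n))) \<le> sqrt (\<E> (d n) (d n))"
      using E.sqrt_diff_le[OF sD tD] by (simp add: d_def[abs_def])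
  qed
  moreover have "(\<lambda>n. sqrt (\<E> (s n) (s n)) - sqrt (\<E> (t n) (t n))) \<longlonglongrightarrow> sqrt c - sqrt c'"
    by (intro tendsto_intros s(2) t(2))
  ultimately have "sqrt c - sqrt c' = 0" by (rule LIMSEQ_unique[rotated])
  then show ?thesis by simp
qed

lemma ext_energy_eq:
  assumes "approx_seq m D \<E> s u" "(\<lambda>n. \<E> (s n) (s n)) \<longlonglongrightarrow> c"
  shows "ext_energy m D \<E> u = c"
  unfolding ext_energy_def using assms ext_energy_unique by (intro the_equality) blast+

text \<open>The tails of \<open>s\<close> generate the midpoint-convex sets \<open>K n\<close> of
  functions that approximate \<open>u\<close> pointwise at least as well as the tail; near-minimizers of the
  energy over \<open>K n\<close> are \<open>\<E>\<close>-Cauchy by the parallelogram law.\<close>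

lemma ext_domain_Fatou:
  assumes s: "\<And>n. s n \<in> D" and u: "u \<in> borel_measurable m" and lim: "AE x in m. (\<lambda>n. s n x) \<longlonglongrightarrow> u x"
    and le: "\<And>e. e > 0 \<Longrightarrow> \<forall>\<^sub>F n in sequentially. \<E> (s n) (s n) \<le> B + e"
  shows "u \<in> ext_domain m D \<E>" "ext_energy m D \<E> u \<le> B"
proof -
  \<comment> \<open>The condition says that |y - u| at x is at most the supremum of |s i - u| over
    the tail. Quantifying over bounds \<open>e\<close> also covers points where that supremum is
    infinite.\<close>
  define K where "K n = {y \<in> D. \<forall>x e. (\<forall>i\<ge>n. \<bar>s i x - u x\<bar> \<le> e) \<longrightarrow> \<bar>y x - u x\<bar> \<le> e}" for n :: nat
  have upper: "\<exists>y\<in>K n. \<E> y y \<le> B + e" if e: "e > 0" for n e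
  proof -
    obtain N where N: "\<And>i. i \<ge> N \<Longrightarrow> \<E> (s i) (s i) \<le> B + e"
      using le[OF e] by (auto simp: eventually_sequentially)
    have "s (max n N) \<in> K n" using s by (auto simp: K_def)
    then show ?thesis using N[of "max n N"] by auto
  qed
  obtain c d where c: "\<And>n. c n \<in> K n" "form_Cauchy \<E> c" "(\<lambda>n. \<E> (c n) (c n) - 2 * 0) \<longlonglongrightarrow> d"
    "\<And>t. (\<And>n. \<exists>y\<in>K n. \<E> y y - 2 * 0 \<le> t) \<Longrightarrow> d \<le> t"
    "\<And>n. \<E> (c n) (c n) - 2 * 0 \<le> d + inverse (real (Suc n))"
  proof (rule E.minimizing_sequence[of "\<lambda>_. 0" K 0 "B + 1"])
    show "K (Suc n) \<subseteq> K n" for n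
    proof
      fix y assume y: "y \<in> K (Suc n)"
      have "\<bar>y x - u x\<bar> \<le> e" if "\<forall>i\<ge>n. \<bar>s i x - u x\<bar> \<le> e" for x e
        using y that by (auto simp: K_def)
      then show "y \<in> K n" using y by (auto simp: K_def)
    qed
    show "(\<lambda>x. (1/2) * (v x + w x)) \<in> K n" if "v \<in> K n" "w \<in> K n" for n v w
    proof -
      have "\<bar>(1/2) * (v x + w x) - u x\<bar> \<le> e" if e: "\<forall>i\<ge>n. \<bar>s i x - u x\<bar> \<le> e" for x e
      proof -
        have "\<bar>v x - u x\<bar> \<le> e" "\<bar>w x - u x\<bar> \<le> e" using \<open>v \<in> K n\<close> \<open>w \<in> K n\<close> e by (auto simp: K_def)
        then have "\<bar>(v x - u x) + (w x - u x)\<bar> \<le> 2 * e" by linarith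
        moreover have "(1/2) * (v x + w x) - u x = (1/2) * ((v x - u x) + (w x - u x))"
          by (simp add: algebra_simps)
        ultimately show ?thesis by (simp only: abs_mult) simp
      qed
      moreover have "v \<in> D" "w \<in> D" using that by (auto simp: K_def)
      ultimately show ?thesis unfolding K_def using E.scale_mem[OF E.add_mem] by blast
    qed
    show "\<exists>y\<in>K n. \<E> y y - 2 * 0 \<le> B + 1" for n using upper[of 1 n] by simp
  qed (auto simp: K_def E.nonneg)
  have cD: "c n \<in> D" for n using c(1) by (auto simp: K_def)
  have "AE x in m. (\<lambda>n. c n x) \<longlonglongrightarrow> u x"
    using lim
  proof eventually_elim
    case (elim x)
    show ?case
    proof (rule LIMSEQ_I)
      fix e :: real assume "e > 0"
      then have "e / 2 > 0" by simp
      then obtain N where N: "\<And>i. i \<ge> N \<Longrightarrow> \<bar>s i x - u x\<bar> < e / 2"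
        using LIMSEQ_D[OF elim] by (metis real_norm_def)
      have "norm (c n x - u x) < e" if "n \<ge> N" for n
      proof -
        have "\<forall>i\<ge>n. \<bar>s i x - u x\<bar> \<le> e / 2" using N that by (meson less_imp_le order_trans)
        then have "\<bar>c n x - u x\<bar> \<le> e / 2" using c(1)[of n] unfolding K_def by blast
        then show ?thesis using \<open>e > 0\<close> by simp
      qed
      then show "\<exists>N. \<forall>n\<ge>N. norm (c n x - u x) < e" by blast
    qed
  qed
  then have a: "approx_seq m D \<E> c u" using cD c(2) by (simp add: approx_seq_def)
  then show "u \<in> ext_domain m D \<E>" using u by (auto simp: ext_domain_def)
  have "ext_energy m D \<E> u = d" using a c(3) by (intro ext_energy_eq) auto
  \<comment> \<open>Every \<open>K n\<close> contains a tail member of \<open>s\<close> with energy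
    at most B + e.\<close>
  also have "d \<le> B"
  proof (rule field_le_epsilon)
    fix e :: real assume "e > 0"
    then show "d \<le> B + e" using upper[of e] by (intro c(4)) auto
  qed
  finally show "ext_energy m D \<E> u \<le> B" .
qed

end


section \<open>Truncations of solutions\<close>

lemma trunc_le: "k \<ge> 0 \<Longrightarrow> \<bar>trunc k u x\<bar> \<le> k"
  by (auto simp: trunc_def)

text \<open>Wherever truncation acts, the truncated value is the endpoint k or -k nearest to u, so
  passing from it to u moves away from every t in the interval.\<close>

lemma trunc_mult_le:
  assumes "\<bar>t\<bar> \<le> k"
  shows "trunc k u x * (trunc k u x - t) \<le> u x * (trunc k u x - t)"
proof -
  have "k \<ge> 0" using assms by linarith
  then consider "u x > k" "trunc k u x = k" | "u x < - k" "trunc k u x = - k" | "trunc k u x = u x"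
    unfolding trunc_def by linarith
  then show ?thesis
  proof cases
    case 1
    then show ?thesis using assms by (simp add: mult_right_mono)
  next
    case 2
    then show ?thesis using assms mult_right_mono_neg[of "u x" "- k" "- k - t"] by simp
  qed simp
qed

text \<open>Truncation at a nonnegative level never reverses the sign of u.\<close>

lemma mult_trunc_nonpos:
  fixes y :: real
  assumes "y * u x \<le> 0" "k \<ge> 0"
  shows "y * trunc k u x \<le> 0"
  using assms by (auto simp: trunc_def mult_le_0_iff min_def max_def)

locale duality_problem = transient_dirichlet m D \<E> g Cg
  for m :: "'a::topological_space measure" and D \<E> g Cg +
  fixes f :: "'a \<Rightarrow> real \<Rightarrow> real" and \<mu> :: "'a set \<Rightarrow> real" and u :: "'a \<Rightarrow> real" and k :: real
  assumes diffuse: "diffuse_measure m D \<E> \<mu>"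
    and sign: "f x y * y \<le> 0"
    and solution: "duality_solution m D \<E> f \<mu> u"
    and k_nonneg: "k \<ge> 0"
begin

abbreviation v :: "'a \<Rightarrow> real" where
  "v \<equiv> trunc k u"

abbreviation fu :: "'a \<Rightarrow> real" where
  "fu \<equiv> \<lambda>x. f x (u x)"

lemma u_measurable[measurable]: "u \<in> borel_measurable m"
  using solution by (simp add: duality_solution_def)

lemma fu_integrable: "integrable m fu"
  using solution by (simp add: duality_solution_def)

lemma fu_measurable[measurable]: "fu \<in> borel_measurable m"
  using fu_integrable by (rule borel_measurable_integrable)

lemma v_measurable[measurable]: "v \<in> borel_measurable m"
  unfolding trunc_def[abs_def] by measurable

lemma v_le: "\<bar>v x\<bar> \<le> k"
  using k_nonneg by (rule trunc_le)

lemma g_cut_integrable: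
  assumes "h \<in> borel_measurable m" "AE x in m. \<bar>h x\<bar> \<le> c"
  shows "integrable m (\<lambda>x. g_cut n x * h x)"
proof (rule Bochner_Integration.integrable_bound)
  show "integrable m (\<lambda>x. g x * c)" using g_integrable by simp
  show "AE x in m. norm (g_cut n x * h x) \<le> norm (g x * c)"
    using assms(2)
  proof eventually_elim
    case (elim x)
    have "g_cut n x * \<bar>h x\<bar> \<le> g x * c"
      using g_cut_bounds g_nonneg elim by (intro mult_mono) auto
    also have "\<dots> \<le> norm (g x * c)" by simp
    finally show ?case using g_cut_bounds(1)[of n x] by (simp add: abs_mult)
  qed
qed (use assms(1) in measurable)

lemma tendsto_integral_fu:
  assumes "\<And>j. s j \<in> borel_measurable m" "\<And>j. AE x in m. \<bar>s j x\<bar> \<le> k" "w \<in> borel_measurable m"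
    and "AE x in m. (\<lambda>j. s j x) \<longlonglongrightarrow> w x"
  shows "(\<lambda>j. LINT x|m. fu x * s j x) \<longlonglongrightarrow> (LINT x|m. fu x * w x)"
proof (rule integral_dominated_convergence)
  show "integrable m (\<lambda>x. \<bar>fu x\<bar> * k)" using fu_integrable by simp
  show "AE x in m. (\<lambda>j. fu x * s j x) \<longlonglongrightarrow> fu x * w x"
    using assms(4) by eventually_elim (intro tendsto_intros)
  show "AE x in m. norm (fu x * s j x) \<le> \<bar>fu x\<bar> * k" for j
    using assms(2)[of j] by eventually_elim (simp add: abs_mult mult_left_mono)
qed (use assms(1,3) in measurable)

text \<open>Testing the equation with \<open>\<eta> = \<beta> \<rho> (v - w)\<close>, where \<open>\<rho> = g_cut n\<close> and \<open>w\<close> is the potential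
  of \<open>\<eta>\<close>, gives the estimate with \<open>w\<close> in place of \<open>s\<close>; the functions in \<open>D\<close> that approximate \<open>w\<close>
  come from adding the killing rates \<open>rate j\<close>.\<close>

lemma approximate_trunc:
  assumes \<beta>: "\<beta> > 0" and \<epsilon>: "\<epsilon> > 0"
  shows "\<exists>s\<in>D. (AE x in m. \<bar>s x\<bar> \<le> k) \<and>
    \<E> s s + \<beta> * (LINT x|m. g_cut n x * (v x - s x)\<^sup>2) \<le> (LINT x|m. fu x * s x) + k * TV_norm \<mu> + \<epsilon>"
proof -
  have vk: "AE x in m. \<bar>v x\<bar> \<le> k" using v_le by simp
  obtain W w where W: "\<And>j. solves (time_change_weight \<beta> n j) (\<lambda>x. \<beta> * g_cut n x * v x) (W j)"
    and wm[measurable]: "w \<in> borel_measurable m" and Wk: "\<And>j. AE x in m. \<bar>W j x\<bar> \<le> k" and wk: "\<And>x. \<bar>w x\<bar> \<le> k"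
    and lim: "AE x in m. (\<lambda>j. W j x) \<longlonglongrightarrow> w x"
    using time_change_limit[OF \<beta> v_measurable vk k_nonneg, of n] by blast
  have Wm[measurable]: "W j \<in> borel_measurable m" for j using W by (rule solves_measurable)
  define \<eta> where "\<eta> = (\<lambda>x. \<beta> * g_cut n x * (v x - w x))"
  have pot: "AE x in m. potential m D \<E> \<eta> x = w x" "\<eta> \<in> L2 m" "integrable m \<eta>"
    and bd: "\<exists>C::real. AE x in m. potential_nn m D \<E> (\<lambda>y. ennreal \<bar>\<eta> y\<bar>) x \<le> ennreal C"
    unfolding \<eta>_def using potential_time_change[OF \<beta> v_measurable vk k_nonneg W wm Wk wk lim] by blast+
  obtain wt where wt: "integrable m (\<lambda>x. u x * \<eta> x)" "qc_version m D \<E> (potential m D \<E> \<eta>) wt"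
    "(LINT x|m. u x * \<eta> x) = (LINT x|m. fu x * potential m D \<E> \<eta> x) + signed_integral \<mu> wt"
    using mp[OF mp[OF spec[OF solution[unfolded duality_solution_def, THEN conjunct2, THEN conjunct2], of \<eta>]
          pot(3)] bd]
    by blast
  note [measurable] = potential_measurable[OF pot(2)]
  have "\<bar>signed_integral \<mu> wt\<bar> \<le> k * TV_norm \<mu>"
  proof (rule signed_integral_qc_bound[OF diffuse wt(2)])
    show "AE x in m. \<bar>potential m D \<E> \<eta> x\<bar> \<le> k" using pot(1) by eventually_elim (simp add: wk)
  qed
  moreover have "(LINT x|m. fu x * potential m D \<E> \<eta> x) = (LINT x|m. fu x * w x)"
    by (rule integral_cong_AE) (use pot(1) in auto)
  \<comment> \<open>Replaces the possibly unbounded u by v, at the price of an inequality in the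
    favorable direction.\<close>
  moreover have "(LINT x|m. \<beta> * g_cut n x * (v x - w x) * v x) \<le> (LINT x|m. u x * \<eta> x)"
  proof (rule integral_mono)
    have "integrable m (\<lambda>x. g_cut n x * (\<beta> * (v x - w x) * v x))"
    proof (rule g_cut_integrable)
      show "AE x in m. \<bar>\<beta> * (v x - w x) * v x\<bar> \<le> \<beta> * (2 * k) * k"
      proof (rule AE_I2)
        fix x
        have "\<bar>v x - w x\<bar> \<le> 2 * k" using v_le[of x] wk[of x] by linarith
        then have "\<beta> * \<bar>v x - w x\<bar> * \<bar>v x\<bar> \<le> \<beta> * (2 * k) * k"
          using \<beta> k_nonneg v_le[of x] by (intro mult_mono) auto
        then show "\<bar>\<beta> * (v x - w x) * v x\<bar> \<le> \<beta> * (2 * k) * k" using \<beta> by (simp add: abs_mult)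
      qed
    qed measurable
    then show "integrable m (\<lambda>x. \<beta> * g_cut n x * (v x - w x) * v x)" by (simp add: mult_ac)
    show "\<beta> * g_cut n x * (v x - w x) * v x \<le> u x * \<eta> x" for x
      using mult_left_mono[OF trunc_mult_le[OF wk[of x], of u x], of "\<beta> * g_cut n x"] \<beta> g_cut_bounds(1)[of n x]
      by (simp add: \<eta>_def mult_ac)
  qed (rule wt(1))
  ultimately have main: "(LINT x|m. \<beta> * g_cut n x * (v x - w x) * v x) \<le> (LINT x|m. fu x * w x) + k * TV_norm \<mu>"
    using wt(3) by linarith
  have energy: "\<E> (W j) (W j) + \<beta> * (LINT x|m. g_cut n x * (v x - W j x)\<^sup>2)
      \<le> (LINT x|m. \<beta> * g_cut n x * (v x - W j x) * v x)" for j
  proof -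
    have WL: "W j \<in> L2 m" by (rule solves_L2[OF W])
    have ivv: "integrable m (\<lambda>x. g_cut n x * (v x * v x))"
    proof (rule g_cut_integrable)
      show "AE x in m. \<bar>v x * v x\<bar> \<le> k * k"
        unfolding abs_mult using v_le k_nonneg by (intro AE_I2 mult_mono) auto
    qed measurable
    have ivW: "integrable m (\<lambda>x. g_cut n x * (v x * W j x))"
    proof (rule g_cut_integrable)
      show "AE x in m. \<bar>v x * W j x\<bar> \<le> k * k"
        using Wk[of j] unfolding abs_mult
        by eventually_elim (rule mult_mono, use v_le k_nonneg in auto)
    qed measurable
    have iWW: "integrable m (\<lambda>x. g_cut n x * (W j x * W j x))"
    proof (rule g_cut_integrable)
      show "AE x in m. \<bar>W j x * W j x\<bar> \<le> k * k"
        using Wk[of j] unfolding abs_mult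
        by eventually_elim (rule mult_mono, use k_nonneg in auto)
    qed measurable
    have "(LINT x|m. \<beta> * (g_cut n x * (W j x * W j x))) \<le> (LINT x|m. time_change_weight \<beta> n j x * (W j x)\<^sup>2)"
    proof (rule integral_mono)
      show "integrable m (\<lambda>x. time_change_weight \<beta> n j x * (W j x)\<^sup>2)"
        using weight_integrable[OF weight_time_change[OF \<beta>] WL WL] by (simp add: power2_eq_square)
      show "\<beta> * (g_cut n x * (W j x * W j x)) \<le> time_change_weight \<beta> n j x * (W j x)\<^sup>2" for x
        using rate_pos[of j] by (simp add: time_change_weight_def power2_eq_square algebra_simps)
    qed (use iWW in simp)
    moreover have "\<E> (W j) (W j) + (LINT x|m. time_change_weight \<beta> n j x * (W j x)\<^sup>2) = \<beta> * (LINT x|m. g_cut n x * (v x * W j x))"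
      using solves_energy(1)[OF weight_time_change[OF \<beta>] W] by (simp add: mult_ac)
    ultimately have 1: "\<E> (W j) (W j) \<le> \<beta> * (LINT x|m. g_cut n x * (v x * W j x)) - \<beta> * (LINT x|m. g_cut n x * (W j x * W j x))"
      by simp
    have 2: "(LINT x|m. g_cut n x * (v x - W j x)\<^sup>2) =
        (LINT x|m. g_cut n x * (v x * v x)) - 2 * (LINT x|m. g_cut n x * (v x * W j x)) + (LINT x|m. g_cut n x * (W j x * W j x))"
    proof -
      have "(\<lambda>x. g_cut n x * (v x - W j x)\<^sup>2) =
          (\<lambda>x. g_cut n x * (v x * v x) - 2 * (g_cut n x * (v x * W j x)) + g_cut n x * (W j x * W j x))"
        by (simp add: fun_eq_iff power2_eq_square algebra_simps)
      then show ?thesis using ivv ivW iWW by simp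
    qed
    have 3: "(LINT x|m. \<beta> * g_cut n x * (v x - W j x) * v x) =
        \<beta> * (LINT x|m. g_cut n x * (v x * v x)) - \<beta> * (LINT x|m. g_cut n x * (v x * W j x))"
    proof -
      have "(\<lambda>x. \<beta> * g_cut n x * (v x - W j x) * v x) =
          (\<lambda>x. \<beta> * (g_cut n x * (v x * v x)) - \<beta> * (g_cut n x * (v x * W j x)))"
        by (simp add: fun_eq_iff algebra_simps)
      then show ?thesis using ivv ivW by simp
    qed
    \<comment> \<open>Adding \<beta> \<rho> (v - W)^2 to the bound \<open>1\<close> completes the
      square: (v - W)^2 + v W - W^2 = (v - W) v.\<close>
    show ?thesis using 1 unfolding 2 3 by (simp add: algebra_simps)
  qed
  have lim1: "(\<lambda>j. LINT x|m. \<beta> * g_cut n x * (v x - W j x) * v x) \<longlonglongrightarrow> (LINT x|m. \<beta> * g_cut n x * (v x - w x) * v x)"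
  proof (rule integral_dominated_convergence)
    show "integrable m (\<lambda>x. \<beta> * g x * (2 * k) * k)" using g_integrable by simp
    show "AE x in m. (\<lambda>j. \<beta> * g_cut n x * (v x - W j x) * v x) \<longlonglongrightarrow> \<beta> * g_cut n x * (v x - w x) * v x"
      using lim by eventually_elim (intro tendsto_intros)
    show "AE x in m. norm (\<beta> * g_cut n x * (v x - W j x) * v x) \<le> \<beta> * g x * (2 * k) * k" for j
      using Wk[of j]
    proof eventually_elim
      case (elim x)
      have "\<beta> * g_cut n x \<le> \<beta> * g x" using \<beta> g_cut_bounds by simp
      moreover have "\<bar>v x - W j x\<bar> \<le> 2 * k" using v_le[of x] elim by linarith
      ultimately have "\<beta> * g_cut n x * \<bar>v x - W j x\<bar> \<le> \<beta> * g x * (2 * k)"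
        by (rule mult_mono) (use \<beta> g_nonneg in auto)
      then have "\<beta> * g_cut n x * \<bar>v x - W j x\<bar> * \<bar>v x\<bar> \<le> \<beta> * g x * (2 * k) * k"
        by (rule mult_mono) (use v_le \<beta> g_nonneg k_nonneg in auto)
      then show ?case using \<beta> g_cut_bounds(1)[of n x] by (simp add: abs_mult)
    qed
  qed measurable
  have lim2: "(\<lambda>j. LINT x|m. fu x * W j x) \<longlonglongrightarrow> (LINT x|m. fu x * w x)"
    by (rule tendsto_integral_fu[OF Wm Wk wm lim])
  \<comment> \<open>The estimate \<open>main\<close> concerns w, which need not lie in D; moving to
    \<open>W j\<close> on each side of it costs \<epsilon> / 2.\<close>
  have "\<forall>\<^sub>F j in sequentially. (LINT x|m. \<beta> * g_cut n x * (v x - W j x) * v x) < (LINT x|m. \<beta> * g_cut n x * (v x - w x) * v x) + \<epsilon> / 2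
      \<and> (LINT x|m. fu x * w x) - \<epsilon> / 2 < (LINT x|m. fu x * W j x)"
    using order_tendstoD(2)[OF lim1] order_tendstoD(1)[OF lim2] \<epsilon> by (intro eventually_conj) auto
  then obtain j where "(LINT x|m. \<beta> * g_cut n x * (v x - W j x) * v x) < (LINT x|m. \<beta> * g_cut n x * (v x - w x) * v x) + \<epsilon> / 2"
      "(LINT x|m. fu x * w x) - \<epsilon> / 2 < (LINT x|m. fu x * W j x)"
    by (auto simp: eventually_sequentially)
  then have "\<E> (W j) (W j) + \<beta> * (LINT x|m. g_cut n x * (v x - W j x)\<^sup>2) \<le> (LINT x|m. fu x * W j x) + k * TV_norm \<mu> + \<epsilon>"
    using energy[of j] main by linarith
  then show ?thesis using Wk[of j] solves_mem[OF W, of j] by blast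
qed

text \<open>Cut level, factor \<beta> and error are tied to one index n. Since everything else in
  the estimate is bounded, the penalty forces the weighted square distance of \<open>s n\<close> to
  v to be of order 1/(n+1); a subsequence then converges a.e., and \<open>ext_domain_Fatou\<close>
  applies to it.\<close>

lemma trunc_energy: "v \<in> ext_domain m D \<E>" "ext_energy m D \<E> v \<le> k * TV_norm \<mu>"
proof -
  define P where "P n s \<longleftrightarrow> s \<in> D \<and> (AE x in m. \<bar>s x\<bar> \<le> k) \<and>
      \<E> s s + real (Suc n) * (LINT x|m. g_cut n x * (v x - s x)\<^sup>2)
        \<le> (LINT x|m. fu x * s x) + k * TV_norm \<mu> + rate n" for n s
  have "\<exists>s. P n s" for n
    using approximate_trunc[of "real (Suc n)" "rate n" n] rate_pos unfolding P_def by auto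
  then obtain s where "\<And>n. P n (s n)" by metis
  then have s: "\<And>n. s n \<in> D" "\<And>n. AE x in m. \<bar>s n x\<bar> \<le> k"
    "\<And>n. \<E> (s n) (s n) + real (Suc n) * (LINT x|m. g_cut n x * (v x - s n x)\<^sup>2)
      \<le> (LINT x|m. fu x * s n x) + k * TV_norm \<mu> + rate n"
    by (auto simp only: P_def)
  have sm[measurable]: "s n \<in> borel_measurable m" for n using s(1) by (rule mem_measurable)
  have dk: "AE x in m. (v x - s n x)\<^sup>2 \<le> (2 * k)\<^sup>2" for n
    using s(2)[of n]
  proof eventually_elim
    case (elim x)
    have "\<bar>v x - s n x\<bar> \<le> \<bar>2 * k\<bar>" using v_le[of x] elim by linarith
    then show ?case by (simp add: abs_le_square_iff)
  qed
  have ic: "integrable m (\<lambda>x. g_cut n x * (v x - s n x)\<^sup>2)" for n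
    using dk[of n] by (intro g_cut_integrable[of _ "(2 * k)\<^sup>2"]) auto
  have ig: "integrable m (\<lambda>x. g x * (v x - s n x)\<^sup>2)" for n
  proof (rule Bochner_Integration.integrable_bound)
    show "integrable m (\<lambda>x. g x * (2 * k)\<^sup>2)" using g_integrable by simp
    show "AE x in m. norm (g x * (v x - s n x)\<^sup>2) \<le> norm (g x * (2 * k)\<^sup>2)"
      using dk[of n]
    proof eventually_elim
      case (elim x)
      have "g x * (v x - s n x)\<^sup>2 \<le> g x * (2 * k)\<^sup>2" using elim g_nonneg by (intro mult_left_mono) auto
      then show ?case using g_nonneg[of x] by (simp add: abs_mult)
    qed
  qed measurable
  have icut: "integrable m (g_cut n)" for n using g_cut_integrable[of "\<lambda>_. 1" 1 n] by simp
  \<comment> \<open>Bounds the right side of the estimate for all n; the final 1 accounts for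
    \<open>rate n\<close>.\<close>
  define C where "C = (LINT x|m. \<bar>fu x\<bar>) * k + \<bar>k * TV_norm \<mu>\<bar> + 1"
  have fle: "(LINT x|m. fu x * s n x) \<le> (LINT x|m. \<bar>fu x\<bar>) * k" for n
  proof -
    have b: "AE x in m. \<bar>fu x * s n x\<bar> \<le> \<bar>fu x\<bar> * k"
      using s(2)[of n] by eventually_elim (simp add: abs_mult mult_left_mono)
    have "integrable m (\<lambda>x. fu x * s n x)"
      by (rule Bochner_Integration.integrable_bound[of m "\<lambda>x. \<bar>fu x\<bar> * k"])
        (use b fu_integrable k_nonneg in \<open>auto simp: abs_mult\<close>)
    then have "(LINT x|m. fu x * s n x) \<le> (LINT x|m. \<bar>fu x\<bar> * k)"
      using b fu_integrable by (intro integral_mono_AE) auto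
    then show ?thesis by simp
  qed
  have cut_le: "(LINT x|m. g_cut n x * (v x - s n x)\<^sup>2) \<le> C * rate n" for n
  proof -
    have "rate n \<le> 1" using rate_antimono[of 0 n] by (simp add: rate_def)
    then have "real (Suc n) * (LINT x|m. g_cut n x * (v x - s n x)\<^sup>2) \<le> C"
      using s(3)[of n] E.nonneg[OF s(1)[of n]] fle[of n] unfolding C_def by linarith
    then show ?thesis by (simp add: rate_def field_simps)
  qed
  \<comment> \<open>On the part of g removed by the cut there is no penalty, but the integrand is at
    most (2 k)^2 times the removed density, whose integral tends to 0.\<close>
  have split: "(LINT x|m. norm (g x * (v x - s n x)\<^sup>2)) \<le> C * rate n + (2 * k)\<^sup>2 * (LINT x|m. g x - g_cut n x)" for n
  proof -
    have "(LINT x|m. norm (g x * (v x - s n x)\<^sup>2)) = (LINT x|m. g x * (v x - s n x)\<^sup>2)"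
      using g_nonneg by simp
    also have "\<dots> \<le> (LINT x|m. g_cut n x * (v x - s n x)\<^sup>2 + (2 * k)\<^sup>2 * (g x - g_cut n x))"
    proof (rule integral_mono_AE)
      show "AE x in m. g x * (v x - s n x)\<^sup>2 \<le> g_cut n x * (v x - s n x)\<^sup>2 + (2 * k)\<^sup>2 * (g x - g_cut n x)"
        using dk[of n]
      proof eventually_elim
        case (elim x)
        have "(g x - g_cut n x) * (v x - s n x)\<^sup>2 \<le> (g x - g_cut n x) * (2 * k)\<^sup>2"
          using elim g_cut_bounds by (intro mult_left_mono) auto
        then show ?case by (simp add: algebra_simps)
      qed
    qed (use ig ic icut g_integrable in auto)
    also have "\<dots> = (LINT x|m. g_cut n x * (v x - s n x)\<^sup>2) + (2 * k)\<^sup>2 * (LINT x|m. g x - g_cut n x)"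
      using ic icut g_integrable by simp
    finally show ?thesis using cut_le[of n] by simp
  qed
  have tail: "(\<lambda>n. LINT x|m. g x - g_cut n x) \<longlonglongrightarrow> (LINT x|m. 0)"
  proof (rule integral_dominated_convergence[of _ _ _ g])
    show "AE x in m. (\<lambda>n. g x - g_cut n x) \<longlonglongrightarrow> 0"
      using g_cut_tendsto
    proof eventually_elim
      case (elim x)
      show ?case using tendsto_diff[OF tendsto_const[of "g x"] elim] by simp
    qed
    show "AE x in m. norm (g x - g_cut n x) \<le> g x" for n
      using g_cut_bounds by (auto simp: abs_le_iff)
  qed (use g_integrable in auto)
  have "(\<lambda>n. C * rate n + (2 * k)\<^sup>2 * (LINT x|m. g x - g_cut n x)) \<longlonglongrightarrow> C * 0 + (2 * k)\<^sup>2 * (LINT x|m. 0)"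
    by (intro tendsto_intros rate_tendsto tail)
  then have up: "(\<lambda>n. C * rate n + (2 * k)\<^sup>2 * (LINT x|m. g x - g_cut n x)) \<longlonglongrightarrow> 0" by simp
  have "(\<lambda>n. LINT x|m. norm (g x * (v x - s n x)\<^sup>2)) \<longlonglongrightarrow> 0"
    by (rule tendsto_sandwich[OF _ _ tendsto_const up])
      (use split g_nonneg in \<open>auto intro!: always_eventually integral_nonneg_AE\<close>)
  then obtain r :: "nat \<Rightarrow> nat" where r: "strict_mono r" "AE x in m. (\<lambda>n. g x * (v x - s (r n) x)\<^sup>2) \<longlonglongrightarrow> 0"
    using tendsto_L1_AE_subseq[of m "\<lambda>n x. g x * (v x - s n x)\<^sup>2"] ig by auto
  have slim: "AE x in m. (\<lambda>n. s (r n) x) \<longlonglongrightarrow> v x"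
    using r(2) g_pos
  proof eventually_elim
    case (elim x)
    have "(\<lambda>n. (1 / g x) * (g x * (v x - s (r n) x)\<^sup>2)) \<longlonglongrightarrow> (1 / g x) * 0"
      by (intro tendsto_mult tendsto_const elim)
    then have "(\<lambda>n. (v x - s (r n) x)\<^sup>2) \<longlonglongrightarrow> 0" using elim(2) by simp
    then have "(\<lambda>n. \<bar>v x - s (r n) x\<bar>) \<longlonglongrightarrow> 0" using tendsto_real_sqrt by fastforce
    then have "(\<lambda>n. v x - s (r n) x) \<longlonglongrightarrow> 0" by (simp add: tendsto_rabs_zero_iff)
    then show ?case using tendsto_diff[OF tendsto_const[of "v x"]] by fastforce
  qed
  have lim: "(\<lambda>n. LINT x|m. fu x * s (r n) x) \<longlonglongrightarrow> (LINT x|m. fu x * v x)"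
    by (rule tendsto_integral_fu[OF sm s(2) v_measurable slim])
  \<comment> \<open>The sign condition speaks about u and hence about v, not about the approximants
    \<open>s n\<close>, so it is used only after the passage to the limit.\<close>
  have neg: "(LINT x|m. fu x * v x) \<le> 0"
  proof -
    have "fu x * v x \<le> 0" for x by (rule mult_trunc_nonpos[OF sign k_nonneg])
    then have "0 \<le> (LINT x|m. - (fu x * v x))" by (intro integral_nonneg_AE) auto
    then show ?thesis by simp
  qed
  have "(\<lambda>n. rate (r n)) \<longlonglongrightarrow> 0"
    using LIMSEQ_subseq_LIMSEQ[OF rate_tendsto r(1)] by (simp add: o_def)
  with lim have lim': "(\<lambda>n. (LINT x|m. fu x * s (r n) x) + rate (r n)) \<longlonglongrightarrow> (LINT x|m. fu x * v x) + 0"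
    by (rule tendsto_add)
  have le: "\<forall>\<^sub>F n in sequentially. \<E> (s (r n)) (s (r n)) \<le> k * TV_norm \<mu> + e" if "e > 0" for e
  proof -
    have "\<forall>\<^sub>F n in sequentially. (LINT x|m. fu x * s (r n) x) + rate (r n) < e"
      using order_tendstoD(2)[OF lim', of e] neg that by simp
    then show ?thesis
    proof eventually_elim
      case (elim n)
      have "0 \<le> real (Suc (r n)) * (LINT x|m. g_cut (r n) x * (v x - s (r n) x)\<^sup>2)"
        using g_cut_bounds(1) by (intro mult_nonneg_nonneg integral_nonneg_AE) auto
      then show ?case using s(3)[of "r n"] elim by linarith
    qed
  qed
  show "v \<in> ext_domain m D \<E>" "ext_energy m D \<E> v \<le> k * TV_norm \<mu>"
    using ext_domain_Fatou[OF s(1) v_measurable slim le] by auto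
qed

end

theorem proposition3p8:
  fixes m :: "'a::metric_space measure"
    and D :: "('a \<Rightarrow> real) set"
    and \<E> :: "('a \<Rightarrow> real) \<Rightarrow> ('a \<Rightarrow> real) \<Rightarrow> real"
    and \<mu> :: "'a set \<Rightarrow> real"
    and f :: "'a \<Rightarrow> real \<Rightarrow> real"
    and u :: "'a \<Rightarrow> real"
    and k :: real
  assumes "locally_compact_space (euclidean :: 'a topology)"
    and "separable_space (euclidean :: 'a topology)"
    and "Radon_full_support m"
    and "Dirichlet_form m D \<E>"
    and "regular_form m D \<E>"
    and "transient_form m D \<E>"
    and "diffuse_measure m D \<E> \<mu>"
    and "Caratheodory f"
    and "\<And>x. f x 0 = 0"
    and "\<And>x y. f x y * y \<le> 0"
    and "duality_solution m D \<E> f \<mu> u"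
    and "k \<ge> 0"
  shows "trunc k u \<in> ext_domain m D \<E> \<and>
         ext_energy m D \<E> (trunc k u) \<le> 2 * k * TV_norm \<mu>"
proof -
  interpret dirichlet m D \<E> by unfold_locales (rule assms(4))
  obtain g where g: "bounded (range g)" "integrable m g" "AE x in m. 0 < g x"
    "\<And>u. u \<in> D \<Longrightarrow> (LINT x|m. \<bar>u x\<bar> * g x) \<le> sqrt (\<E> u u)"
    using assms(6) unfolding transient_form_def by blast
  obtain C where C: "\<And>x. \<bar>g x\<bar> \<le> C" using g(1) by (auto simp: bounded_iff)
  \<comment> \<open>Transience provides positivity m-a.e. only; the positive part is nonnegative
    everywhere and leaves all integrals unchanged.\<close>
  define g' where "g' x = max 0 (g x)" for x
  have [measurable]: "g \<in> borel_measurable m" using g(2) by simp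
  have [measurable]: "g' \<in> borel_measurable m" unfolding g'_def[abs_def] by measurable
  have ae: "AE x in m. g' x = g x" using g(3) by eventually_elim (simp add: g'_def)
  interpret duality_problem m D \<E> g' C f \<mu> u k
  proof
    show "integrable m g'" unfolding g'_def[abs_def] using g(2) by simp
    show "0 \<le> g' x" for x by (simp add: g'_def)
    show "g' x \<le> C" for x using C[of x] by (auto simp: g'_def)
    show "AE x in m. 0 < g' x" using ae g(3) by eventually_elim simp
    show "(LINT x|m. \<bar>u x\<bar> * g' x) \<le> sqrt (\<E> u u)" if "u \<in> D" for u
    proof -
      have [measurable]: "u \<in> borel_measurable m" using that by (rule mem_measurable)
      have "(LINT x|m. \<bar>u x\<bar> * g' x) = (LINT x|m. \<bar>u x\<bar> * g x)"
        by (rule integral_cong_AE) (use ae in auto)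
      then show ?thesis using g(4)[OF that] by simp
    qed
  qed (rule assms)+
  \<comment> \<open>Needed to weaken the sharper bound just proved to the stated one.\<close>
  have "0 \<le> k * TV_norm \<mu>" using assms(12) by (simp add: TV_norm_def)
  then show ?thesis using trunc_energy by simp
qed

end
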